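(* Let $0<\beta<1$ and let $u:\mathbb{D}\to[-\infty,0)$ be defined by $$u(z)=\int_0^1\log\left|\frac{z-s}{1-sz}\right|\frac{ds}{(1-s)^\beta}.$$ For $\frac{1-\beta}{2}\le\alpha<\frac12$ the function $$f(z)=\frac{1}{(1-z)^\alpha}$$ is in $H^2(\mathbb{D})$ but not in $H^2_u(\mathbb{D})$.
   Context: $\mathbb{D}=\{z\in\mathbb{C}:|z|<1\}$, $\mathbb{T}=\partial\mathbb{D}$, and $\lambda$ is the normalized Lebesgue measure on $\mathbb{T}$. The power $(1-z)^\alpha$ is the principal branch. $\Delta$ is the distributional Laplace operator normalized so that $\Delta\log|z|=\delta_0$; for a subharmonic function $v$, $\Delta v$ is a positive measure. $\mathcal{E}$ is the set of continuous subharmonic functions $u:\mathbb{D}\to[-\infty,0)$ such that $u(z)\to0$ as $|z|\to1$ and $\int_{\mathbb{D}}\Delta u<\infty$; the function $u$ in the claim belongs to $\mathcal{E}$. For $u\in\mathcal{E}$ and $r<0$ put $B_{u,r}=\{z\in\mathbb{D}:u(z)<r\}$, $S_{u,r}=\{z\in\mathbb{D}:u(z)=r\}$, $u_r=\max\{u,r\}$, and $\mu_{u,r}=\Delta u_r-\chi_{\mathbb{D}\setminus B_{u,r}}\Delta u$; this is a positive measure supported by $S_{u,r}$. For every non-negative subharmonic $\phi$ on $\mathbb{D}$ the function $r\mapsto\int\phi\,d\mu_{u,r}$ is increasing on $(-\infty,0)$ (Demailly). $H^2_u(\mathbb{D})$ is the space of analytic functions $f$ on $\mathbb{D}$ with $\|f\|^2_{H^2_u}=\lim_{r\to0^-}\int_{S_{u,r}}|f|^2\,d\mu_{u,r}<\infty$.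 $H^2(\mathbb{D})$ is the classical Hardy space, with $\|f\|^2_{H^2}=\sup_{0\le\rho<1}\int_{\mathbb{T}}|f(\rho e^{i\theta})|^2\,d\lambda(\theta)$. *)

theory Defs
  imports "HOL-Analysis.Analysis"
begin

abbreviation unit_disc :: "complex set" where
  "unit_disc \<equiv> ball 0 1"

text \<open>The normalized Lebesgue measure on the unit circle, as a Borel measure on the plane.\<close>

definition circle_measure :: "complex measure" where
  "circle_measure = distr (uniform_measure lborel {0..<2 * pi}) borel cis"

primrec Ck :: "nat \<Rightarrow> (complex \<Rightarrow> real) \<Rightarrow> bool" where
  "Ck 0 \<phi> \<longleftrightarrow> continuous_on UNIV \<phi>"
| "Ck (Suc k) \<phi> \<longleftrightarrow>
     (\<forall>z. \<phi> differentiable at z) \<and> (\<forall>v. Ck k (\<lambda>z. frechet_derivative \<phi> (at z) v))"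

text \<open>Smoothness is in the real sense, on the plane.\<close>

definition test_functions :: "(complex \<Rightarrow> real) set" where
  "test_functions =
     {\<phi>. (\<forall>k. Ck k \<phi>) \<and> compact (closure {z. \<phi> z \<noteq> 0}) \<and> closure {z. \<phi> z \<noteq> 0} \<subseteq> unit_disc}"

text \<open>The classical Laplacian \<open>\<partial>\<^sub>x\<^sub>x + \<partial>\<^sub>y\<^sub>y\<close>, without normalization
  (\<open>Basis = {1, \<i>}\<close>).\<close>

definition laplace :: "(complex \<Rightarrow> real) \<Rightarrow> complex \<Rightarrow> real" where
  "laplace \<phi> z =
     (\<Sum>b\<in>Basis. frechet_derivative (\<lambda>w. frechet_derivative \<phi> (at w) b) (at z) b)"

text \<open>
  \<open>M\<close> is the distributional Laplacian of \<open>v\<close> on the disc. The factor \<open>1 / (2 * pi)\<close> makes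
  the Laplacian of \<open>log \<bar>z\<bar>\<close> the unit point mass at \<open>0\<close>. A subharmonic function is locally
  integrable, so its values \<open>-\<infinity>\<close>, which \<^const>\<open>real_of_ereal\<close> sends to \<open>0\<close>, do not
  influence the integrals.
\<close>

definition is_laplacian_measure :: "(complex \<Rightarrow> ereal) \<Rightarrow> complex measure \<Rightarrow> bool" where
  "is_laplacian_measure v M \<longleftrightarrow>
     sets M = sets (restrict_space borel unit_disc) \<and>
     (\<forall>K. compact K \<and> K \<subseteq> unit_disc \<longrightarrow>
        emeasure M K < \<infinity> \<and> set_integrable lborel K (\<lambda>z. real_of_ereal (v z))) \<and>
     (\<forall>\<phi>\<in>test_functions.
        (\<integral>z. \<phi> z \<partial>M) =
        1 / (2 * pi) * (\<integral>z\<in>unit_disc. real_of_ereal (v z) * laplace \<phi> z \<partial>lborel))"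

definition laplacian_measure :: "(complex \<Rightarrow> ereal) \<Rightarrow> complex measure" where
  "laplacian_measure v = (THE M. is_laplacian_measure v M)"

definition sublevel :: "(complex \<Rightarrow> ereal) \<Rightarrow> real \<Rightarrow> complex set" where
  "sublevel u r = {z \<in> unit_disc. u z < ereal r}"

definition level :: "(complex \<Rightarrow> ereal) \<Rightarrow> real \<Rightarrow> complex set" where
  "level u r = {z \<in> unit_disc. u z = ereal r}"

text \<open>The Monge-Ampere measure of Demailly,
  \<open>\<mu>\<^sub>u\<^sub>,\<^sub>r = \<Delta> (max u r) - \<chi> \<Delta> u\<close>, with \<open>\<chi>\<close> the indicator of the complement of the sublevel set.\<close>

definition demailly_measure :: "(complex \<Rightarrow> ereal) \<Rightarrow> real \<Rightarrow> complex measure" where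
  "demailly_measure u r =
     diff_measure (laplacian_measure (\<lambda>z. max (u z) (ereal r)))
       (density (laplacian_measure u) (indicator (unit_disc - sublevel u r)))"

text \<open>
  The squared norms take values in \<open>[0, \<infinity>]\<close>. The space is meant for \<open>u\<close> continuous, negative
  and subharmonic on the disc, with boundary values \<open>0\<close> and a Laplacian of finite mass; the
  integrals below then increase with \<open>r\<close> for every analytic \<open>f\<close>, so that the limit exists.
\<close>

definition poletsky_stessin_norm2 :: "(complex \<Rightarrow> ereal) \<Rightarrow> (complex \<Rightarrow> complex) \<Rightarrow> ennreal" where
  "poletsky_stessin_norm2 u f =
     Lim (at_left (0::real))
       (\<lambda>r. \<integral>\<^sup>+z\<in>level u r. ennreal ((cmod (f z))\<^sup>2) \<partial>demailly_measure u r)"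

definition poletsky_stessin_hardy :: "(complex \<Rightarrow> ereal) \<Rightarrow> (complex \<Rightarrow> complex) set" where
  "poletsky_stessin_hardy u =
     {f. f holomorphic_on unit_disc \<and> poletsky_stessin_norm2 u f < \<infinity>}"

definition hardy_norm2 :: "(complex \<Rightarrow> complex) \<Rightarrow> ennreal" where
  "hardy_norm2 f =
     (SUP \<rho>\<in>{0..<1::real}. \<integral>\<^sup>+\<zeta>. ennreal ((cmod (f (of_real \<rho> * \<zeta>)))\<^sup>2) \<partial>circle_measure)"

definition hardy :: "(complex \<Rightarrow> complex) set" where
  "hardy = {f. f holomorphic_on unit_disc \<and> hardy_norm2 f < \<infinity>}"

end

theory Submission
  imports Defs "HOL-Probability.Sinc_Integral" "HOL-Complex_Analysis.Complex_Analysis"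
begin

text \<open>On the unit disc \<open>\<bar>f z\<bar>\<^sup>2 = \<bar>1 - z\<bar> powr (- 2\<alpha>)\<close>. On the circle this has an integrable singularity at \<open>1\<close>, because
\<open>2\<alpha> < 1\<close>; hence \<open>f\<close> lies in the Hardy space (\<open>one_minus_powr_hardy\<close>).

The Laplacian of \<open>u\<close> is the measure \<open>\<rho> ds\<close> on the segment \<open>(0, 1)\<close>, with \<open>\<rho> s = (1 - s) powr (- \<beta>)\<close>. The
real part \<open>\<phi>\<close> of \<open>(1 - z) powr (- 2\<alpha>)\<close> is harmonic, it is at most \<open>\<bar>f\<bar>\<^sup>2\<close>, and it equals \<open>\<bar>f\<bar>\<^sup>2\<close> on the
segment. The Lelong-Jensen formula for a harmonic function says that the Demailly measure of the level
\<open>r\<close> integrates \<open>\<phi>\<close> to the integral of \<open>\<phi>\<close> against the Laplacian of \<open>u\<close> over the sublevel set. So the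
integral of \<open>\<bar>f\<bar>\<^sup>2\<close> over the level set is at least the integral of \<open>(1 - s) powr (- 2\<alpha> - \<beta>)\<close> over the points
\<open>s\<close> of the segment with \<open>u s < r\<close>. As \<open>r\<close> tends to \<open>0\<close> these points fill the segment, and the integral
diverges because \<open>2\<alpha> + \<beta> \<ge> 1\<close> (\<open>level_integral_lower_bound\<close>, \<open>poletsky_stessin_norm2_infinite\<close>).

Most of the work goes into the Demailly measure, which is built from distributional Laplacians, each of them
introduced by a definite description. Such a Laplacian is unique because test functions approximate the
indicators of open boxes (\<open>is_laplacian_measure_unique\<close>). Existence for \<open>max u r\<close> is shown by writing the
measure down. Every kernel \<open>log \<bar>(z - s) / (1 - s z)\<bar>\<close> with real \<open>s\<close> increases along vertical lines as one
leaves the real axis, hence so does \<open>u\<close>, and the level set \<open>u = r\<close> consists of a graph over the real axis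
and its mirror image. In the upper half disc \<open>u\<close> is the real part of a holomorphic function, so that
\<open>\<partial>\<^sub>yu > 0\<close> and \<open>\<Delta>(\<chi> \<circ> u) = (\<chi>'' \<circ> u) \<bar>\<nabla>u\<bar>\<^sup>2\<close> for every smooth \<open>\<chi>\<close>. Green's formula in the half planes
\<open>Im z \<ge> \<delta>\<close>, applied to convex \<open>\<chi>\<close> that approach \<open>max \<cdot> r\<close>, produces the density \<open>\<bar>\<nabla>u\<bar>\<^sup>2 / \<partial>\<^sub>yu\<close> on the
graph (\<open>level_formula\<close>). As \<open>\<delta>\<close> tends to \<open>0\<close>, the boundary term on the line \<open>Im z = \<delta>\<close> is, up to a small error, a Poisson integral
of \<open>\<rho>\<close> and converges to the part of \<open>\<Delta> u\<close> on which \<open>u \<ge> r\<close> (\<open>level_limit\<close>, \<open>laplacian_formula\<close>). Thus the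
Demailly measure is the measure on the graphs (\<open>demailly_measure_eq\<close>), and the case of a level below the
minimum of \<open>u\<close> identifies \<open>\<Delta> u\<close> itself.\<close>

section \<open>Smooth functions\<close>

text \<open>The classical flat function \<open>exp (- 1 / t)\<close>, divided by \<open>t ^ m\<close> so that the family is closed under
derivatives up to linear combinations.\<close>

definition flat :: "nat \<Rightarrow> real \<Rightarrow> real" where
  "flat m t = (if t > 0 then exp (- 1 / t) / t ^ m else 0)"

lemma flat_nonneg: "0 \<le> flat m t"
  by (simp add: flat_def)

lemma flat_tendsto_0: "(flat m \<longlongrightarrow> 0) (at 0)"
proof -
  have 1: "((\<lambda>x::real. x ^ m / exp x) \<longlongrightarrow> 0) at_top"
    by (rule tendsto_power_div_exp_0)
  have 2: "((\<lambda>t::real. inverse t ^ m / exp (inverse t)) \<longlongrightarrow> 0) (at_right 0)"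
    by (rule filterlim_compose[OF 1 filterlim_inverse_at_top_right])
  have r: "(flat m \<longlongrightarrow> 0) (at_right 0)"
    by (rule Lim_transform_eventually[OF 2])
      (auto simp: eventually_at_right_field flat_def exp_minus field_simps intro!: exI[of _ 1])
  have l: "(flat m \<longlongrightarrow> 0) (at_left 0)"
    by (rule Lim_transform_eventually[OF tendsto_const])
      (auto simp: eventually_at_left_field flat_def intro!: exI[of _ "-1"])
  show ?thesis
    using l r by (simp add: filterlim_split_at)
qed

lemma flat_has_derivative:
  "(flat m has_real_derivative flat (m + 2) t - real m * flat (m + 1) t) (at t)"
proof (cases t "0::real" rule: linorder_cases)
  case less
  have "((\<lambda>_. 0) has_real_derivative flat (m + 2) t - real m * flat (m + 1) t) (at t)"
    using less by (simp add: flat_def)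
  then show ?thesis
    by (rule has_field_derivative_transform_within_open[of _ _ _ "{..<0}"])
      (use less in \<open>auto simp: flat_def\<close>)
next
  case equal
  have "((\<lambda>h. (flat m (0 + h) - flat m 0) / h) \<longlongrightarrow> 0) (at 0)"
    by (rule Lim_transform_eventually[OF flat_tendsto_0[of "m + 1"]])
      (auto simp: eventually_at flat_def field_simps intro!: exI[of _ 1])
  then show ?thesis
    using equal by (simp add: DERIV_def flat_def)
next
  case greater
  have "((\<lambda>t. exp (- 1 / t) / t ^ m) has_real_derivative
      flat (m + 2) t - real m * flat (m + 1) t) (at t)"
  proof (cases m)
    case 0
    then show ?thesis
      using greater
      by (auto intro!: derivative_eq_intros simp: flat_def field_simps power2_eq_square)
  next
    case (Suc n)
    then show ?thesis
      using greater
      by (auto intro!: derivative_eq_intros simp: flat_def divide_simps power2_eq_square)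
        (cases n; auto simp: algebra_simps)+
  qed
  then show ?thesis
    by (rule has_field_derivative_transform_within_open[of _ _ _ "{0<..}"])
      (use greater in \<open>auto simp: flat_def\<close>)
qed

lemma continuous_flat: "isCont (flat m) t"
  using DERIV_isCont flat_has_derivative by blast

lemma antiderivative_exists:
  fixes f :: "real \<Rightarrow> real"
  assumes "\<And>x. isCont f x"
  shows "\<exists>F. F 0 = 0 \<and> (\<forall>x. (F has_real_derivative f x) (at x))"
proof -
  obtain F where F: "\<And>x. (F has_vector_derivative f x) (at x)"
    using einterval_antiderivative[of "-\<infinity>" "\<infinity>" f] assms by auto
  have "((\<lambda>x. F x - F 0) has_real_derivative f x) (at x)" for x
    using F[of x] by (auto intro!: derivative_eq_intros simp: has_real_derivative_iff_has_vector_derivative)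
  then show ?thesis
    by (intro exI[of _ "\<lambda>x. F x - F 0"]) auto
qed

text \<open>A primitive of the bump \<open>exp (- 1 / t) exp (- 1 / (1 - t))\<close>, normalized to run from \<open>0\<close> to \<open>1\<close>.\<close>

lemma smooth_step_exists:
  "\<exists>S c. 0 < c \<and> (\<forall>t. (S has_real_derivative c * (flat 0 t * flat 0 (1 - t))) (at t)) \<and>
    (\<forall>t\<le>0. S t = 0) \<and> (\<forall>t\<ge>1. S t = 1)"
proof -
  let ?k = "\<lambda>t::real. flat 0 t * flat 0 (1 - t)"
  have "isCont ?k t" for t
    by (intro continuous_intros continuous_flat isCont_o2[OF _ continuous_flat])
  then obtain F where F0: "F 0 = 0" and F: "\<And>t. (F has_real_derivative ?k t) (at t)"
    using antiderivative_exists[of ?k] by blast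
  have "F 0 < F 1"
  proof (rule DERIV_pos_imp_increasing_open[OF zero_less_one])
    fix x :: real assume "0 < x" "x < 1"
    then show "\<exists>y. (F has_real_derivative y) (at x) \<and> 0 < y"
      using F[of x] by (intro exI[of _ "?k x"]) (auto simp: flat_def)
  next
    show "continuous_on {0..1} F"
      using F by (meson DERIV_isCont continuous_at_imp_continuous_on)
  qed
  have contF: "continuous_on A F" for A
    using F by (meson DERIV_isCont continuous_at_imp_continuous_on)
  have neg: "F t = 0" if "t \<le> 0" for t
  proof (cases "t = 0")
    case False
    have "(F has_real_derivative 0) (at x)" if "x < 0" for x
      using F[of x] that by (simp add: flat_def)
    with that False have "F 0 = F t"
      by (intro DERIV_isconst_end contF) auto
    then show ?thesis using F0 by simp
  qed (use F0 in auto)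
  have pos: "F t = F 1" if "t \<ge> 1" for t
  proof (cases "t = 1")
    case False
    have "(F has_real_derivative 0) (at x)" if "1 < x" for x
      using F[of x] that by (simp add: flat_def)
    with that False show ?thesis
      by (intro DERIV_isconst_end contF) auto
  qed auto
  define S where "S t = F t / F 1" for t
  have "(S has_real_derivative (1 / F 1) * ?k t) (at t)" for t
    unfolding S_def[abs_def] using \<open>F 0 < F 1\<close> F0
    by (auto intro!: derivative_eq_intros F)
  moreover have "0 < 1 / F 1"
    using \<open>F 0 < F 1\<close> F0 by simp
  moreover have "S t = 0" if "t \<le> 0" for t
    using neg[OF that] by (simp add: S_def)
  moreover have "S t = 1" if "t \<ge> 1" for t
    using pos[OF that] \<open>F 0 < F 1\<close> F0 by (simp add: S_def)
  ultimately show ?thesis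
    by blast
qed

definition smooth_step :: "real \<Rightarrow> real" where
  "smooth_step = (SOME S. \<exists>c. 0 < c \<and>
     (\<forall>t. (S has_real_derivative c * (flat 0 t * flat 0 (1 - t))) (at t)) \<and>
     (\<forall>t\<le>0. S t = 0) \<and> (\<forall>t\<ge>1. S t = 1))"

lemma smooth_step_props:
  "\<exists>c>0. \<forall>t. (smooth_step has_real_derivative c * (flat 0 t * flat 0 (1 - t))) (at t)"
  "t \<le> 0 \<Longrightarrow> smooth_step t = 0"
  "t \<ge> 1 \<Longrightarrow> smooth_step t = 1"
proof -
  from someI_ex[OF smooth_step_exists, folded smooth_step_def]
  obtain c where c: "0 < c"
    "\<forall>t. (smooth_step has_real_derivative c * (flat 0 t * flat 0 (1 - t))) (at t)"
    "\<forall>t\<le>0. smooth_step t = 0" "\<forall>t\<ge>1. smooth_step t = 1"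
    by (elim exE conjE)
  show "\<exists>c>0. \<forall>t. (smooth_step has_real_derivative c * (flat 0 t * flat 0 (1 - t))) (at t)"
    by (intro exI[of _ c] conjI c)
  show "t \<le> 0 \<Longrightarrow> smooth_step t = 0" "t \<ge> 1 \<Longrightarrow> smooth_step t = 1"
    using c by simp_all
qed

lemma smooth_step_bounds: "0 \<le> smooth_step t" "smooth_step t \<le> 1"
proof -
  obtain c where c: "0 < c" "\<And>t. (smooth_step has_real_derivative c * (flat 0 t * flat 0 (1 - t))) (at t)"
    using smooth_step_props(1) by blast
  have "0 \<le> c * (flat 0 t * flat 0 (1 - t))" for t
    using c(1) by (intro mult_nonneg_nonneg flat_nonneg) auto
  then have mono: "smooth_step s \<le> smooth_step t" if "s \<le> t" for s t
    using that c(2) by (meson DERIV_nonneg_imp_nondecreasing)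
  show "0 \<le> smooth_step t" "smooth_step t \<le> 1"
    using mono[of "min t 0" t] mono[of t "max t 1"] smooth_step_props(2)[of "min t 0"] smooth_step_props(3)[of "max t 1"]
    by auto
qed

text \<open>Instead of a calculus of smooth functions, an inductive class that contains every test function needed
below. It is designed to be closed under partial derivatives, which makes its members smooth. The last rule
cuts off harmonic functions that are defined on the disc only.\<close>

inductive smooth :: "(complex \<Rightarrow> real) \<Rightarrow> bool" where
  smooth_const: "smooth (\<lambda>_. c)"
| smooth_Re: "smooth Re"
| smooth_Im: "smooth Im"
| smooth_add: "smooth f \<Longrightarrow> smooth g \<Longrightarrow> smooth (\<lambda>z. f z + g z)"
| smooth_mult: "smooth f \<Longrightarrow> smooth g \<Longrightarrow> smooth (\<lambda>z. f z * g z)"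
| smooth_flat: "smooth g \<Longrightarrow> smooth (\<lambda>z. flat m (g z))"
| smooth_smooth_step: "smooth g \<Longrightarrow> smooth (\<lambda>z. smooth_step (g z))"
| smooth_cutoff: "smooth g \<Longrightarrow> R < 1 \<Longrightarrow> (\<And>z. R < cmod z \<Longrightarrow> g z = 0) \<Longrightarrow>
    Q holomorphic_on unit_disc \<Longrightarrow> smooth (\<lambda>z. g z * Re (Q z))"

lemma smooth_diff: "smooth f \<Longrightarrow> smooth g \<Longrightarrow> smooth (\<lambda>z. f z - g z)"
  using smooth_add[OF _ smooth_mult[OF smooth_const[of "-1"]], of f g] by simp

lemma has_derivative_compose_real:
  fixes g :: "complex \<Rightarrow> real"
  assumes "(g has_derivative (\<lambda>v. Re v * D1 + Im v * D2)) (at z)"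
    and "(h has_real_derivative d) (at (g z))"
  shows "((\<lambda>z. h (g z)) has_derivative (\<lambda>v. Re v * (d * D1) + Im v * (d * D2))) (at z)"
proof -
  have "((\<lambda>z. h (g z)) has_derivative (\<lambda>v. d * (Re v * D1 + Im v * D2))) (at z)"
    using has_derivative_compose[OF assms(1) assms(2)[unfolded has_field_derivative_def]] .
  then show ?thesis
    by (simp add: algebra_simps)
qed

text \<open>The partial derivatives of each generator lie in the class again: the derivatives of the flat functions and
of the smooth step are built from flat functions. A cutoff vanishes on an open set, and so do its partial
derivatives, which therefore cut off as well.\<close>

lemma smooth_gradient:
  assumes "smooth g"
  shows "\<exists>D1 D2. smooth D1 \<and> smooth D2 \<and>
    (\<forall>z. (g has_derivative (\<lambda>v. Re v * D1 z + Im v * D2 z)) (at z))"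
  using assms
proof induction
  case (smooth_const c)
  show ?case
    by (intro exI[of _ "\<lambda>_. 0"]) (auto intro: smooth.smooth_const)
next
  case smooth_Re
  show ?case
    by (intro exI[of _ "\<lambda>_. 1"] exI[of _ "\<lambda>_. 0"])
      (auto intro!: smooth.smooth_const bounded_linear_imp_has_derivative bounded_linear_Re)
next
  case smooth_Im
  show ?case
    by (rule exI[of _ "\<lambda>_. 0"], rule exI[of _ "\<lambda>_. 1"])
      (auto intro!: smooth.smooth_const bounded_linear_imp_has_derivative bounded_linear_Im)
next
  case (smooth_add f g)
  then obtain D1 D2 E1 E2 where "smooth D1" "smooth D2" "smooth E1" "smooth E2"
    and D: "\<And>z. (f has_derivative (\<lambda>v. Re v * D1 z + Im v * D2 z)) (at z)"
    and E: "\<And>z. (g has_derivative (\<lambda>v. Re v * E1 z + Im v * E2 z)) (at z)"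
    by blast
  then show ?case
    by (intro exI[of _ "\<lambda>z. D1 z + E1 z"] exI[of _ "\<lambda>z. D2 z + E2 z"])
      (auto intro!: smooth.smooth_add derivative_eq_intros D E simp: algebra_simps)
next
  case (smooth_mult f g)
  then obtain D1 D2 E1 E2 where sm: "smooth D1" "smooth D2" "smooth E1" "smooth E2"
    and D: "\<And>z. (f has_derivative (\<lambda>v. Re v * D1 z + Im v * D2 z)) (at z)"
    and E: "\<And>z. (g has_derivative (\<lambda>v. Re v * E1 z + Im v * E2 z)) (at z)"
    by blast
  have "((\<lambda>z. f z * g z) has_derivative
     (\<lambda>v. Re v * (D1 z * g z + f z * E1 z) + Im v * (D2 z * g z + f z * E2 z))) (at z)" for z
    by (rule derivative_eq_intros D E | simp add: algebra_simps)+
  then show ?case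
    using sm smooth_mult.hyps
    by (intro exI[of _ "\<lambda>z. D1 z * g z + f z * E1 z"] exI[of _ "\<lambda>z. D2 z * g z + f z * E2 z"])
      (auto intro!: smooth.smooth_add smooth.smooth_mult)
next
  case (smooth_flat g m)
  then obtain D1 D2 where sm: "smooth D1" "smooth D2"
    and D: "\<And>z. (g has_derivative (\<lambda>v. Re v * D1 z + Im v * D2 z)) (at z)"
    by blast
  let ?d = "\<lambda>z. flat (m + 2) (g z) - real m * flat (m + 1) (g z)"
  show ?case
    using sm smooth_flat.hyps
    by (intro exI[of _ "\<lambda>z. ?d z * D1 z"] exI[of _ "\<lambda>z. ?d z * D2 z"] conjI allI
        has_derivative_compose_real[OF D flat_has_derivative]
        smooth.smooth_mult smooth_diff smooth.smooth_flat smooth.smooth_const)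
next
  case (smooth_smooth_step g)
  then obtain D1 D2 where sm: "smooth D1" "smooth D2"
    and D: "\<And>z. (g has_derivative (\<lambda>v. Re v * D1 z + Im v * D2 z)) (at z)"
    by blast
  obtain c where c: "\<And>t. (smooth_step has_real_derivative c * (flat 0 t * flat 0 (1 - t))) (at t)"
    using smooth_step_props(1) by blast
  let ?d = "\<lambda>z. c * (flat 0 (g z) * flat 0 (1 - g z))"
  show ?case
    using sm smooth_smooth_step.hyps
    by (intro exI[of _ "\<lambda>z. ?d z * D1 z"] exI[of _ "\<lambda>z. ?d z * D2 z"] conjI allI
        has_derivative_compose_real[OF D c]
        smooth.smooth_mult smooth_diff smooth.smooth_flat smooth.smooth_const)
next
  case (smooth_cutoff g R Q)
  then obtain D1 D2 where sm: "smooth D1" "smooth D2"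
    and D: "\<And>z. (g has_derivative (\<lambda>v. Re v * D1 z + Im v * D2 z)) (at z)"
    by blast
  have open_out: "open {z. R < cmod z}"
    by (intro open_Collect_less continuous_intros)
  have zero: "((\<lambda>z. 0) has_derivative (\<lambda>v. Re v * D1 z + Im v * D2 z)) (at z)" if "R < cmod z" for z
    using D by (rule has_derivative_transform_within_open[OF _ open_out])
      (use that smooth_cutoff.hyps in auto)
  have D0: "D1 z = 0" "D2 z = 0" if "R < cmod z" for z
  proof -
    have "(\<lambda>v. Re v * D1 z + Im v * D2 z) = (\<lambda>v. 0)"
      using has_derivative_unique[OF zero[OF that] has_derivative_const[of 0]] by auto
    from fun_cong[OF this, of 1] fun_cong[OF this, of \<i>] show "D1 z = 0" "D2 z = 0" by simp_all
  qed
  have Q': "deriv Q holomorphic_on unit_disc"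
    using smooth_cutoff.hyps by (auto intro: holomorphic_deriv)
  let ?G1 = "\<lambda>z. D1 z * Re (Q z) + g z * Re (deriv Q z)"
  let ?G2 = "\<lambda>z. D2 z * Re (Q z) + g z * Re (\<i> * deriv Q z)"
  have "((\<lambda>z. g z * Re (Q z)) has_derivative (\<lambda>v. Re v * ?G1 z + Im v * ?G2 z)) (at z)" for z
  proof (cases "cmod z < 1")
    case True
    then have "(Q has_field_derivative deriv Q z) (at z)"
      using smooth_cutoff.hyps by (intro holomorphic_derivI[of _ unit_disc]) auto
    then have "(Q has_derivative (\<lambda>v. deriv Q z * v)) (at z)"
      by (simp add: has_field_derivative_def)
    then have "((\<lambda>z. Re (Q z)) has_derivative (\<lambda>v. Re (deriv Q z * v))) (at z)"
      by (rule bounded_linear.has_derivative[OF bounded_linear_Re])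
    from has_derivative_mult[OF D this] show ?thesis
      by (simp add: algebra_simps)
  next
    case False
    then have z: "R < cmod z" using smooth_cutoff.hyps by auto
    have "((\<lambda>z. 0) has_derivative (\<lambda>v. Re v * ?G1 z + Im v * ?G2 z)) (at z)"
      using z smooth_cutoff.hyps D0 by simp
    then show ?thesis
      by (rule has_derivative_transform_within_open[OF _ open_out])
        (use z smooth_cutoff.hyps in auto)
  qed
  moreover have "smooth ?G1" "smooth ?G2"
    using sm smooth_cutoff.hyps Q' D0
    by (intro smooth.smooth_add smooth.smooth_cutoff[of _ R] holomorphic_intros; blast)+
  ultimately show ?case
    by blast
qed

lemma smooth_Ck: "smooth g \<Longrightarrow> Ck k g"
proof (induction k arbitrary: g)
  case 0
  then obtain D1 D2 where "\<And>z. (g has_derivative (\<lambda>v. Re v * D1 z + Im v * D2 z)) (at z)"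
    using smooth_gradient by blast
  then show ?case
    by (auto intro!: continuous_at_imp_continuous_on has_derivative_continuous)
next
  case (Suc k)
  then obtain D1 D2 where sm: "smooth D1" "smooth D2"
    and D: "\<And>z. (g has_derivative (\<lambda>v. Re v * D1 z + Im v * D2 z)) (at z)"
    using smooth_gradient by blast
  have "(\<lambda>z. frechet_derivative g (at z) v) = (\<lambda>z. Re v * D1 z + Im v * D2 z)" for v
    by (simp add: frechet_derivative_at[OF D, symmetric])
  moreover have "smooth (\<lambda>z. Re v * D1 z + Im v * D2 z)" for v
    using sm by (intro smooth_add smooth_mult smooth_const)
  ultimately show ?case
    using D Suc.IH by (auto simp: differentiable_def)
qed

lemma smooth_test_function:
  assumes "smooth g" "compact K" "K \<subseteq> unit_disc" "\<And>z. z \<notin> K \<Longrightarrow> g z = 0"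
  shows "g \<in> test_functions"
proof -
  have "closure {z. g z \<noteq> 0} \<subseteq> K"
    using assms(2,4) by (intro closure_minimal) (auto intro: compact_imp_closed)
  moreover have "bounded {z. g z \<noteq> 0}"
    by (rule bounded_subset[OF compact_imp_bounded[OF assms(2)]]) (use assms(4) in blast)
  ultimately show ?thesis
    using assms smooth_Ck[OF assms(1)] unfolding test_functions_def by auto
qed

lemma continuous_test_function: "\<phi> \<in> test_functions \<Longrightarrow> continuous_on UNIV \<phi>"
  by (auto simp: test_functions_def dest: spec[of _ 0])

lemma compact_subset_smaller_disc:
  assumes "compact K" "K \<subseteq> unit_disc"
  obtains R where "0 < R" "R < 1" "K \<subseteq> ball 0 R"
proof (cases "K = {}")
  case True
  then show thesis by (intro that[of "1/2"]) auto
next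
  case False
  then obtain w where w: "w \<in> K" "\<And>z. z \<in> K \<Longrightarrow> cmod z \<le> cmod w"
    using continuous_attains_sup[of K cmod] assms by (auto intro: continuous_intros)
  then have "cmod w < 1" using assms by auto
  moreover have "cmod z < (1 + cmod w) / 2" if "z \<in> K" for z
    using w(2)[OF that] \<open>cmod w < 1\<close> by (simp add: field_simps)
  ultimately show thesis by (intro that[of "(1 + cmod w) / 2"]) (auto simp: add_pos_nonneg)
qed

lemma has_real_derivative_along_lines:
  fixes g :: "complex \<Rightarrow> real"
  assumes "g differentiable (at (Complex x y))"
  shows "((\<lambda>x. g (Complex x y)) has_real_derivative frechet_derivative g (at (Complex x y)) 1) (at x)"
    and "((\<lambda>y. g (Complex x y)) has_real_derivative frechet_derivative g (at (Complex x y)) \<i>) (at y)"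
proof -
  let ?g' = "frechet_derivative g (at (Complex x y))"
  have g': "(g has_derivative ?g') (at (Complex x y))"
    using assms by (simp add: frechet_derivative_works)
  then have lin: "?g' (r *\<^sub>R v) = r * ?g' v" for r :: real and v :: complex
    by (simp add: has_derivative_linear linear_cmul)
  have "((\<lambda>x. Complex x y) has_derivative of_real) (at x)"
    unfolding Complex_eq by (auto intro!: derivative_eq_intros)
  from has_derivative_compose[OF this g']
  show "((\<lambda>x. g (Complex x y)) has_real_derivative ?g' 1) (at x)"
    using lin[of _ 1] by (simp add: has_field_derivative_def scaleR_conv_of_real mult_commute_abs)
  have "((\<lambda>y. Complex x y) has_derivative (\<lambda>h. \<i> * of_real h)) (at y)"
    unfolding Complex_eq by (auto intro!: derivative_eq_intros)
  from has_derivative_compose[OF this g']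
  show "((\<lambda>y. g (Complex x y)) has_real_derivative ?g' \<i>) (at y)"
    using lin[of _ \<i>]
    by (simp add: has_field_derivative_def scaleR_conv_of_real mult.commute[of \<i>] mult_commute_abs)
qed

lemma frechet_derivative_outside_support:
  fixes g :: "complex \<Rightarrow> real"
  assumes "closed K" "\<And>z. z \<notin> K \<Longrightarrow> g z = 0" "z \<notin> K"
  shows "frechet_derivative g (at z) v = 0"
proof -
  have "((\<lambda>_. 0) has_derivative (\<lambda>_. 0)) (at z)"
    by simp
  then have "(g has_derivative (\<lambda>_. 0)) (at z)"
    by (rule has_derivative_transform_within_open[of _ _ _ _ "- K"]) (use assms in auto)
  from frechet_derivative_at[OF this] show ?thesis by metis
qed

text \<open>All that the integrations by parts need to know about a test function: its first and pure second partial
derivatives are continuous and vanish off a disc of radius \<open>R\<close>. Unlike being a test function, this is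
immediately stable under the reflection in the real axis.\<close>

definition C2_compact :: "real \<Rightarrow> (complex \<Rightarrow> real) \<Rightarrow> (complex \<Rightarrow> real) \<Rightarrow> (complex \<Rightarrow> real) \<Rightarrow>
    (complex \<Rightarrow> real) \<Rightarrow> (complex \<Rightarrow> real) \<Rightarrow> bool" where
  "C2_compact R p px py pxx pyy \<longleftrightarrow>
     (\<forall>g \<in> {p, px, py, pxx, pyy}. continuous_on UNIV g \<and> (\<forall>z. R \<le> cmod z \<longrightarrow> g z = 0)) \<and>
     (\<forall>x y. ((\<lambda>x. p (Complex x y)) has_real_derivative px (Complex x y)) (at x) \<and>
            ((\<lambda>y. p (Complex x y)) has_real_derivative py (Complex x y)) (at y) \<and>
            ((\<lambda>x. px (Complex x y)) has_real_derivative pxx (Complex x y)) (at x) \<and>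
            ((\<lambda>y. py (Complex x y)) has_real_derivative pyy (Complex x y)) (at y))"

lemma test_function_C2:
  assumes "\<phi> \<in> test_functions"
  obtains R px py pxx pyy where "0 < R" "R < 1" "C2_compact R \<phi> px py pxx pyy"
    "\<And>z. laplace \<phi> z = pxx z + pyy z"
proof -
  define K where "K = closure {z. \<phi> z \<noteq> 0}"
  have K: "compact K" "K \<subseteq> unit_disc" and Ck: "\<And>k. Ck k \<phi>"
    using assms by (auto simp: test_functions_def K_def)
  have K0: "\<phi> z = 0" if "z \<notin> K" for z
    using that closure_subset[of "{z. \<phi> z \<noteq> 0}"] unfolding K_def by auto
  obtain R where R: "0 < R" "R < 1" "K \<subseteq> ball 0 R"
    using compact_subset_smaller_disc[OF K] .
  define D where "D v = (\<lambda>z. frechet_derivative \<phi> (at z) v)" for v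
  define D2 where "D2 v = (\<lambda>z. frechet_derivative (D v) (at z) v)" for v
  have diff: "\<phi> differentiable (at z)" for z
    using Ck[of "Suc 0"] by simp
  have CkD: "Ck k (D v)" for k v
    using Ck[of "Suc k"] by (simp add: D_def)
  have diffD: "D v differentiable (at z)" for v z
    using CkD[of "Suc 0"] by simp
  have CkD2: "Ck k (D2 v)" for k v
    using CkD[of "Suc k"] by (simp add: D2_def)
  have D0: "D v z = 0" if "z \<notin> K" for v z
    unfolding D_def using K0 that K by (intro frechet_derivative_outside_support[of K] compact_imp_closed)
  have D20: "D2 v z = 0" if "z \<notin> K" for v z
    unfolding D2_def using D0 that K by (intro frechet_derivative_outside_support[of K] compact_imp_closed)
  have out: "z \<notin> K" if "R \<le> cmod z" for z using R that by auto
  have "((\<lambda>x. \<phi> (Complex x y)) has_real_derivative D 1 (Complex x y)) (at x)"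
    "((\<lambda>y. \<phi> (Complex x y)) has_real_derivative D \<i> (Complex x y)) (at y)"
    "((\<lambda>x. D 1 (Complex x y)) has_real_derivative D2 1 (Complex x y)) (at x)"
    "((\<lambda>y. D \<i> (Complex x y)) has_real_derivative D2 \<i> (Complex x y)) (at y)" for x y
    unfolding D2_def using has_real_derivative_along_lines[OF diffD] has_real_derivative_along_lines[OF diff]
    by (auto simp: D_def)
  then have "C2_compact R \<phi> (D 1) (D \<i>) (D2 1) (D2 \<i>)"
    unfolding C2_compact_def using Ck[of 0] CkD[of 0] CkD2[of 0] K0 D0 D20 out by auto
  moreover have "laplace \<phi> z = D2 1 z + D2 \<i> z" for z
    by (simp add: laplace_def Basis_complex_def D2_def D_def)
  ultimately show thesis
    using R that by blast
qed

section \<open>Uniqueness of the distributional Laplacian\<close>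

text \<open>Since \<open>flat 0\<close> tends to \<open>1\<close> at infinity, these functions converge to the indicator of the box.\<close>

definition box_bump :: "nat \<Rightarrow> complex \<Rightarrow> complex \<Rightarrow> complex \<Rightarrow> real" where
  "box_bump n a b z =
     flat 0 (n * (Re z - Re a)) * flat 0 (n * (Re b - Re z)) *
     (flat 0 (n * (Im z - Im a)) * flat 0 (n * (Im b - Im z)))"

lemma smooth_box_bump: "smooth (box_bump n a b)"
proof -
  have "smooth (\<lambda>z. box_bump n a b z)"
    unfolding box_bump_def
    by (intro smooth_mult smooth_flat smooth_diff smooth_const smooth_Re smooth_Im)
  then show ?thesis by simp
qed

lemma flat_0_le_1: "flat 0 t \<le> 1"
  by (simp add: flat_def)

lemma in_box_complex: "z \<in> box a b \<longleftrightarrow> Re a < Re z \<and> Re z < Re b \<and> Im a < Im z \<and> Im z < Im b"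
  by (auto simp: box_def Basis_complex_def)

lemma box_bump_0: "z \<notin> box a b \<Longrightarrow> box_bump n a b z = 0"
  by (auto simp: in_box_complex box_bump_def flat_def zero_less_mult_iff)

lemma box_bump_bounds: "0 \<le> box_bump n a b z" "box_bump n a b z \<le> indicator (box a b) z"
proof -
  show "0 \<le> box_bump n a b z"
    unfolding box_bump_def by (intro mult_nonneg_nonneg flat_nonneg)
  have "box_bump n a b z \<le> 1"
    unfolding box_bump_def by (intro mult_le_one mult_nonneg_nonneg flat_nonneg flat_0_le_1)
  then show "box_bump n a b z \<le> indicator (box a b) z"
    using box_bump_0[of z a b n] by (auto simp: indicator_def)
qed

lemma flat_scaled_limit: "0 < t \<Longrightarrow> (\<lambda>n. flat 0 (real n * t)) \<longlonglongrightarrow> 1"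
proof -
  assume t: "0 < t"
  have l: "filterlim (\<lambda>n. real n * t) at_top sequentially"
    using t by real_asymp
  have "((\<lambda>x::real. exp (- 1 / x)) \<longlongrightarrow> 1) at_top"
    by real_asymp
  then have "(\<lambda>n. exp (- 1 / (real n * t))) \<longlonglongrightarrow> 1"
    using l by (rule filterlim_compose)
  moreover have "\<forall>\<^sub>F n in sequentially. 0 < real n * t"
    using l unfolding filterlim_at_top_dense by blast
  then have "\<forall>\<^sub>F n in sequentially. exp (- 1 / (real n * t)) = flat 0 (real n * t)"
    by eventually_elim (simp add: flat_def)
  ultimately show ?thesis
    by (rule Lim_transform_eventually)
qed

lemma box_bump_limit: "(\<lambda>n. box_bump n a b z) \<longlonglongrightarrow> indicator (box a b) z"
proof (cases "z \<in> box a b")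
  case True
  then have "(\<lambda>n. box_bump n a b z) \<longlonglongrightarrow> 1 * 1 * (1 * 1)"
    unfolding box_bump_def by (intro tendsto_mult flat_scaled_limit) (auto simp: in_box_complex)
  then show ?thesis using True by simp
qed (simp add: box_bump_0)

lemma rational_box_cover:
  fixes U :: "complex set"
  assumes "open U"
  obtains C where "countable C" "C \<subseteq> {box a b | a b. cbox a b \<subseteq> U}" "\<Union>C = U"
proof -
  define Q where "Q = (\<lambda>(x, y). Complex x y) ` (\<rat> \<times> \<rat>)"
  define C where "C = (\<lambda>(a, b). box a b) ` {(a, b) \<in> Q \<times> Q. cbox a b \<subseteq> U}"
  have Q: "z \<in> Q" if "Re z \<in> \<rat>" "Im z \<in> \<rat>" for z
    unfolding Q_def using that by (intro image_eqI[of _ _ "(Re z, Im z)"]) auto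
  have "countable Q" unfolding Q_def by (intro countable_image countable_SIGMA countable_rat)
  then have "countable {(a, b) \<in> Q \<times> Q. cbox a b \<subseteq> U}"
    using countable_subset[of "{(a, b) \<in> Q \<times> Q. cbox a b \<subseteq> U}" "Q \<times> Q"] by auto
  then have "countable C" unfolding C_def by (rule countable_image)
  moreover have "C \<subseteq> {box a b | a b. cbox a b \<subseteq> U}"
    by (auto simp: C_def)
  moreover have "\<Union>C = U"
  proof (intro antisym subsetI)
    fix x assume "x \<in> U"
    with assms obtain e where e: "0 < e" "ball x e \<subseteq> U"
      by (auto elim: openE)
    then obtain a b where ab: "\<forall>i\<in>Basis. a \<bullet> i \<in> \<rat> \<and> b \<bullet> i \<in> \<rat>" "x \<in> box a b" "box a b \<subseteq> ball x (e / 2)"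
      using rational_boxes[of "e / 2" x] by auto
    have "closure (box a b) \<subseteq> cball x (e / 2)"
      using ab(3) by (intro closure_minimal) auto
    moreover have "box a b \<noteq> {}" using ab by auto
    ultimately have "cbox a b \<subseteq> U"
      using e by (force simp: closure_box)
    moreover have "a \<in> Q" "b \<in> Q"
      using ab(1) by (auto simp: Basis_complex_def intro: Q)
    ultimately show "x \<in> \<Union>C"
      using ab(2) by (auto simp: C_def)
  next
    fix x assume "x \<in> \<Union>C"
    then show "x \<in> U"
      unfolding C_def using box_subset_cbox by blast
  qed
  ultimately show thesis using that by blast
qed

text \<open>Boxes whose closure lies in the disc form a generator that is stable under intersection and consists of
sets on which all the measures in question are finite.\<close>

lemma sets_disc_eq_boxes:
  "sets (restrict_space borel unit_disc) = sigma_sets unit_disc {box a b | a b. cbox a b \<subseteq> unit_disc}"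
    (is "_ = sigma_sets _ ?E")
proof (intro antisym)
  have "sets (restrict_space borel unit_disc) = (\<inter>) unit_disc ` sigma_sets UNIV (Collect open)"
    by (simp add: sets_restrict_space borel_def)
  also have "\<dots> = sigma_sets unit_disc ((\<inter>) unit_disc ` Collect open)"
    by (intro sigma_sets_Int) auto
  also have "\<dots> \<subseteq> sigma_sets unit_disc ?E"
  proof (rule sigma_sets_mono, safe)
    fix U :: "complex set" assume "open U"
    then have "open (unit_disc \<inter> U)" by auto
    then obtain C where C: "countable C" "C \<subseteq> {box a b | a b. cbox a b \<subseteq> unit_disc \<inter> U}" "\<Union>C = unit_disc \<inter> U"
      by (rule rational_box_cover)
    from C(2) have "b \<in> ?E" if "b \<in> C" for b
      using that by blast
    with C(1) have "\<Union>C \<in> sigma_sets unit_disc ?E"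
      by (intro sigma_sets_UNION sigma_sets.Basic)
    then show "unit_disc \<inter> U \<in> sigma_sets unit_disc ?E"
      using C by simp
  qed
  finally show "sets (restrict_space borel unit_disc) \<subseteq> sigma_sets unit_disc ?E" .
  show "sigma_sets unit_disc ?E \<subseteq> sets (restrict_space borel unit_disc)"
    using sets.sigma_sets_subset[of ?E "restrict_space borel unit_disc"]
    by (fastforce simp: sets_restrict_space space_restrict_space intro: box_subset_cbox[THEN subsetD])
qed

text \<open>The defining identity determines the integrals of the bump functions, and their limits are the measures of
the boxes.\<close>

theorem is_laplacian_measure_unique:
  assumes "is_laplacian_measure v M" "is_laplacian_measure v N"
  shows "M = N"
proof -
  let ?E = "{box a b | a b. cbox a b \<subseteq> unit_disc}"
  have lim: "(\<lambda>n. 1 / (2 * pi) * (\<integral>z\<in>unit_disc. real_of_ereal (v z) * laplace (box_bump n a b) z \<partial>lborel))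
      \<longlonglongrightarrow> measure L (box a b)"
    and fin: "emeasure L (box a b) \<noteq> \<infinity>"
    if L: "is_laplacian_measure v L" and ab: "cbox a b \<subseteq> unit_disc" for L a b
  proof -
    have sets: "sets L = sets (restrict_space borel unit_disc)"
      using L by (simp add: is_laplacian_measure_def)
    have meas: "A \<inter> unit_disc \<in> sets L" if "A \<in> sets borel" for A
      using that by (auto simp: sets sets_restrict_space)
    have box: "box a b \<in> sets L" "cbox a b \<in> sets L"
      using meas[of "box a b"] meas[of "cbox a b"] ab box_subset_cbox[of a b]
      by (auto simp: Int_absorb2)
    have "emeasure L (cbox a b) < \<infinity>"
      using L ab by (simp add: is_laplacian_measure_def)
    then have fin': "emeasure L (box a b) < \<infinity>"
      using emeasure_mono[OF box_subset_cbox box(2)] by (metis order_le_less_trans)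
    then show "emeasure L (box a b) \<noteq> \<infinity>" by simp
    have test: "box_bump n a b \<in> test_functions" for n
      using ab subsetD[OF box_subset_cbox]
      by (intro smooth_test_function[of _ "cbox a b"] smooth_box_bump) (auto intro!: box_bump_0)
    have borel: "f \<in> borel_measurable L" if "f \<in> borel_measurable borel" for f :: "complex \<Rightarrow> real"
      unfolding measurable_cong_sets[OF sets refl] by (rule measurable_restrict_space1[OF that])
    have "(\<lambda>n. \<integral>z. box_bump n a b z \<partial>L) \<longlonglongrightarrow> (\<integral>z. indicator (box a b) z \<partial>L)"
    proof (rule integral_dominated_convergence)
      show "integrable L (indicator (box a b) :: _ \<Rightarrow> real)"
        using box fin' by simp
      show "box_bump n a b \<in> borel_measurable L" for n
        by (intro borel borel_measurable_continuous_onI continuous_test_function test)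
      show "AE z in L. (\<lambda>n. box_bump n a b z) \<longlonglongrightarrow> indicator (box a b) z"
        by (simp add: box_bump_limit)
      show "AE z in L. norm (box_bump n a b z) \<le> indicator (box a b) z" for n
        by (simp add: box_bump_bounds)
    qed (use box in measurable)
    moreover have "(\<integral>z. indicator (box a b) z \<partial>L) = measure L (box a b)"
      using box sets.sets_into_space[OF box(1)] by (simp add: Int_absorb2)
    ultimately show "(\<lambda>n. 1 / (2 * pi) * (\<integral>z\<in>unit_disc. real_of_ereal (v z) * laplace (box_bump n a b) z \<partial>lborel))
      \<longlonglongrightarrow> measure L (box a b)"
      using L test by (simp add: is_laplacian_measure_def)
  qed
  obtain C where C: "countable C" "C \<subseteq> ?E" "\<Union>C = unit_disc"
    using rational_box_cover[of unit_disc] by auto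
  show ?thesis
  proof (rule measure_eqI_generator_eq_countable[of ?E unit_disc, OF _ _ _ _ _ C(2,3,1)])
    show "Int_stable ?E"
    proof (rule Int_stableI)
      fix A B assume "A \<in> ?E" "B \<in> ?E"
      then obtain a b c d where AB: "A = box a b" "B = box c d" "cbox a b \<subseteq> unit_disc" by auto
      then show "A \<inter> B \<in> ?E"
        using Int_interval[of a b c d] by (auto simp: box_Int_box)
    qed
    show "?E \<subseteq> Pow unit_disc"
      using box_subset_cbox by blast
    show "sets M = sigma_sets unit_disc ?E" "sets N = sigma_sets unit_disc ?E"
      using assms by (simp_all add: is_laplacian_measure_def sets_disc_eq_boxes)
    show "emeasure M A \<noteq> \<infinity>" if "A \<in> C" for A
      using fin[OF assms(1)] that C by auto
    show "emeasure M A = emeasure N A" if A: "A \<in> ?E" for A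
    proof -
      obtain a b where ab: "A = box a b" "cbox a b \<subseteq> unit_disc" using A by auto
      then have "measure M A = measure N A"
        using LIMSEQ_unique[OF lim[OF assms(1) ab(2)] lim[OF assms(2) ab(2)]] by simp
      then show ?thesis
        using fin[OF assms(1) ab(2)] fin[OF assms(2) ab(2)] ab by (simp add: emeasure_eq_ennreal_measure)
    qed
  qed
qed

lemma laplacian_measure_eqI: "is_laplacian_measure v M \<Longrightarrow> laplacian_measure v = M"
  unfolding laplacian_measure_def using is_laplacian_measure_unique by (intro the_equality)

section \<open>The potential of the segment\<close>

text \<open>With a small exponent this turns the logarithmic singularity of the kernel into an integrable power and at
the same time keeps a power of the factor \<open>1 - \<bar>z\<bar>\<^sup>2\<close>, which forces the potential to vanish on the circle.\<close>

lemma ln_one_plus_le: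
  fixes x q :: real
  assumes "0 \<le> x" "0 < q" "q \<le> 1"
  shows "ln (1 + x) \<le> 2 / q * x powr q"
proof (cases "x \<le> 1")
  case True
  have "ln (1 + x) \<le> x" using assms by (intro ln_add_one_self_le_self) auto
  also have "x \<le> x powr q"
    using powr_mono'[of q 1 x] assms True by simp
  also have "\<dots> \<le> 2 / q * x powr q"
    using assms by (simp add: field_simps) (smt (verit) mult_left_le_one_le powr_ge_zero)
  finally show ?thesis .
next
  case False
  have "ln (1 + x) \<le> ln (2 * x)" using False by simp
  also have "\<dots> \<le> (2 * x) powr q / q" using False assms by (intro ln_powr_bound) auto
  also have "\<dots> = 2 powr q * x powr q / q" using assms by (simp add: powr_mult)
  also have "\<dots> \<le> 2 powr 1 * x powr q / q"
    using assms by (intro divide_right_mono mult_right_mono powr_mono) auto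
  finally show ?thesis by (simp add: field_simps)
qed

text \<open>The truncation to \<open>[-2, 2]\<close> makes the power integrable; distances between points of the disc do not exceed
\<open>2\<close>.\<close>

definition cut_power :: "real \<Rightarrow> real \<Rightarrow> real" where
  "cut_power \<gamma> t = indicator {-2..2} t * \<bar>t\<bar> powr (- \<gamma>)"

lemma cut_power_measurable [measurable]: "cut_power \<gamma> \<in> borel_measurable borel"
  unfolding cut_power_def[abs_def] by measurable

lemma cut_power_nonneg: "0 \<le> cut_power \<gamma> t"
  by (simp add: cut_power_def)

lemma integrable_cut_power:
  assumes "\<gamma> < 1"
  shows "integrable lborel (cut_power \<gamma>)"
proof -
  let ?h = "\<lambda>x::real. indicator {0..2} x * x powr (- \<gamma>)"
  have "(\<lambda>x. x powr (- \<gamma>)) integrable_on {0..2::real}"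
    using assms by (intro integrable_on_powr_from_0) auto
  then have "(\<lambda>x. x powr (- \<gamma>)) absolutely_integrable_on {0..2::real}"
    by (intro nonnegative_absolutely_integrable_1) auto
  then have h: "integrable lborel ?h"
    by (simp add: set_integrable_def integrable_completion)
  have "integrable lborel (\<lambda>x. ?h x + ?h (0 + (- 1) * x))"
    by (intro Bochner_Integration.integrable_add h lborel_integrable_real_affine) auto
  then show ?thesis
    by (rule Bochner_Integration.integrable_bound)
      (auto simp: cut_power_def indicator_def split: if_splits)
qed

locale segment_potential =
  fixes \<beta> :: real
  assumes beta: "0 < \<beta>" "\<beta> < 1"
begin

definition dens :: "real \<Rightarrow> real" where
  "dens s = indicator {0<..<1} s * (1 / (1 - s) powr \<beta>)"

definition kernel :: "complex \<Rightarrow> real \<Rightarrow> real" where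
  "kernel z s = ln (cmod ((z - of_real s) / (1 - of_real s * z)))"

definition pot :: "complex \<Rightarrow> real" where
  "pot z = (\<integral>s. kernel z s * dens s \<partial>lborel)"

text \<open>The kernel is estimated by a power \<open>q\<close> of the quotient in \<open>kernel_eq\<close> below, where the distance to the
pole has the exponent \<open>- 2 q\<close>, and the density has the exponent \<open>- \<beta>\<close>. The sum of both is \<open>- \<gamma>\<close>, and \<open>q\<close> is
chosen such that \<open>\<gamma> < 1\<close>.\<close>

definition \<gamma> where "\<gamma> = (1 + \<beta>) / 2"
definition q where "q = (1 - \<beta>) / 4"

lemma gamma_q: "\<gamma> < 1" "0 < \<gamma>" "0 < q" "q \<le> 1" "\<gamma> = \<beta> + 2 * q"
  using beta by (auto simp: \<gamma>_def q_def field_simps)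

lemma dens_nonneg: "0 \<le> dens s"
  by (simp add: dens_def)

lemma dens_measurable [measurable]: "dens \<in> borel_measurable borel"
  unfolding dens_def[abs_def] by measurable

lemma dens_0: "s \<notin> {0<..<1} \<Longrightarrow> dens s = 0"
  by (simp add: dens_def)

lemma dens_pos: "0 < s \<Longrightarrow> s < 1 \<Longrightarrow> 0 < dens s"
  by (simp add: dens_def)

lemma integrable_cut_power_shift: "integrable lborel (\<lambda>s. cut_power \<gamma> (x - s))"
  using lborel_integrable_real_affine[OF integrable_cut_power[OF gamma_q(1)], of "-1" x] by simp

lemma integral_cut_power_shift: "(\<integral>s. cut_power \<gamma> (x - s) \<partial>lborel) = (\<integral>s. cut_power \<gamma> s \<partial>lborel)"
  using lborel_integral_real_affine[of "-1" "cut_power \<gamma>" x] by simp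

lemma dens_le_cut_power: "dens s \<le> cut_power \<gamma> (1 - s)"
proof (cases "0 < s \<and> s < 1")
  case True
  have "(1 - s) powr (- \<beta>) \<le> (1 - s) powr (- \<gamma>)"
    using True beta gamma_q by (intro powr_mono') auto
  then show ?thesis
    using True by (simp add: dens_def cut_power_def powr_minus field_simps)
qed (auto simp: dens_0 cut_power_nonneg)

lemma integrable_dens: "integrable lborel dens"
  by (rule Bochner_Integration.integrable_bound[OF integrable_cut_power_shift[of 1]])
    (auto simp: dens_le_cut_power dens_nonneg cut_power_nonneg)

text \<open>From \<open>\<bar>1 - s z\<bar>\<^sup>2 = \<bar>z - s\<bar>\<^sup>2 + (1 - \<bar>z\<bar>\<^sup>2) (1 - s\<^sup>2)\<close>.\<close>

lemma kernel_eq: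
  assumes "cmod z < 1" "0 < s" "s < 1" "z \<noteq> of_real s"
  shows "kernel z s = - (1/2) * ln (1 + (1 - (cmod z)\<^sup>2) * (1 - s\<^sup>2) / (cmod (z - of_real s))\<^sup>2)"
    and "0 < (1 - (cmod z)\<^sup>2) * (1 - s\<^sup>2) / (cmod (z - of_real s))\<^sup>2"
proof -
  have "cmod (of_real s * z) < 1"
    using assms mult_left_le_one_le[of "cmod z" s] by (simp add: norm_mult)
  then have n0: "1 - of_real s * z \<noteq> 0" by auto
  have id: "(cmod (1 - of_real s * z))\<^sup>2 = (cmod (z - of_real s))\<^sup>2 + (1 - (cmod z)\<^sup>2) * (1 - s\<^sup>2)"
    unfolding cmod_power2 by (simp add: algebra_simps power2_eq_square)
  have pos: "0 < cmod (z - of_real s)" "0 < cmod (1 - of_real s * z)" using assms n0 by auto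
  have "2 * kernel z s = ln ((cmod (z - of_real s))\<^sup>2 / (cmod (1 - of_real s * z))\<^sup>2)"
    using pos by (simp add: kernel_def norm_divide ln_div ln_realpow algebra_simps)
  also have "\<dots> = - ln ((cmod (1 - of_real s * z))\<^sup>2 / (cmod (z - of_real s))\<^sup>2)"
    using pos by (simp add: ln_div)
  also have "(cmod (1 - of_real s * z))\<^sup>2 / (cmod (z - of_real s))\<^sup>2 =
      1 + (1 - (cmod z)\<^sup>2) * (1 - s\<^sup>2) / (cmod (z - of_real s))\<^sup>2"
    using pos unfolding id by (simp add: field_simps)
  finally show "kernel z s = - (1/2) * ln (1 + (1 - (cmod z)\<^sup>2) * (1 - s\<^sup>2) / (cmod (z - of_real s))\<^sup>2)"
    by simp
  show "0 < (1 - (cmod z)\<^sup>2) * (1 - s\<^sup>2) / (cmod (z - of_real s))\<^sup>2"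
    using assms pos by (intro divide_pos_pos mult_pos_pos) (auto simp: power_less_one_iff)
qed

lemma kernel_neg:
  assumes "cmod z < 1" "0 < s" "s < 1" "z \<noteq> of_real s"
  shows "kernel z s < 0"
  using kernel_eq[OF assms] by simp

text \<open>If \<open>m\<close> is the smaller one of two positive numbers \<open>a\<close> and \<open>b\<close>, then \<open>a powr (- 2 q) * b powr (- \<beta>)\<close> is at most
\<open>m powr (- \<gamma>)\<close>, hence at most the sum of the powers of \<open>a\<close> and \<open>b\<close>. This separates the singularity of the
kernel at \<open>Re z\<close> from that of the density at \<open>1\<close>, and the integral of the bound does not depend on \<open>z\<close> except
through \<open>1 - \<bar>z\<bar>\<^sup>2\<close>.\<close>

lemma kernel_dens_bound:
  assumes z: "cmod z < 1" and s: "s \<noteq> Re z"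
  shows "\<bar>kernel z s * dens s\<bar> \<le> 1 / q * (1 - (cmod z)\<^sup>2) powr q * (cut_power \<gamma> (Re z - s) + cut_power \<gamma> (1 - s))"
proof (cases "0 < s \<and> s < 1")
  case False
  then show ?thesis
    using gamma_q by (simp add: dens_0 cut_power_nonneg)
next
  case True
  let ?a = "\<bar>Re z - s\<bar>" and ?b = "1 - s" and ?e = "1 - (cmod z)\<^sup>2"
  let ?X = "?e * (1 - s\<^sup>2) / (cmod (z - of_real s))\<^sup>2"
  have zs: "z \<noteq> of_real s" using s by auto
  have e: "0 < ?e" using z by (simp add: power_less_one_iff)
  have a: "0 < ?a" "?a \<le> 2"
    using s True abs_Re_le_cmod[of z] z by auto
  have b: "0 < ?b" using True by simp
  note k = kernel_eq[OF z True[THEN conjunct1] True[THEN conjunct2] zs]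
  have "?a \<le> cmod (z - of_real s)"
    using abs_Re_le_cmod[of "z - of_real s"] by simp
  then have "?a\<^sup>2 \<le> (cmod (z - of_real s))\<^sup>2" by (intro power_mono) auto
  moreover have "?e * (1 - s\<^sup>2) \<le> ?e * 1"
    using e by (intro mult_left_mono) auto
  ultimately have "?X \<le> ?e / ?a\<^sup>2"
    using a e by (intro frac_le) auto
  then have "?X powr q \<le> (?e / ?a\<^sup>2) powr q"
    using k(2) gamma_q by (intro powr_mono2) auto
  also have "\<dots> = ?e powr q * ?a powr (- 2 * q)"
  proof -
    have "(t\<^sup>2) powr q = t powr (2 * q)" if "0 < t" for t :: real
      using powr_powr[of t 2 q] that by simp
    note pw = this[OF a(1)]
    have "(?e / ?a\<^sup>2) powr q = ?e powr q / (?a\<^sup>2) powr q"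
      by (rule powr_divide)
    then show ?thesis
      by (simp only: pw powr_minus minus_mult_left[symmetric] divide_inverse)
  qed
  finally have X: "?X powr q \<le> ?e powr q * ?a powr (- 2 * q)" .
  have "\<bar>kernel z s\<bar> = 1/2 * ln (1 + ?X)"
    using k by (simp add: abs_mult)
  also have "\<dots> \<le> 1/2 * (2 / q * ?X powr q)"
    using k(2) gamma_q by (intro mult_left_mono ln_one_plus_le) auto
  also have "\<dots> \<le> 1 / q * (?e powr q * ?a powr (- 2 * q))"
    using X gamma_q by (simp add: divide_right_mono)
  finally have K: "\<bar>kernel z s\<bar> \<le> 1 / q * ?e powr q * ?a powr (- 2 * q)" by simp
  define m where "m = min ?a ?b"
  have m: "0 < m" "m \<le> ?a" "m \<le> ?b" using a b by (auto simp: m_def)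
  have "?a powr (- 2 * q) * ?b powr (- \<beta>) \<le> m powr (- 2 * q) * m powr (- \<beta>)"
    using m gamma_q beta by (intro mult_mono powr_mono2') auto
  also have "\<dots> = m powr (- \<gamma>)"
    unfolding powr_add[symmetric] gamma_q(5) by (simp add: algebra_simps)
  also have "\<dots> \<le> ?a powr (- \<gamma>) + ?b powr (- \<gamma>)"
    unfolding m_def min_def by auto
  also have "\<dots> = cut_power \<gamma> (Re z - s) + cut_power \<gamma> (1 - s)"
    using a True by (auto simp: cut_power_def abs_le_iff)
  finally have AB: "?a powr (- 2 * q) * ?b powr (- \<beta>) \<le> cut_power \<gamma> (Re z - s) + cut_power \<gamma> (1 - s)" .
  have "\<bar>kernel z s * dens s\<bar> = \<bar>kernel z s\<bar> * ?b powr (- \<beta>)"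
    using True by (simp add: dens_def abs_mult powr_minus field_simps)
  also have "\<dots> \<le> (1 / q * ?e powr q * ?a powr (- 2 * q)) * ?b powr (- \<beta>)"
    by (intro mult_right_mono K) auto
  also have "\<dots> = 1 / q * ?e powr q * (?a powr (- 2 * q) * ?b powr (- \<beta>))" by simp
  also have "\<dots> \<le> 1 / q * ?e powr q * (cut_power \<gamma> (Re z - s) + cut_power \<gamma> (1 - s))"
    using gamma_q by (intro mult_left_mono AB) auto
  finally show ?thesis .
qed

lemma kernel_measurable [measurable]: "(\<lambda>(z, s). kernel z s) \<in> borel_measurable (borel \<Otimes>\<^sub>M borel)"
  unfolding kernel_def by measurable

lemma pot_measurable [measurable]: "pot \<in> borel_measurable borel"
proof -
  have "(\<lambda>(z, s). kernel z s * dens s) \<in> borel_measurable (borel \<Otimes>\<^sub>M lborel)"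
    by measurable
  from sigma_finite_measure.borel_measurable_lebesgue_integral[OF _ this]
  show ?thesis
    unfolding pot_def[abs_def] by (simp add: lborel.sigma_finite_measure_axioms)
qed

lemma kernel_dens_bound_AE:
  assumes z: "cmod z < 1"
  shows "AE s in lborel. norm (kernel z s * dens s) \<le>
     1 / q * (1 - (cmod z)\<^sup>2) powr q * (cut_power \<gamma> (Re z - s) + cut_power \<gamma> (1 - s))"
  using AE_lborel_singleton[of "Re z"] by eventually_elim (use kernel_dens_bound[OF z] in simp)

lemma integrable_cut_power_sum: "integrable lborel (\<lambda>s. c * (cut_power \<gamma> (x - s) + cut_power \<gamma> (1 - s)))"
  by (intro integrable_mult_right Bochner_Integration.integrable_add integrable_cut_power_shift)

lemma integrable_kernel_dens:
  assumes "cmod z < 1"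
  shows "integrable lborel (\<lambda>s. kernel z s * dens s)"
proof (rule Bochner_Integration.integrable_bound[OF integrable_cut_power_sum])
  show "AE s in lborel. norm (kernel z s * dens s) \<le>
      norm (1 / q * (1 - (cmod z)\<^sup>2) powr q * (cut_power \<gamma> (Re z - s) + cut_power \<gamma> (1 - s)))"
    using kernel_dens_bound_AE[OF assms]
    by eventually_elim (metis abs_ge_self order_trans real_norm_def)
qed measurable

definition pot_const where "pot_const = 2 / q * (\<integral>s. cut_power \<gamma> s \<partial>lborel)"

lemma pot_const_nonneg: "0 \<le> pot_const"
  unfolding pot_const_def using gamma_q by (intro mult_nonneg_nonneg Bochner_Integration.integral_nonneg cut_power_nonneg) auto

text \<open>This gives two things: the potential is bounded, and it tends to \<open>0\<close> at the circle, also at the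
point \<open>1\<close>, where the density is singular.\<close>

lemma pot_bound:
  assumes "cmod z < 1"
  shows "\<bar>pot z\<bar> \<le> pot_const * (1 - (cmod z)\<^sup>2) powr q"
proof -
  let ?c = "1 / q * (1 - (cmod z)\<^sup>2) powr q"
  have "norm (pot z) \<le> (\<integral>s. ?c * (cut_power \<gamma> (Re z - s) + cut_power \<gamma> (1 - s)) \<partial>lborel)"
    unfolding pot_def
    by (intro order_trans[OF integral_norm_bound] integral_mono_AE integrable_cut_power_sum
        kernel_dens_bound_AE assms integrable_norm integrable_kernel_dens)
  also have "\<dots> = ?c * ((\<integral>s. cut_power \<gamma> (Re z - s) \<partial>lborel) + (\<integral>s. cut_power \<gamma> (1 - s) \<partial>lborel))"
    by (simp add: Bochner_Integration.integral_add[OF integrable_cut_power_shift integrable_cut_power_shift])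
  also have "\<dots> = pot_const * (1 - (cmod z)\<^sup>2) powr q"
    by (simp add: integral_cut_power_shift pot_const_def)
  finally show ?thesis by simp
qed

lemma segment_integral_pos:
  fixes g :: "real \<Rightarrow> real"
  assumes int: "integrable lborel g"
    and pos: "\<And>s. 0 < s \<Longrightarrow> s < 1 \<Longrightarrow> s \<noteq> a \<Longrightarrow> 0 < g s"
    and zero: "\<And>s. s \<notin> {0<..<1} \<Longrightarrow> g s = 0"
  shows "0 < (\<integral>s. g s \<partial>lborel)"
proof -
  have nonneg: "AE s in lborel. 0 \<le> g s"
    using AE_lborel_singleton[of a]
  proof eventually_elim
    case (elim s)
    then show ?case using pos[of s] zero[of s] by (cases "s \<in> {0<..<1}") auto
  qed
  have "(\<integral>s. g s \<partial>lborel) \<noteq> 0"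
  proof
    assume "(\<integral>s. g s \<partial>lborel) = 0"
    then have "AE s in lborel. g s = 0"
      using integral_nonneg_eq_0_iff_AE[OF int nonneg] by simp
    then have "AE s in lborel. s \<notin> {0<..<1::real}"
      using AE_lborel_singleton[of a] by eventually_elim (use pos in force)
    then have "emeasure lborel {0<..<1::real} = 0"
      by (subst (asm) AE_iff_measurable[of "{0<..<1::real}"]) auto
    then show False by simp
  qed
  then show ?thesis
    using integral_nonneg_AE[OF nonneg] by linarith
qed

lemma pot_neg:
  assumes "cmod z < 1"
  shows "pot z < 0"
proof -
  have "0 < (\<integral>s. - (kernel z s * dens s) \<partial>lborel)"
  proof (rule segment_integral_pos[of _ "Re z"])
    show "0 < - (kernel z s * dens s)" if "0 < s" "s < 1" "s \<noteq> Re z" for s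
      using kernel_neg[of z s] dens_pos[of s] that assms by (force simp: mult_neg_pos)
  qed (use integrable_kernel_dens[OF assms] in \<open>auto simp: dens_0\<close>)
  then show ?thesis
    by (simp add: pot_def)
qed

lemma pot_cnj: "pot (cnj z) = pot z"
proof -
  have "kernel (cnj z) s = kernel z s" for s
  proof -
    have "cmod (cnj z - of_real s) = cmod (cnj (z - of_real s))"
      "cmod (1 - of_real s * cnj z) = cmod (cnj (1 - of_real s * z))" by simp_all
    then show ?thesis by (simp add: kernel_def norm_divide del: complex_cnj_diff)
  qed
  then show ?thesis by (simp add: pot_def)
qed

text \<open>Along a vertical line the bound for the integrand can be chosen independently of the height, so that the
potential is continuous up to the real axis there.\<close>

lemma pot_vertical_limit:
  assumes x: "\<bar>x\<bar> < 1" and Y: "Y \<longlonglongrightarrow> 0" "\<And>n. cmod (Complex x (Y n)) < 1"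
  shows "(\<lambda>n. pot (Complex x (Y n))) \<longlonglongrightarrow> pot (Complex x 0)"
  unfolding pot_def
proof (rule integral_dominated_convergence)
  show "integrable lborel (\<lambda>s. 1 / q * (cut_power \<gamma> (x - s) + cut_power \<gamma> (1 - s)))"
    by (rule integrable_cut_power_sum)
  show "AE s in lborel. norm (kernel (Complex x (Y n)) s * dens s) \<le>
      1 / q * (cut_power \<gamma> (x - s) + cut_power \<gamma> (1 - s))" for n
    using kernel_dens_bound_AE[OF Y(2)[of n]]
  proof eventually_elim
    case (elim s)
    have "(1 - (cmod (Complex x (Y n)))\<^sup>2) powr q \<le> 1"
      using Y(2)[of n] gamma_q by (intro powr_le1) (auto simp: power_le_one)
    then have "1 / q * (1 - (cmod (Complex x (Y n)))\<^sup>2) powr q * (cut_power \<gamma> (x - s) + cut_power \<gamma> (1 - s)) \<le>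
       1 / q * 1 * (cut_power \<gamma> (x - s) + cut_power \<gamma> (1 - s))"
      using gamma_q cut_power_nonneg by (intro mult_right_mono mult_left_mono add_nonneg_nonneg) auto
    with elim show ?case by simp
  qed
  show "AE s in lborel. (\<lambda>n. kernel (Complex x (Y n)) s * dens s) \<longlonglongrightarrow> kernel (Complex x 0) s * dens s"
    using AE_lborel_singleton[of x]
  proof eventually_elim
    case (elim s)
    show ?case
    proof (cases "0 < s \<and> s < 1")
      case True
      have "\<bar>s * x\<bar> < 1" using True x by (simp add: abs_mult) (smt (verit) mult_less_cancel_left1 mult_left_le)
      then have ne: "1 - of_real s * complex_of_real x \<noteq> 0" "complex_of_real x - of_real s \<noteq> 0"
        using elim by (auto simp flip: of_real_mult of_real_diff)
      have "(\<lambda>n. complex_of_real x + \<i> * complex_of_real (Y n)) \<longlonglongrightarrow> complex_of_real x + \<i> * complex_of_real 0"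
        by (intro tendsto_intros Y)
      then have "(\<lambda>n. Complex x (Y n)) \<longlonglongrightarrow> complex_of_real x"
        by (simp add: Complex_eq)
      then have "(\<lambda>n. kernel (Complex x (Y n)) s * dens s) \<longlonglongrightarrow> kernel (complex_of_real x) s * dens s"
        unfolding kernel_def using ne by (intro tendsto_intros) auto
      then show ?thesis by (simp add: complex_of_real_def)
    qed (simp add: dens_0)
  qed
qed measurable

end

text \<open>Differentiation under the integral sign: by the mean value theorem the difference quotients are dominated by
the bound for the derivative.\<close>

lemma has_field_derivative_lebesgue_integral:
  fixes f f' :: "complex \<Rightarrow> 'a \<Rightarrow> complex"
  assumes U: "open U" "convex U" "z0 \<in> U"
    and int: "\<And>z. z \<in> U \<Longrightarrow> integrable M (f z)"
    and der: "\<And>z s. z \<in> U \<Longrightarrow> ((\<lambda>z. f z s) has_field_derivative f' z s) (at z)"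
    and bnd: "\<And>z s. z \<in> U \<Longrightarrow> norm (f' z s) \<le> g s"
    and g: "integrable M g" and meas: "f' z0 \<in> borel_measurable M"
  shows "((\<lambda>z. \<integral>s. f z s \<partial>M) has_field_derivative (\<integral>s. f' z0 s \<partial>M)) (at z0)"
proof -
  have "((\<lambda>z. ((\<integral>s. f z s \<partial>M) - (\<integral>s. f z0 s \<partial>M)) / (z - z0)) \<longlongrightarrow> (\<integral>s. f' z0 s \<partial>M)) (at z0 within U)"
    unfolding tendsto_at_iff_sequentially
  proof (intro allI impI)
    fix X assume X: "\<forall>i. X i \<in> U - {z0}" "X \<longlonglongrightarrow> z0"
    have XU: "X n \<in> U" "X n \<noteq> z0" for n using X by auto
    have "(\<lambda>n. \<integral>s. (f (X n) s - f z0 s) / (X n - z0) \<partial>M) \<longlonglongrightarrow> (\<integral>s. f' z0 s \<partial>M)"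
    proof (rule integral_dominated_convergence[OF meas _ g])
      show "(\<lambda>s. (f (X n) s - f z0 s) / (X n - z0)) \<in> borel_measurable M" for n
        using borel_measurable_integrable[OF int[OF XU(1)[of n]]] borel_measurable_integrable[OF int[OF U(3)]]
        by measurable
      show "AE s in M. (\<lambda>n. (f (X n) s - f z0 s) / (X n - z0)) \<longlonglongrightarrow> f' z0 s"
      proof (rule AE_I2)
        fix s
        have "((\<lambda>z. (f z s - f z0 s) / (z - z0)) \<longlongrightarrow> f' z0 s) (at z0)"
          using der[OF U(3)] by (simp add: has_field_derivative_iff)
        then show "(\<lambda>n. (f (X n) s - f z0 s) / (X n - z0)) \<longlonglongrightarrow> f' z0 s"
          unfolding tendsto_at_iff_sequentially using X by (auto simp: o_def)
      qed
      show "AE s in M. norm ((f (X n) s - f z0 s) / (X n - z0)) \<le> g s" for n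
      proof (rule AE_I2)
        fix s
        have "norm (f (X n) s - f z0 s) \<le> g s * norm (X n - z0)"
          by (rule field_differentiable_bound[OF U(2) has_field_derivative_at_within[OF der] bnd XU(1) U(3)])
        then show "norm ((f (X n) s - f z0 s) / (X n - z0)) \<le> g s"
          using XU(2)[of n] by (simp add: norm_divide divide_le_eq)
      qed
    qed
    then show "((\<lambda>z. ((\<integral>s. f z s \<partial>M) - (\<integral>s. f z0 s \<partial>M)) / (z - z0)) \<circ> X) \<longlonglongrightarrow> (\<integral>s. f' z0 s \<partial>M)"
      using int[OF XU(1)] int[OF U(3)] by (simp add: o_def)
  qed
  then show ?thesis
    unfolding has_field_derivative_iff by (simp only: at_within_open[OF U(3) U(1)])
qed

lemma real_derivatives_of_holomorphic:
  assumes "(F has_field_derivative D) (at (Complex x y))"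
  shows "((\<lambda>x. Re (F (Complex x y))) has_real_derivative Re D) (at x)"
    and "((\<lambda>y. Re (F (Complex x y))) has_real_derivative - Im D) (at y)"
    and "((\<lambda>y. Im (F (Complex x y))) has_real_derivative Re D) (at y)"
proof -
  have "((\<lambda>x. Complex x y) has_vector_derivative 1) (at x)"
    unfolding Complex_eq by (auto intro!: derivative_eq_intros simp: has_vector_derivative_def scaleR_conv_of_real)
  from field_vector_diff_chain_at[OF this assms]
  have x: "((\<lambda>x. F (Complex x y)) has_vector_derivative D) (at x)" by (simp add: o_def)
  have "((\<lambda>y. Complex x y) has_vector_derivative \<i>) (at y)"
    unfolding Complex_eq by (auto intro!: derivative_eq_intros simp: has_vector_derivative_def scaleR_conv_of_real)
  from field_vector_diff_chain_at[OF this assms]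
  have y: "((\<lambda>y. F (Complex x y)) has_vector_derivative \<i> * D) (at y)" by (simp add: o_def)
  show "((\<lambda>x. Re (F (Complex x y))) has_real_derivative Re D) (at x)"
    "((\<lambda>y. Re (F (Complex x y))) has_real_derivative - Im D) (at y)"
    "((\<lambda>y. Im (F (Complex x y))) has_real_derivative Re D) (at y)"
    using bounded_linear.has_vector_derivative[OF bounded_linear_Re x]
      bounded_linear.has_vector_derivative[OF bounded_linear_Re y]
      bounded_linear.has_vector_derivative[OF bounded_linear_Im y]
    by (simp_all add: has_real_derivative_iff_has_vector_derivative)
qed

lemma abs_ln_le: "0 < a \<Longrightarrow> a \<le> t \<Longrightarrow> t \<le> b \<Longrightarrow> \<bar>ln t\<bar> \<le> \<bar>ln a\<bar> + \<bar>ln b\<bar>" for a b t :: real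
  by (smt (verit) ln_mono)

lemma norm_Ln_bound: "w \<noteq> 0 \<Longrightarrow> cmod (Ln w) \<le> \<bar>ln (cmod w)\<bar> + pi"
  using cmod_le[of "Ln w"] Im_Ln_le_pi[of w] mpi_less_Im_Ln[of w] by (simp add: Re_Ln)

definition upper :: "complex set" where
  "upper = {z. cmod z < 1 \<and> 0 < Im z}"

lemma open_upper: "open upper"
  unfolding upper_def by (intro open_Collect_conj open_Collect_less continuous_intros)

context segment_potential
begin

text \<open>In the upper half disc this is \<open>\<partial>\<^sub>xu - \<i> \<partial>\<^sub>yu\<close> for the potential \<open>u\<close>, and the derivative of the holomorphic potential below.\<close>

definition dpot :: "complex \<Rightarrow> complex" where
  "dpot z = (\<integral>s. (1 / (z - of_real s) + of_real s / (1 - of_real s * z)) * of_real (dens s) \<partial>lborel)"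

definition cpot :: "complex \<Rightarrow> complex" where
  "cpot z = (\<integral>s. (Ln (z - of_real s) - Ln (1 - of_real s * z)) * of_real (dens s) \<partial>lborel)"

lemma upper_ne:
  assumes "z \<in> upper"
  shows "z - of_real s \<notin> \<real>\<^sub>\<le>\<^sub>0" "1 - of_real s * z \<notin> \<real>\<^sub>\<le>\<^sub>0" "z - of_real s \<noteq> 0" "1 - of_real s * z \<noteq> 0"
proof -
  show a: "z - of_real s \<notin> \<real>\<^sub>\<le>\<^sub>0" "1 - of_real s * z \<notin> \<real>\<^sub>\<le>\<^sub>0"
    using assms by (auto simp: upper_def complex_nonpos_Reals_iff)
  show "z - of_real s \<noteq> 0" "1 - of_real s * z \<noteq> 0" using a by auto
qed

lemma norm_bounds:
  assumes z: "z \<in> upper" and s: "0 < s" "s < 1"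
  shows "Im z \<le> cmod (z - of_real s)" "cmod (z - of_real s) \<le> 2"
    "1 - cmod z \<le> cmod (1 - of_real s * z)" "cmod (1 - of_real s * z) \<le> 2"
proof -
  show "Im z \<le> cmod (z - of_real s)"
    using abs_Im_le_cmod[of "z - of_real s"] by simp
  show "cmod (z - of_real s) \<le> 2"
    using norm_triangle_ineq4[of z "of_real s"] z s by (simp add: upper_def)
  have "cmod (of_real s * z) \<le> cmod z"
    using s mult_left_le_one_le[of "cmod z" s] by (simp add: norm_mult)
  moreover have "cmod z < 1" using z by (simp add: upper_def)
  ultimately show "1 - cmod z \<le> cmod (1 - of_real s * z)" "cmod (1 - of_real s * z) \<le> 2"
    using norm_triangle_ineq2[of 1 "of_real s * z"] norm_triangle_ineq4[of 1 "of_real s * z"] by auto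
qed

lemma integrable_cpot:
  assumes z: "z \<in> upper"
  shows "integrable lborel (\<lambda>s. (Ln (z - of_real s) - Ln (1 - of_real s * z)) * of_real (dens s))"
proof -
  let ?K = "\<bar>ln (Im z)\<bar> + \<bar>ln 2\<bar> + pi + (\<bar>ln (1 - cmod z)\<bar> + \<bar>ln 2\<bar> + pi)"
  have "integrable lborel (\<lambda>s. ?K * dens s)"
    by (intro integrable_mult_right integrable_dens)
  then show ?thesis
  proof (rule Bochner_Integration.integrable_bound)
    have "continuous_on UNIV (\<lambda>s. Ln (z - of_real s) - Ln (1 - of_real s * z))"
      by (intro continuous_intros) (use upper_ne[OF z] in auto)
    from borel_measurable_continuous_onI[OF this] show
      "(\<lambda>s. (Ln (z - of_real s) - Ln (1 - of_real s * z)) * of_real (dens s)) \<in> borel_measurable lborel"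
      by simp
    have "cmod (Ln (z - of_real s) - Ln (1 - of_real s * z)) \<le> ?K" if s: "0 < s" "s < 1" for s
    proof -
      note b = norm_bounds[OF z s]
      have "0 < Im z" "0 < 1 - cmod z" using z by (auto simp: upper_def)
      then have "\<bar>ln (cmod (z - of_real s))\<bar> \<le> \<bar>ln (Im z)\<bar> + \<bar>ln 2\<bar>"
        "\<bar>ln (cmod (1 - of_real s * z))\<bar> \<le> \<bar>ln (1 - cmod z)\<bar> + \<bar>ln 2\<bar>"
        using b by (intro abs_ln_le; simp)+
      then show ?thesis
        using norm_Ln_bound[OF upper_ne(3)[OF z], of s] norm_Ln_bound[OF upper_ne(4)[OF z], of s]
          norm_triangle_ineq4[of "Ln (z - of_real s)" "Ln (1 - of_real s * z)"] by linarith
    qed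
    then have "norm ((Ln (z - of_real s) - Ln (1 - of_real s * z)) * of_real (dens s)) \<le> ?K * dens s" for s
      using dens_nonneg[of s] by (cases "0 < s \<and> s < 1") (auto simp: norm_mult dens_0 intro!: mult_right_mono)
    moreover have "?K * dens s \<le> norm (?K * dens s)" for s by simp
    ultimately show "AE s in lborel. norm ((Ln (z - of_real s) - Ln (1 - of_real s * z)) * of_real (dens s))
       \<le> norm (?K * dens s)"
      by (intro AE_I2) (blast intro: order_trans)
  qed
qed

lemma dpot_integrand_bound:
  assumes z: "a \<le> Im z" "0 < a" "cmod z \<le> 1 - b" "0 < b"
  shows "cmod ((1 / (z - of_real s) + of_real s / (1 - of_real s * z)) * of_real (dens s)) \<le> (1 / a + 1 / b) * dens s"
proof (cases "0 < s \<and> s < 1")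
  case True
  have zu: "z \<in> upper" using z by (simp add: upper_def)
  note b = norm_bounds[OF zu True[THEN conjunct1] True[THEN conjunct2]]
  have "cmod (1 / (z - of_real s)) \<le> 1 / a"
    using b z by (simp add: norm_divide frac_le)
  moreover have "cmod (of_real s / (1 - of_real s * z)) \<le> 1 / b"
    using b z True unfolding norm_divide by (intro frac_le) auto
  ultimately have "cmod (1 / (z - of_real s) + of_real s / (1 - of_real s * z)) \<le> 1 / a + 1 / b"
    by (intro norm_triangle_mono)
  then show ?thesis
    using dens_nonneg[of s] by (simp add: norm_mult mult_right_mono)
qed (auto simp: dens_0)

lemma dpot_integrand_measurable [measurable]:
  "(\<lambda>s. (1 / (z - of_real s) + of_real s / (1 - of_real s * z)) * complex_of_real (dens s))
     \<in> borel_measurable borel"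
  by measurable

lemma integrable_dpot:
  assumes z: "z \<in> upper"
  shows "integrable lborel (\<lambda>s. (1 / (z - of_real s) + of_real s / (1 - of_real s * z)) * of_real (dens s))"
proof -
  have "integrable lborel (\<lambda>s. (1 / Im z + 1 / (1 - cmod z)) * dens s)"
    by (intro integrable_mult_right integrable_dens)
  then show ?thesis
    by (rule Bochner_Integration.integrable_bound)
      (use z dpot_integrand_bound[of "Im z" z "1 - cmod z"] dens_nonneg in
        \<open>auto simp: upper_def abs_mult simp del: of_real_mult\<close>)
qed

lemma cpot_deriv:
  assumes z: "z \<in> upper"
  shows "(cpot has_field_derivative dpot z) (at z)"
proof -
  define a where "a = Im z / 2"
  define b where "b = (1 - cmod z) / 2"
  define U where "U = {w. a < Im w} \<inter> ball 0 (1 - b)"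
  have ab: "0 < a" "0 < b" "a < Im z" "cmod z < 1 - b"
    using z by (auto simp: upper_def a_def b_def field_simps)
  have U: "open U" "convex U" "z \<in> U"
    unfolding U_def using ab
    by (auto intro!: open_Int open_halfspace_Im_gt convex_Int convex_halfspace_Im_gt)
  have Uu: "w \<in> upper" if "w \<in> U" for w
    using that ab by (auto simp: U_def upper_def)
  show ?thesis
    unfolding cpot_def[abs_def] dpot_def
  proof (rule has_field_derivative_lebesgue_integral[OF U])
    fix w s assume w: "w \<in> U"
    show "((\<lambda>z. (Ln (z - of_real s) - Ln (1 - of_real s * z)) * of_real (dens s)) has_field_derivative
       (1 / (w - of_real s) + of_real s / (1 - of_real s * w)) * of_real (dens s)) (at w)"
      using upper_ne[OF Uu[OF w], of s]
      by (auto intro!: derivative_eq_intros simp: divide_inverse mult.commute)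
    show "cmod ((1 / (w - of_real s) + of_real s / (1 - of_real s * w)) * of_real (dens s)) \<le> (1 / a + 1 / b) * dens s"
      using w ab by (intro dpot_integrand_bound) (auto simp: U_def)
  qed (auto intro!: integrable_cpot Uu integrable_dens)
qed

lemma Re_cpot:
  assumes z: "z \<in> upper"
  shows "Re (cpot z) = pot z"
proof -
  have "Re (cpot z) = (\<integral>s. Re ((Ln (z - of_real s) - Ln (1 - of_real s * z)) * of_real (dens s)) \<partial>lborel)"
    unfolding cpot_def by (rule integral_Re[OF integrable_cpot[OF z], symmetric])
  also have "\<dots> = pot z"
    unfolding pot_def kernel_def using upper_ne(3,4)[OF z]
    by (intro Bochner_Integration.integral_cong) (auto simp: Re_Ln norm_divide ln_div)
  finally show ?thesis .
qed

lemma dpot_holomorphic: "dpot holomorphic_on upper"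
proof -
  have "cpot holomorphic_on upper"
    using cpot_deriv open_upper by (auto simp: holomorphic_on_open)
  then have "deriv cpot holomorphic_on upper"
    by (intro holomorphic_deriv open_upper)
  then show ?thesis
    by (rule holomorphic_transform) (use cpot_deriv in \<open>auto intro: DERIV_imp_deriv\<close>)
qed

lemma dpot_deriv: "z \<in> upper \<Longrightarrow> (dpot has_field_derivative deriv dpot z) (at z)"
  by (rule holomorphic_derivI[OF dpot_holomorphic open_upper])

lemma pot_derivatives:
  assumes z: "Complex x y \<in> upper"
  shows "((\<lambda>x. pot (Complex x y)) has_real_derivative Re (dpot (Complex x y))) (at x)"
    and "((\<lambda>y. pot (Complex x y)) has_real_derivative - Im (dpot (Complex x y))) (at y)"
    and "((\<lambda>x. Re (dpot (Complex x y))) has_real_derivative Re (deriv dpot (Complex x y))) (at x)"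
    and "((\<lambda>y. - Im (dpot (Complex x y))) has_real_derivative - Re (deriv dpot (Complex x y))) (at y)"
proof -
  have "continuous_on UNIV (\<lambda>x. Complex x y)" "continuous_on UNIV (\<lambda>y. Complex x y)"
    unfolding Complex_eq by (intro continuous_intros)+
  from this[THEN open_vimage[OF open_upper]]
  have o: "open {x. Complex x y \<in> upper}" "open {y. Complex x y \<in> upper}"
    by (simp_all add: vimage_def)
  note F = real_derivatives_of_holomorphic[OF cpot_deriv[OF z]]
  show "((\<lambda>x. pot (Complex x y)) has_real_derivative Re (dpot (Complex x y))) (at x)"
    by (rule has_field_derivative_transform_within_open[OF F(1) o(1)]) (use z Re_cpot in auto)
  show "((\<lambda>y. pot (Complex x y)) has_real_derivative - Im (dpot (Complex x y))) (at y)"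
    by (rule has_field_derivative_transform_within_open[OF F(2) o(2)]) (use z Re_cpot in auto)
  note G = real_derivatives_of_holomorphic[OF dpot_deriv[OF z]]
  show "((\<lambda>x. Re (dpot (Complex x y))) has_real_derivative Re (deriv dpot (Complex x y))) (at x)"
    by (rule G)
  show "((\<lambda>y. - Im (dpot (Complex x y))) has_real_derivative - Re (deriv dpot (Complex x y))) (at y)"
    by (rule DERIV_minus[OF G(3)])
qed

lemma continuous_on_pot: "continuous_on upper pot"
proof -
  have "continuous_on upper (\<lambda>z. Re (cpot z))"
    using cpot_deriv by (intro continuous_intros continuous_at_imp_continuous_on ballI) (blast intro: DERIV_isCont)
  then show ?thesis
    by (subst continuous_on_cong[OF refl Re_cpot[symmetric]])
qed

lemma vertical_derivative_integrand:
  assumes z: "z \<in> upper"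
  shows "- Im ((1 / (z - of_real s) + of_real s / (1 - of_real s * z)) * of_real (dens s)) =
    (Im z / (cmod (z - of_real s))\<^sup>2 - s\<^sup>2 * Im z / (cmod (1 - of_real s * z))\<^sup>2) * dens s"
proof -
  have "Im (1 / (z - of_real s)) = - Im z / (cmod (z - of_real s))\<^sup>2"
    by (simp add: Im_divide cmod_power2)
  moreover have "Im (of_real s / (1 - of_real s * z)) = s\<^sup>2 * Im z / (cmod (1 - of_real s * z))\<^sup>2"
    unfolding cmod_power2 by (simp add: Im_divide power2_eq_square)
  moreover have "Im (w * complex_of_real d) = Im w * d" for w d by simp
  ultimately show ?thesis
    by (simp only: plus_complex.sel) (simp add: left_diff_distrib distrib_right)
qed

lemma vertical_derivative_eq:
  assumes z: "z \<in> upper"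
  shows "- Im (dpot z) = (\<integral>s. (Im z / (cmod (z - of_real s))\<^sup>2 - s\<^sup>2 * Im z / (cmod (1 - of_real s * z))\<^sup>2) * dens s \<partial>lborel)"
    and "integrable lborel (\<lambda>s. (Im z / (cmod (z - of_real s))\<^sup>2 - s\<^sup>2 * Im z / (cmod (1 - of_real s * z))\<^sup>2) * dens s)"
proof -
  have "- Im (dpot z) = - (\<integral>s. Im ((1 / (z - of_real s) + of_real s / (1 - of_real s * z)) * of_real (dens s)) \<partial>lborel)"
    unfolding dpot_def by (simp only: integral_Im[OF integrable_dpot[OF z]])
  also have "\<dots> = (\<integral>s. - Im ((1 / (z - of_real s) + of_real s / (1 - of_real s * z)) * of_real (dens s)) \<partial>lborel)"
    by simp
  finally show "- Im (dpot z) = (\<integral>s. (Im z / (cmod (z - of_real s))\<^sup>2 - s\<^sup>2 * Im z / (cmod (1 - of_real s * z))\<^sup>2) * dens s \<partial>lborel)"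
    by (simp only: vertical_derivative_integrand[OF z])
  have "integrable lborel (\<lambda>s. - Im ((1 / (z - of_real s) + of_real s / (1 - of_real s * z)) * of_real (dens s)))"
    by (intro Bochner_Integration.integrable_minus integrable_Im integrable_dpot z)
  then show "integrable lborel (\<lambda>s. (Im z / (cmod (z - of_real s))\<^sup>2 - s\<^sup>2 * Im z / (cmod (1 - of_real s * z))\<^sup>2) * dens s)"
    by (simp only: vertical_derivative_integrand[OF z])
qed

text \<open>The integrand is positive because \<open>\<bar>1 - s z\<bar>\<^sup>2 - s\<^sup>2 \<bar>z - s\<bar>\<^sup>2 = (1 - s\<^sup>2) (1 + s\<^sup>2 - 2 s Re z)\<close>.\<close>

lemma vertical_derivative_pos:
  assumes z: "z \<in> upper"
  shows "0 < - Im (dpot z)"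
  unfolding vertical_derivative_eq(1)[OF z]
proof (rule segment_integral_pos[of _ 0])
  fix s :: real assume s: "0 < s" "s < 1"
  have pos: "0 < (cmod (z - of_real s))\<^sup>2" "0 < (cmod (1 - of_real s * z))\<^sup>2"
    using upper_ne(3,4)[OF z] by auto
  have "Re z < 1" using z abs_Re_le_cmod[of z] by (auto simp: upper_def)
  then have "s * Re z < s * 1" using s by (intro mult_strict_left_mono)
  moreover have "0 \<le> (1 - s)\<^sup>2" by simp
  ultimately have "0 < 1 + s\<^sup>2 - 2 * s * Re z" by (simp add: power2_eq_square algebra_simps)
  moreover have "0 < 1 - s\<^sup>2" using s by (simp add: power_less_one_iff)
  ultimately have "0 < (1 - s\<^sup>2) * (1 + s\<^sup>2 - 2 * s * Re z)" by simp
  also have "\<dots> = (cmod (1 - of_real s * z))\<^sup>2 - s\<^sup>2 * (cmod (z - of_real s))\<^sup>2"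
    unfolding cmod_power2 by (simp add: algebra_simps power2_eq_square)
  finally have "s\<^sup>2 / (cmod (1 - of_real s * z))\<^sup>2 < 1 / (cmod (z - of_real s))\<^sup>2"
    using pos by (simp add: divide_simps)
  then have "Im z * (s\<^sup>2 / (cmod (1 - of_real s * z))\<^sup>2) < Im z * (1 / (cmod (z - of_real s))\<^sup>2)"
    using z by (intro mult_strict_left_mono) (auto simp: upper_def)
  then show "0 < (Im z / (cmod (z - of_real s))\<^sup>2 - s\<^sup>2 * Im z / (cmod (1 - of_real s * z))\<^sup>2) * dens s"
    using dens_pos[OF s] by (simp add: mult.commute)
qed (auto simp: dens_0 vertical_derivative_eq(2)[OF z])

lemma disc_vertical:
  assumes "cmod (Complex x y) < 1" "0 \<le> t" "t \<le> y"
  shows "cmod (Complex x t) < 1"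
proof -
  have "t\<^sup>2 \<le> y\<^sup>2" using assms(2,3) by (intro power_mono)
  then have "(cmod (Complex x t))\<^sup>2 \<le> (cmod (Complex x y))\<^sup>2"
    unfolding cmod_power2 by simp
  then have "cmod (Complex x t) \<le> cmod (Complex x y)" by (rule power2_le_imp_le) simp
  with assms show ?thesis by simp
qed

lemma pot_vertical_strict_mono_pos:
  assumes "cmod (Complex x b) < 1" "0 < a" "a < b"
  shows "pot (Complex x a) < pot (Complex x b)"
proof (rule DERIV_pos_imp_increasing[OF assms(3)])
  fix y assume y: "a \<le> y" "y \<le> b"
  then have "Complex x y \<in> upper"
    using disc_vertical[OF assms(1), of y] assms by (auto simp: upper_def)
  then show "\<exists>d. ((\<lambda>y. pot (Complex x y)) has_real_derivative d) (at y) \<and> 0 < d"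
    using pot_derivatives(2) vertical_derivative_pos by blast
qed

text \<open>The lower endpoint may lie on the axis, where the derivative need not exist: there the statement follows
from the case of positive heights by continuity.\<close>

lemma pot_vertical_strict_mono:
  assumes b: "cmod (Complex x b) < 1" "0 \<le> a" "a < b"
  shows "pot (Complex x a) < pot (Complex x b)"
proof (cases "a = 0")
  case False
  then show ?thesis using assms by (intro pot_vertical_strict_mono_pos) auto
next
  case True
  define Y where "Y n = b / 2 / real (Suc n)" for n
  have Y: "0 < Y n" "Y n \<le> b / 2" for n
    using b True by (auto simp: Y_def field_simps)
  have Yb: "Y n \<le> b" for n using Y(2)[of n] b True by simp
  have Y0: "Y \<longlonglongrightarrow> 0" unfolding Y_def by real_asymp
  have disc: "cmod (Complex x t) < 1" if "0 \<le> t" "t \<le> b" for t using disc_vertical[OF b(1) that] .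
  have "\<bar>x\<bar> < 1" using disc[of 0] b by (simp add: True complex_of_real_def[symmetric])
  then have "(\<lambda>n. pot (Complex x (Y n))) \<longlonglongrightarrow> pot (Complex x 0)"
    using Y0 by (rule pot_vertical_limit) (use Y Yb in \<open>auto intro: disc less_imp_le\<close>)
  moreover have "pot (Complex x (Y n)) \<le> pot (Complex x (b / 2))" for n
    using pot_vertical_strict_mono_pos[of x "b / 2" "Y n"] Y[of n] disc[of "b/2"] b True
    by (cases "Y n = b / 2") auto
  ultimately have "pot (Complex x 0) \<le> pot (Complex x (b / 2))"
    by (intro LIMSEQ_le_const2) auto
  also have "\<dots> < pot (Complex x b)"
    using b True by (intro pot_vertical_strict_mono_pos) auto
  finally show ?thesis using True by simp
qed

lemma cauchy_density:
  "integrable lborel (\<lambda>\<tau>::real. inverse (1 + \<tau>\<^sup>2))" "(\<integral>\<tau>. inverse (1 + \<tau>\<^sup>2) \<partial>lborel) = pi"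
  using integrable_inverse_1_plus_square LBINT_inverse_1_plus_square
  by (simp_all add: set_integrable_def interval_lebesgue_integral_def set_lebesgue_integral_def)

text \<open>Near a point of \<open>[-R, R]\<close> the density agrees with this bounded one; the singularity at \<open>1\<close> is cut off halfway
between \<open>R\<close> and \<open>1\<close>.\<close>

definition dens_near :: "real \<Rightarrow> real \<Rightarrow> real" where
  "dens_near R s = indicator {..(1 + R) / 2} s * dens s"

lemma dens_near_measurable [measurable]: "dens_near R \<in> borel_measurable borel"
  unfolding dens_near_def[abs_def] by measurable

lemma dens_near_bounds:
  assumes "R < 1"
  shows "0 \<le> dens_near R s" "dens_near R s \<le> dens s" "dens_near R s \<le> ((1 - R) / 2) powr (- \<beta>)"
proof -
  show "0 \<le> dens_near R s" "dens_near R s \<le> dens s"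
    using dens_nonneg[of s] by (auto simp: dens_near_def indicator_def)
  show "dens_near R s \<le> ((1 - R) / 2) powr (- \<beta>)"
  proof (cases "0 < s \<and> s < 1 \<and> s \<le> (1 + R) / 2")
    case True
    then have "(1 - s) powr (- \<beta>) \<le> ((1 - R) / 2) powr (- \<beta>)"
      using assms beta by (intro powr_mono2') (auto simp: field_simps)
    then show ?thesis
      using True by (simp add: dens_near_def dens_def powr_minus field_simps)
  qed (auto simp: dens_near_def dens_0 indicator_def)
qed

lemma isCont_dens_near:
  assumes "R < 1" "\<bar>x\<bar> \<le> R" "x \<noteq> 0"
  shows "isCont (dens_near R) x"
proof (cases "0 < x")
  case True
  have "continuous_on {0<..<(1 + R) / 2} (\<lambda>s. 1 / (1 - s) powr \<beta>)"
    using assms by (auto intro!: continuous_intros)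
  then have "continuous_on {0<..<(1 + R) / 2} (dens_near R)"
    by (rule continuous_on_eq) (use assms in \<open>auto simp: dens_near_def dens_def indicator_def\<close>)
  then show ?thesis
    using assms True by (auto simp: continuous_on_eq_continuous_at)
next
  case False
  have "continuous_on {..<0} (dens_near R)"
    by (rule continuous_on_eq[OF continuous_on_const[of _ 0]]) (auto simp: dens_near_def dens_def)
  then show ?thesis
    using assms False by (auto simp: continuous_on_eq_continuous_at)
qed

text \<open>The substitution \<open>s = x + y \<tau>\<close> turns the Poisson integral into an average against the Cauchy density, to which
dominated convergence applies as \<open>y\<close> tends to \<open>0\<close>.\<close>

lemma poisson_near:
  assumes "R < 1" "0 < y"
  shows "integrable lborel (\<lambda>\<tau>. dens_near R (x + y * \<tau>) * inverse (1 + \<tau>\<^sup>2))"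
    and "(\<integral>s. y / ((x - s)\<^sup>2 + y\<^sup>2) * dens_near R s \<partial>lborel) =
      (\<integral>\<tau>. dens_near R (x + y * \<tau>) * inverse (1 + \<tau>\<^sup>2) \<partial>lborel)"
    and "integrable lborel (\<lambda>s. y / ((x - s)\<^sup>2 + y\<^sup>2) * dens_near R s)"
proof -
  let ?B = "((1 - R) / 2) powr (- \<beta>)"
  let ?f = "\<lambda>s. y / ((x - s)\<^sup>2 + y\<^sup>2) * dens_near R s"
  show 1: "integrable lborel (\<lambda>\<tau>. dens_near R (x + y * \<tau>) * inverse (1 + \<tau>\<^sup>2))"
  proof (rule Bochner_Integration.integrable_bound)
    show "integrable lborel (\<lambda>\<tau>. ?B * inverse (1 + \<tau>\<^sup>2))"
      by (intro integrable_mult_right cauchy_density)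
    show "AE \<tau> in lborel. norm (dens_near R (x + y * \<tau>) * inverse (1 + \<tau>\<^sup>2)) \<le> norm (?B * inverse (1 + \<tau>\<^sup>2))"
      using dens_near_bounds[OF assms(1)] by (intro AE_I2) (auto simp: abs_mult intro!: mult_right_mono)
  qed measurable
  have f: "?f (x + y * \<tau>) = inverse y * (dens_near R (x + y * \<tau>) * inverse (1 + \<tau>\<^sup>2))" for \<tau>
  proof -
    have "0 < 1 + \<tau>\<^sup>2" by (simp add: add_pos_nonneg)
    moreover have "(x - (x + y * \<tau>))\<^sup>2 + y\<^sup>2 = y * y * (1 + \<tau>\<^sup>2)"
      by (simp add: power2_eq_square algebra_simps)
    ultimately show ?thesis
      using assms by (simp add: divide_simps)
  qed
  show "(\<integral>s. ?f s \<partial>lborel) = (\<integral>\<tau>. dens_near R (x + y * \<tau>) * inverse (1 + \<tau>\<^sup>2) \<partial>lborel)"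
    using assms by (subst lborel_integral_real_affine[of y _ x]) (simp_all only: f, simp_all)
  have "integrable lborel (\<lambda>\<tau>. ?f (x + y * \<tau>))"
    unfolding f by (intro integrable_mult_right 1)
  then show "integrable lborel ?f"
    using assms by (subst (asm) lborel_integrable_real_affine_iff) auto
qed

text \<open>Up to an error of order \<open>y\<close>, the vertical derivative is the Poisson integral of the bounded part of the
density: the part of the density near \<open>1\<close> and the reflected kernel \<open>s / (1 - s z)\<close> are both seen from a
positive distance.\<close>

lemma vertical_derivative_split:
  assumes z: "Complex x y \<in> upper" and R: "\<bar>x\<bar> \<le> R" "R < 1"
  obtains e where "- Im (dpot (Complex x y)) =
      (\<integral>\<tau>. dens_near R (x + y * \<tau>) * inverse (1 + \<tau>\<^sup>2) \<partial>lborel) + e"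
    "\<bar>e\<bar> \<le> y * (4 / (1 - R)\<^sup>2 * (\<integral>s. dens s \<partial>lborel))"
proof -
  let ?c = "4 / (1 - R)\<^sup>2"
  have y: "0 < y" using z by (simp add: upper_def)
  define f where "f s = (y / ((x - s)\<^sup>2 + y\<^sup>2) - s\<^sup>2 * y / (cmod (1 - of_real s * Complex x y))\<^sup>2) * dens s" for s
  define g where "g s = y / ((x - s)\<^sup>2 + y\<^sup>2) * dens_near R s" for s
  have f: "integrable lborel f" "- Im (dpot (Complex x y)) = (\<integral>s. f s \<partial>lborel)"
    using vertical_derivative_eq[OF z] by (simp_all add: f_def[abs_def] cmod_power2)
  have g: "integrable lborel g" using poisson_near(3)[OF R(2) y] by (simp add: g_def[abs_def])
  have D: "integrable lborel (\<lambda>s. y * (?c * dens s))"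
    by (intro integrable_mult_right integrable_dens)
  have bound: "\<bar>f s - g s\<bar> \<le> y * (?c * dens s)" for s
  proof (cases "0 < s \<and> s < 1")
    case False
    then show ?thesis by (simp add: f_def g_def dens_near_def dens_0)
  next
    case True
    define a where "a = y / ((x - s)\<^sup>2 + y\<^sup>2) * (dens s - dens_near R s)"
    define b where "b = s\<^sup>2 * y / (cmod (1 - of_real s * Complex x y))\<^sup>2 * dens s"
    have fg: "f s - g s = a - b" by (simp add: f_def g_def a_def b_def left_diff_distrib right_diff_distrib)
    have "0 \<le> a" "0 \<le> b"
      using y dens_near_bounds[OF R(2), of s] dens_nonneg[of s]
      by (auto simp: a_def b_def intro!: mult_nonneg_nonneg divide_nonneg_nonneg)
    moreover have "a \<le> y * (?c * dens s)"
    proof (cases "s \<le> (1 + R) / 2")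
      case True
      then show ?thesis using y dens_nonneg[of s] R by (simp add: a_def dens_near_def)
    next
      case False
      then have "(1 - R) / 2 \<le> s - x" using R by (simp add: field_simps)
      then have "((1 - R) / 2)\<^sup>2 \<le> (s - x)\<^sup>2" using R by (intro power_mono) auto
      also have "\<dots> \<le> (x - s)\<^sup>2 + y\<^sup>2" by (simp add: power2_commute)
      finally have "y / ((x - s)\<^sup>2 + y\<^sup>2) \<le> y / ((1 - R) / 2)\<^sup>2"
        using y R by (intro divide_left_mono mult_pos_pos add_nonneg_pos) auto
      also have "\<dots> = y * ?c" by (simp add: power_divide)
      finally have "y / ((x - s)\<^sup>2 + y\<^sup>2) * dens s \<le> y * ?c * dens s"
        by (rule mult_right_mono) (rule dens_nonneg)
      then show ?thesis
        using False by (simp add: a_def dens_near_def mult.assoc)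
    qed
    moreover have "b \<le> y * (?c * dens s)"
    proof -
      have "s * x \<le> s * R" using True R by (intro mult_left_mono) auto
      also have "\<dots> \<le> R" using True R mult_left_le_one_le[of R s] by auto
      finally have "(1 - R) / 2 \<le> 1 - s * x" using R by simp
      then have "((1 - R) / 2)\<^sup>2 \<le> (1 - s * x)\<^sup>2" using R by (intro power_mono) auto
      also have "\<dots> \<le> (cmod (1 - of_real s * Complex x y))\<^sup>2"
        unfolding cmod_power2 by simp
      finally have "s\<^sup>2 * y / (cmod (1 - of_real s * Complex x y))\<^sup>2 \<le> s\<^sup>2 * y / ((1 - R) / 2)\<^sup>2"
        using y R by (intro divide_left_mono mult_pos_pos) auto
      also have "\<dots> \<le> 1 * y / ((1 - R) / 2)\<^sup>2"
        using True y by (intro divide_right_mono mult_right_mono) (auto simp: power_le_one)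
      also have "\<dots> = y * ?c" by (simp add: power_divide)
      finally have "s\<^sup>2 * y / (cmod (1 - of_real s * Complex x y))\<^sup>2 * dens s \<le> y * ?c * dens s"
        by (rule mult_right_mono) (rule dens_nonneg)
      then show ?thesis
        unfolding b_def by (simp only: mult.assoc)
    qed
    ultimately show ?thesis unfolding fg by linarith
  qed
  show thesis
  proof (rule that[of "(\<integral>s. f s - g s \<partial>lborel)"])
    show "- Im (dpot (Complex x y)) =
      (\<integral>\<tau>. dens_near R (x + y * \<tau>) * inverse (1 + \<tau>\<^sup>2) \<partial>lborel) + (\<integral>s. f s - g s \<partial>lborel)"
      using poisson_near(2)[OF R(2) y, of x, folded g_def] f g by simp
    have "\<bar>\<integral>s. f s - g s \<partial>lborel\<bar> \<le> (\<integral>s. y * (?c * dens s) \<partial>lborel)"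
      using bound f g D by (intro order_trans[OF integral_abs_bound] integral_mono) auto
    then show "\<bar>\<integral>s. f s - g s \<partial>lborel\<bar> \<le> y * (?c * (\<integral>s. dens s \<partial>lborel))"
      by simp
  qed
qed

lemma vertical_derivative_bounded:
  assumes R: "R < 1"
  obtains B where "0 \<le> B" "\<And>z. z \<in> upper \<Longrightarrow> \<bar>Re z\<bar> \<le> R \<Longrightarrow> - Im (dpot z) \<le> B"
proof (rule that)
  let ?b = "((1 - R) / 2) powr (- \<beta>)" and ?D = "4 / (1 - R)\<^sup>2 * (\<integral>s. dens s \<partial>lborel)"
  have D: "0 \<le> ?D"
    by (intro mult_nonneg_nonneg Bochner_Integration.integral_nonneg dens_nonneg) auto
  then show "0 \<le> ?b * pi + ?D" by simp
  fix z assume z: "z \<in> upper" "\<bar>Re z\<bar> \<le> R"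
  obtain x y where xy: "z = Complex x y" by (cases z)
  with z have *: "Complex x y \<in> upper" "\<bar>x\<bar> \<le> R" and y: "0 < y" by (auto simp: upper_def)
  have "y \<le> cmod z" using xy abs_Im_le_cmod[of z] by simp
  with z have y1: "y \<le> 1" by (auto simp: upper_def)
  obtain e where e: "- Im (dpot (Complex x y)) =
      (\<integral>\<tau>. dens_near R (x + y * \<tau>) * inverse (1 + \<tau>\<^sup>2) \<partial>lborel) + e" "\<bar>e\<bar> \<le> y * ?D"
    using vertical_derivative_split[OF * R] .
  have "(\<integral>\<tau>. dens_near R (x + y * \<tau>) * inverse (1 + \<tau>\<^sup>2) \<partial>lborel) \<le> (\<integral>\<tau>. ?b * inverse (1 + \<tau>\<^sup>2) \<partial>lborel)"
    using poisson_near(1)[OF R y, of x] dens_near_bounds[OF R]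
    by (intro integral_mono integrable_mult_right cauchy_density) (auto intro!: mult_right_mono)
  also have "\<dots> = ?b * pi" by (simp add: cauchy_density)
  finally show "- Im (dpot z) \<le> ?b * pi + ?D"
    using e mult_left_le_one_le[OF D _ y1] y by (simp add: xy)
qed

text \<open>The vertical derivative jumps by \<open>2 \<pi>\<close> times the density across the segment. The point \<open>0\<close> is excluded, since the
density is discontinuous there.\<close>

lemma vertical_derivative_boundary_limit:
  assumes x: "\<bar>x\<bar> < 1" "x \<noteq> 0" and Y: "Y \<longlonglongrightarrow> 0" "\<And>n. Complex x (Y n) \<in> upper"
  shows "(\<lambda>n. - Im (dpot (Complex x (Y n)))) \<longlonglongrightarrow> pi * dens x"
proof -
  define R where "R = \<bar>x\<bar>"
  have R: "\<bar>x\<bar> \<le> R" "R < 1" using x by (auto simp: R_def)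
  let ?b = "((1 - R) / 2) powr (- \<beta>)" and ?D = "4 / (1 - R)\<^sup>2 * (\<integral>s. dens s \<partial>lborel)"
  let ?P = "\<lambda>n. \<integral>\<tau>. dens_near R (x + Y n * \<tau>) * inverse (1 + \<tau>\<^sup>2) \<partial>lborel"
  have "?P \<longlonglongrightarrow> (\<integral>\<tau>. dens_near R x * inverse (1 + \<tau>\<^sup>2) \<partial>lborel)"
  proof (rule integral_dominated_convergence)
    show "integrable lborel (\<lambda>\<tau>. ?b * inverse (1 + \<tau>\<^sup>2))"
      by (intro integrable_mult_right cauchy_density)
    show "AE \<tau> in lborel. norm (dens_near R (x + Y n * \<tau>) * inverse (1 + \<tau>\<^sup>2)) \<le> ?b * inverse (1 + \<tau>\<^sup>2)" for n
      using dens_near_bounds[OF R(2)] by (intro AE_I2) (auto simp: abs_mult intro!: mult_right_mono)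
    show "AE \<tau> in lborel. (\<lambda>n. dens_near R (x + Y n * \<tau>) * inverse (1 + \<tau>\<^sup>2)) \<longlonglongrightarrow> dens_near R x * inverse (1 + \<tau>\<^sup>2)"
    proof (rule AE_I2)
      fix \<tau> :: real
      have "(\<lambda>n. x + Y n * \<tau>) \<longlonglongrightarrow> x + 0 * \<tau>"
        by (intro tendsto_intros Y)
      then have "(\<lambda>n. dens_near R (x + Y n * \<tau>)) \<longlonglongrightarrow> dens_near R x"
        using isCont_dens_near[OF R(2,1) x(2)] by (auto intro: isCont_tendsto_compose)
      then show "(\<lambda>n. dens_near R (x + Y n * \<tau>) * inverse (1 + \<tau>\<^sup>2)) \<longlonglongrightarrow> dens_near R x * inverse (1 + \<tau>\<^sup>2)"
        by (intro tendsto_intros)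
    qed
  qed measurable
  moreover have "dens_near R x = dens x"
    using R by (auto simp: dens_near_def indicator_def field_simps)
  ultimately have P: "?P \<longlonglongrightarrow> pi * dens x"
    by (simp add: cauchy_density mult.commute)
  define e where "e n = - Im (dpot (Complex x (Y n))) - ?P n" for n
  have "\<bar>e n\<bar> \<le> Y n * ?D" for n
  proof -
    obtain d where "- Im (dpot (Complex x (Y n))) = ?P n + d" "\<bar>d\<bar> \<le> Y n * ?D"
      using vertical_derivative_split[OF Y(2) R] .
    then show ?thesis by (simp add: e_def)
  qed
  moreover have "(\<lambda>n. Y n * ?D) \<longlonglongrightarrow> 0"
    using tendsto_mult_right[OF Y(1), of ?D] by simp
  ultimately have "e \<longlonglongrightarrow> 0"
    by (intro Lim_null_comparison[of e "\<lambda>n. Y n * ?D"]) auto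
  from tendsto_add[OF P this] show ?thesis
    by (simp add: e_def)
qed

end

section \<open>Green's formula in a half plane\<close>

lemma lborel_complex:
  "distr (lborel \<Otimes>\<^sub>M lborel) borel (\<lambda>(x, y). Complex x y) = (lborel :: complex measure)"
proof (rule lborel_eqI[symmetric])
  have [measurable]: "(\<lambda>(x, y). Complex x y) \<in> borel_measurable (lborel \<Otimes>\<^sub>M lborel)"
    unfolding Complex_eq by measurable
  fix l u :: complex assume le: "\<And>b. b \<in> Basis \<Longrightarrow> l \<bullet> b \<le> u \<bullet> b"
  have "(\<lambda>(x, y). Complex x y) -` box l u \<inter> space (lborel \<Otimes>\<^sub>M lborel) =
      {Re l<..<Re u} \<times> {Im l<..<Im u}"
    by (auto simp: in_box_complex space_pair_measure)
  then have "emeasure (distr (lborel \<Otimes>\<^sub>M lborel) borel (\<lambda>(x, y). Complex x y)) (box l u) =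
      emeasure (lborel \<Otimes>\<^sub>M lborel) ({Re l<..<Re u} \<times> {Im l<..<Im u})"
    by (subst emeasure_distr) auto
  also have "\<dots> = ennreal (Re u - Re l) * ennreal (Im u - Im l)"
    using le[of 1] le[of \<i>] by (subst lborel.emeasure_pair_measure_Times) (auto simp: Basis_complex_def)
  also have "\<dots> = ennreal (\<Prod>b\<in>Basis. (u - l) \<bullet> b)"
    using le[of 1] le[of \<i>] by (auto simp: Basis_complex_def ennreal_mult)
  finally show "emeasure (distr (lborel \<Otimes>\<^sub>M lborel) borel (\<lambda>(x, y). Complex x y)) (box l u) =
     ennreal (\<Prod>b\<in>Basis. (u - l) \<bullet> b)" .
qed simp

lemma Complex_measurable [measurable]:
  assumes "f \<in> borel_measurable M" "g \<in> borel_measurable M"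
  shows "(\<lambda>x. Complex (f x) (g x)) \<in> borel_measurable M"
  unfolding Complex_eq using assms by measurable

lemma complex_Fubini:
  fixes f :: "complex \<Rightarrow> real"
  assumes f: "integrable lborel f"
  shows "(\<integral>z. f z \<partial>lborel) = (\<integral>x. \<integral>y. f (Complex x y) \<partial>lborel \<partial>lborel)"
    and "(\<integral>z. f z \<partial>lborel) = (\<integral>y. \<integral>x. f (Complex x y) \<partial>lborel \<partial>lborel)"
proof -
  have m: "(\<lambda>(x, y). Complex x y) \<in> lborel \<Otimes>\<^sub>M lborel \<rightarrow>\<^sub>M borel"
    by measurable
  have fm: "f \<in> borel_measurable borel" using f by auto
  have int: "integrable (lborel \<Otimes>\<^sub>M lborel) (\<lambda>(x, y). f (Complex x y))"
    using f integrable_distr_eq[OF m fm] unfolding lborel_complex by (simp add: case_prod_beta')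
  have eq: "(\<integral>z. f z \<partial>lborel) = (\<integral>p. (case p of (x, y) \<Rightarrow> f (Complex x y)) \<partial>(lborel \<Otimes>\<^sub>M lborel))"
    using integral_distr[OF m fm] unfolding lborel_complex by (simp add: case_prod_beta')
  show "(\<integral>z. f z \<partial>lborel) = (\<integral>x. \<integral>y. f (Complex x y) \<partial>lborel \<partial>lborel)"
    using lborel_pair.integral_fst'[OF int] eq by simp
  show "(\<integral>z. f z \<partial>lborel) = (\<integral>y. \<integral>x. f (Complex x y) \<partial>lborel \<partial>lborel)"
    using lborel_pair.integral_snd[OF int] eq by simp
qed

text \<open>The integrands below vanish outside the unit disc or the interval \<open>[-1, 1]\<close>, so that boundedness is enough for integrability.\<close>

lemma integrable_bounded_support:
  fixes f :: "'a::euclidean_space \<Rightarrow> real"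
  assumes "f \<in> borel_measurable borel" "\<And>z. \<bar>f z\<bar> \<le> B" "\<And>z. 1 < norm z \<Longrightarrow> f z = 0"
  shows "integrable lborel f"
proof (rule Bochner_Integration.integrable_bound)
  show "integrable lborel (\<lambda>z. B * indicator (cball (0::'a) 1) z)"
    using emeasure_lborel_cball_finite[of "0::'a" 1] by (intro integrable_mult_right) simp
  show "AE z in lborel. norm (f z) \<le> norm (B * indicator (cball (0::'a) 1) z)"
  proof (rule AE_I2)
    fix z show "norm (f z) \<le> norm (B * indicator (cball (0::'a) 1) z)"
      using assms(2)[of z] assms(3)[of z] by (cases "norm z \<le> 1") auto
  qed
qed (use assms in simp)

lemma C2_compactD:
  assumes "C2_compact R p px py pxx pyy"
  shows "continuous_on A p" "continuous_on A px" "continuous_on A py" "continuous_on A pxx" "continuous_on A pyy"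
    and "R \<le> cmod z \<Longrightarrow> p z = 0" "R \<le> cmod z \<Longrightarrow> px z = 0" "R \<le> cmod z \<Longrightarrow> py z = 0"
      "R \<le> cmod z \<Longrightarrow> pxx z = 0" "R \<le> cmod z \<Longrightarrow> pyy z = 0"
    and "((\<lambda>x. p (Complex x y)) has_real_derivative px (Complex x y)) (at x)"
      "((\<lambda>y. p (Complex x y)) has_real_derivative py (Complex x y)) (at y)"
      "((\<lambda>x. px (Complex x y)) has_real_derivative pxx (Complex x y)) (at x)"
      "((\<lambda>y. py (Complex x y)) has_real_derivative pyy (Complex x y)) (at y)"
  using assms by (auto simp: C2_compact_def intro: continuous_on_subset[OF _ subset_UNIV])

lemma C2_compact_mono: "C2_compact R p px py pxx pyy \<Longrightarrow> R \<le> R' \<Longrightarrow> C2_compact R' p px py pxx pyy"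
  unfolding C2_compact_def by (meson order_trans)

lemma continuous_on_half_plane_product:
  fixes g p :: "complex \<Rightarrow> real"
  assumes "continuous_on upper g" "continuous_on UNIV p" "\<And>z. R \<le> cmod z \<Longrightarrow> p z = 0" "R < 1"
  shows "continuous_on {z. 0 < Im z} (\<lambda>z. g z * p z)"
proof -
  have "continuous_on {z. 0 < Im z \<and> R < cmod z} (\<lambda>z. g z * p z)"
    by (rule continuous_on_eq[OF continuous_on_const[of _ 0]]) (use assms in auto)
  moreover have "continuous_on upper (\<lambda>z. g z * p z)"
    using assms by (intro continuous_on_mult) (auto intro: continuous_on_subset)
  moreover have "open {z. 0 < Im z \<and> R < cmod z}"
    by (intro open_Collect_conj open_Collect_less continuous_intros)
  ultimately have "continuous_on ({z. 0 < Im z \<and> R < cmod z} \<union> upper) (\<lambda>z. g z * p z)"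
    by (intro continuous_on_open_Un open_upper)
  then show ?thesis
    by (rule continuous_on_subset) (use assms in \<open>auto simp: upper_def\<close>)
qed

lemma bounded_on_half_plane:
  fixes g :: "complex \<Rightarrow> real"
  assumes "continuous_on {z. 0 < Im z} g" "\<And>z. R \<le> cmod z \<Longrightarrow> g z = 0" "R < 1" "0 < \<delta>"
  obtains B where "0 \<le> B" "\<And>z. \<delta> \<le> Im z \<Longrightarrow> \<bar>g z\<bar> \<le> B"
proof -
  have "compact (cball 0 1 \<inter> {z. \<delta> \<le> Im z})"
    by (intro compact_Int_closed closed_Collect_le continuous_intros compact_cball)
  then have "compact (g ` (cball 0 1 \<inter> {z. \<delta> \<le> Im z}))"
    by (rule compact_continuous_image[rotated])
      (use assms in \<open>auto intro: continuous_on_subset[OF assms(1)]\<close>)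
  then obtain B where B: "\<And>z. cmod z \<le> 1 \<Longrightarrow> \<delta> \<le> Im z \<Longrightarrow> \<bar>g z\<bar> \<le> B"
    by (force dest!: compact_imp_bounded simp: bounded_iff)
  show thesis
  proof (rule that[of "\<bar>B\<bar>"])
    fix z assume "\<delta> \<le> Im z"
    then show "\<bar>g z\<bar> \<le> \<bar>B\<bar>" using B[of z] assms(2,3) by (cases "cmod z \<le> 1") auto
  qed simp
qed

lemma half_plane_measurable:
  fixes g :: "complex \<Rightarrow> real"
  assumes "continuous_on {z. 0 < Im z} g" "0 < \<delta>"
  shows "(\<lambda>z. indicator {z. \<delta> \<le> Im z} z * g z) \<in> borel_measurable borel"
proof -
  have "(\<lambda>z. indicator {z. \<delta> \<le> Im z} z *\<^sub>R g z) \<in> borel_measurable borel"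
  proof (rule borel_measurable_continuous_on_indicator)
    have "closed {z. \<delta> \<le> Im z}"
      by (intro closed_Collect_le continuous_intros)
    then show "{z. \<delta> \<le> Im z} \<in> sets borel" by (rule borel_closed)
    show "continuous_on {z. \<delta> \<le> Im z} g"
      by (rule continuous_on_subset[OF assms(1)]) (use assms(2) in auto)
  qed
  then show ?thesis by simp
qed

lemma integrable_half_plane:
  fixes g :: "complex \<Rightarrow> real"
  assumes "continuous_on {z. 0 < Im z} g" "\<And>z. R \<le> cmod z \<Longrightarrow> g z = 0" "R < 1" "0 < \<delta>"
  shows "integrable lborel (\<lambda>z. indicator {z. \<delta> \<le> Im z} z * g z)"
proof -
  obtain B where B: "0 \<le> B" "\<And>z. \<delta> \<le> Im z \<Longrightarrow> \<bar>g z\<bar> \<le> B"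
    using bounded_on_half_plane[OF assms] by blast
  show ?thesis
    by (rule integrable_bounded_support[of _ B])
      (use half_plane_measurable[OF assms(1,4)] assms B in \<open>auto simp: indicator_def\<close>)
qed

lemma isCont_along_lines:
  assumes "continuous_on {z. 0 < Im z} g" "0 < y"
  shows "isCont (\<lambda>x. g (Complex x y)) x" "isCont (\<lambda>y. g (Complex x y)) y"
proof -
  have "open {z. 0 < Im z}" by (intro open_Collect_less continuous_intros)
  then have "isCont g (Complex x y)"
    using assms by (simp add: continuous_on_eq_continuous_at)
  moreover have "isCont (\<lambda>x. Complex x y) x" "isCont (\<lambda>y. Complex x y) y"
    unfolding Complex_eq by (intro continuous_intros)+
  ultimately show "isCont (\<lambda>x. g (Complex x y)) x" "isCont (\<lambda>y. g (Complex x y)) y"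
    by (auto intro: isCont_o2)
qed

text \<open>Green's formula for the half plane above height \<open>\<delta>\<close>, one variable at a time. On a line, \<open>w p\<^sub>x\<^sub>x - w\<^sub>x\<^sub>x p\<close> is the
derivative of \<open>w p\<^sub>x - w\<^sub>x p\<close>, which vanishes outside the disc. Horizontal lines therefore contribute nothing,
and vertical lines contribute their lower endpoint.\<close>

lemma green_identity:
  assumes p: "C2_compact R p px py pxx pyy" "R < 1"
    and cont: "continuous_on upper w" "continuous_on upper wxx" "continuous_on upper wyy"
    and dx: "\<And>x y. Complex x y \<in> upper \<Longrightarrow> ((\<lambda>x. w (Complex x y)) has_real_derivative wx (Complex x y)) (at x)"
    and dy: "\<And>x y. Complex x y \<in> upper \<Longrightarrow> ((\<lambda>y. w (Complex x y)) has_real_derivative wy (Complex x y)) (at y)"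
    and dxx: "\<And>x y. Complex x y \<in> upper \<Longrightarrow> ((\<lambda>x. wx (Complex x y)) has_real_derivative wxx (Complex x y)) (at x)"
    and dyy: "\<And>x y. Complex x y \<in> upper \<Longrightarrow> ((\<lambda>y. wy (Complex x y)) has_real_derivative wyy (Complex x y)) (at y)"
    and \<delta>: "0 < \<delta>"
  shows "(\<integral>z. indicator {z. \<delta> \<le> Im z} z * (w z * (pxx z + pyy z)) \<partial>lborel) =
     (\<integral>z. indicator {z. \<delta> \<le> Im z} z * ((wxx z + wyy z) * p z) \<partial>lborel) +
     (\<integral>x. wy (Complex x \<delta>) * p (Complex x \<delta>) - w (Complex x \<delta>) * py (Complex x \<delta>) \<partial>lborel)"
proof -
  note P = C2_compactD[OF p(1)]
  define X where "X z = w z * pxx z - wxx z * p z" for z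
  define Y where "Y z = w z * pyy z - wyy z * p z" for z
  have contX: "continuous_on {z. 0 < Im z} X" and contY: "continuous_on {z. 0 < Im z} Y"
    unfolding X_def[abs_def] Y_def[abs_def] using P p(2) cont
    by (auto intro!: continuous_on_diff continuous_on_half_plane_product[where R = R])
  have X0: "X z = 0" and Y0: "Y z = 0" if "R \<le> cmod z" for z
    using P that by (auto simp: X_def Y_def)
  have intX: "integrable lborel (\<lambda>z. indicator {z. \<delta> \<le> Im z} z * X z)"
    and intY: "integrable lborel (\<lambda>z. indicator {z. \<delta> \<le> Im z} z * Y z)"
    using integrable_half_plane[OF contX X0 p(2) \<delta>] integrable_half_plane[OF contY Y0 p(2) \<delta>] by auto
  have re: "\<bar>x\<bar> \<le> cmod (Complex x y)" "\<bar>y\<bar> \<le> cmod (Complex x y)" for x y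
    using abs_Re_le_cmod[of "Complex x y"] abs_Im_le_cmod[of "Complex x y"] by simp_all
  have cont_line: "continuous_on UNIV (\<lambda>x. Complex x y)" "continuous_on UNIV (\<lambda>y. Complex x y)" for x y
    unfolding Complex_eq by (intro continuous_intros)+
  have outside: "open {x. R < cmod (Complex x y)}" "open {y. R < cmod (Complex x y)}" for x y
    by (intro open_Collect_less continuous_intros cont_line)+
  have DX: "((\<lambda>x. w (Complex x y) * px (Complex x y) - wx (Complex x y) * p (Complex x y))
      has_real_derivative X (Complex x y)) (at x)" if "0 < y" for x y
  proof (cases "cmod (Complex x y) < 1")
    case True
    with that have u: "Complex x y \<in> upper" by (simp add: upper_def)
    show ?thesis
      by (rule DERIV_cong[OF DERIV_diff[OF DERIV_mult[OF dx[OF u] P(13)] DERIV_mult[OF dxx[OF u] P(11)]]])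
        (simp add: X_def algebra_simps)
  next
    case False
    have "((\<lambda>x. 0) has_real_derivative X (Complex x y)) (at x)"
      using False p(2) X0[of "Complex x y"] by simp
    then show ?thesis
      by (rule has_field_derivative_transform_within_open[OF _ outside(1)[of y]]) (use False p(2) P in auto)
  qed
  have DY: "((\<lambda>y. w (Complex x y) * py (Complex x y) - wy (Complex x y) * p (Complex x y))
      has_real_derivative Y (Complex x y)) (at y)" if "0 < y" for x y
  proof (cases "cmod (Complex x y) < 1")
    case True
    with that have u: "Complex x y \<in> upper" by (simp add: upper_def)
    show ?thesis
      by (rule DERIV_cong[OF DERIV_diff[OF DERIV_mult[OF dy[OF u] P(14)] DERIV_mult[OF dyy[OF u] P(12)]]])
        (simp add: Y_def algebra_simps)
  next
    case False
    have "((\<lambda>y. 0) has_real_derivative Y (Complex x y)) (at y)"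
      using False p(2) Y0[of "Complex x y"] by simp
    then show ?thesis
      by (rule has_field_derivative_transform_within_open[OF _ outside(2)[of x]]) (use False p(2) P in auto)
  qed
  have "(\<integral>x. X (Complex x y) \<partial>lborel) = 0" if y: "0 < y" for y
  proof -
    have ind: "X (Complex x y) * indicator {-1..1} x = X (Complex x y)" for x
    proof (cases "\<bar>x\<bar> \<le> 1")
      case False
      then have "R \<le> cmod (Complex x y)" using re(1)[of x y] p(2) by linarith
      then show ?thesis by (simp add: X0)
    qed (auto simp: abs_le_iff)
    have "(\<integral>x. X (Complex x y) * indicator {-1..1} x \<partial>lborel) =
        (w (Complex 1 y) * px (Complex 1 y) - wx (Complex 1 y) * p (Complex 1 y)) -
        (w (Complex (-1) y) * px (Complex (-1) y) - wx (Complex (-1) y) * p (Complex (-1) y))"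
      by (rule integral_FTC_Icc_real) (use y in \<open>auto intro: DX isCont_along_lines(1)[OF contX]\<close>)
    also have "\<dots> = 0"
      using P re(1)[of 1 y] re(1)[of "-1" y] p(2) by simp
    finally show ?thesis by (simp add: ind)
  qed
  then have "(\<integral>x. indicator {z. \<delta> \<le> Im z} (Complex x y) * X (Complex x y) \<partial>lborel) = 0" for y
    using \<delta> by (auto simp: indicator_def)
  then have sumX: "(\<integral>z. indicator {z. \<delta> \<le> Im z} z * X z \<partial>lborel) = 0"
    using complex_Fubini(2)[OF intX] by simp
  have "(\<integral>y. indicator {z. \<delta> \<le> Im z} (Complex x y) * Y (Complex x y) \<partial>lborel) =
      wy (Complex x \<delta>) * p (Complex x \<delta>) - w (Complex x \<delta>) * py (Complex x \<delta>)" for x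
  proof -
    have ind: "Y (Complex x y) * indicator {\<delta>..1 + \<delta>} y = indicator {z. \<delta> \<le> Im z} (Complex x y) * Y (Complex x y)" for y
      using Y0[of "Complex x y"] re(2)[of y x] p(2) \<delta> by (auto simp: indicator_def)
    have "(\<integral>y. Y (Complex x y) * indicator {\<delta>..1 + \<delta>} y \<partial>lborel) =
        (w (Complex x (1 + \<delta>)) * py (Complex x (1 + \<delta>)) - wy (Complex x (1 + \<delta>)) * p (Complex x (1 + \<delta>))) -
        (w (Complex x \<delta>) * py (Complex x \<delta>) - wy (Complex x \<delta>) * p (Complex x \<delta>))"
      by (rule integral_FTC_Icc_real) (use \<delta> in \<open>auto intro: DY isCont_along_lines(2)[OF contY]\<close>)
    also have "\<dots> = wy (Complex x \<delta>) * p (Complex x \<delta>) - w (Complex x \<delta>) * py (Complex x \<delta>)"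
      using P re(2)[of "1 + \<delta>" x] p(2) \<delta> by simp
    finally show ?thesis by (simp add: ind)
  qed
  then have sumY: "(\<integral>z. indicator {z. \<delta> \<le> Im z} z * Y z \<partial>lborel) =
     (\<integral>x. wy (Complex x \<delta>) * p (Complex x \<delta>) - w (Complex x \<delta>) * py (Complex x \<delta>) \<partial>lborel)"
    using complex_Fubini(1)[OF intY] by simp
  have contL: "continuous_on {z. 0 < Im z} (\<lambda>z. (wxx z + wyy z) * p z)"
    using P p(2) cont by (intro continuous_on_half_plane_product[where R = R] continuous_intros) auto
  have intL: "integrable lborel (\<lambda>z. indicator {z. \<delta> \<le> Im z} z * ((wxx z + wyy z) * p z))"
    by (rule integrable_half_plane[OF contL _ p(2) \<delta>]) (use P in auto)
  have "(\<integral>z. indicator {z. \<delta> \<le> Im z} z * (w z * (pxx z + pyy z)) \<partial>lborel) =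
     (\<integral>z. indicator {z. \<delta> \<le> Im z} z * X z + indicator {z. \<delta> \<le> Im z} z * Y z +
        indicator {z. \<delta> \<le> Im z} z * ((wxx z + wyy z) * p z) \<partial>lborel)"
    by (intro Bochner_Integration.integral_cong) (auto simp: X_def Y_def algebra_simps)
  also have "\<dots> = (\<integral>z. indicator {z. \<delta> \<le> Im z} z * X z \<partial>lborel) + (\<integral>z. indicator {z. \<delta> \<le> Im z} z * Y z \<partial>lborel) +
     (\<integral>z. indicator {z. \<delta> \<le> Im z} z * ((wxx z + wyy z) * p z) \<partial>lborel)"
    using intX intY intL by simp
  finally show ?thesis
    unfolding sumX sumY by simp
qed

section \<open>Convex truncation at a level\<close>

text \<open>A primitive of the smooth step; its rescalings are smooth convex functions that approach the positive part.\<close>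

lemma smooth_ramp_exists:
  obtains ramp \<kappa> :: "real \<Rightarrow> real" where
    "\<And>t. (ramp has_real_derivative smooth_step t) (at t)"
    "\<And>t. (smooth_step has_real_derivative \<kappa> t) (at t)"
    "\<And>t. isCont \<kappa> t" "\<And>t. 0 \<le> \<kappa> t" "\<And>t. t \<le> 0 \<or> 1 \<le> t \<Longrightarrow> \<kappa> t = 0"
    "\<And>t. \<bar>ramp t\<bar> \<le> \<bar>t\<bar>" "\<And>s. (\<lambda>n. ramp (real (Suc n) * s) / real (Suc n)) \<longlonglongrightarrow> max s 0"
proof -
  obtain c where c: "0 < c" "\<And>t. (smooth_step has_real_derivative c * (flat 0 t * flat 0 (1 - t))) (at t)"
    using smooth_step_props(1) by blast
  define \<kappa> where "\<kappa> t = c * (flat 0 t * flat 0 (1 - t))" for t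
  have \<kappa>: "isCont \<kappa> t" "0 \<le> \<kappa> t" "t \<le> 0 \<or> 1 \<le> t \<Longrightarrow> \<kappa> t = 0" for t
    unfolding \<kappa>_def[abs_def] using c(1)
    by (auto intro!: continuous_intros continuous_flat isCont_o2[OF _ continuous_flat] mult_nonneg_nonneg flat_nonneg)
      (auto simp: flat_def)
  have S: "(smooth_step has_real_derivative \<kappa> t) (at t)" for t
    using c(2) by (simp add: \<kappa>_def)
  obtain ramp where r0: "ramp 0 = 0" and r: "\<And>t. (ramp has_real_derivative smooth_step t) (at t)"
    using antiderivative_exists[of smooth_step] S DERIV_isCont by blast
  have "\<bar>ramp t\<bar> \<le> \<bar>t\<bar>" for t
    using field_differentiable_bound[of UNIV ramp smooth_step 1 t 0] smooth_step_bounds r r0 by (simp add: has_field_derivative_at_within)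
  moreover have "(\<lambda>n. ramp (real (Suc n) * s) / real (Suc n)) \<longlonglongrightarrow> max s 0" for s
  proof (cases "s \<le> 0")
    case True
    have "ramp t = 0" if t: "t \<le> 0" for t
    proof (cases "t = 0")
      case False
      have "(ramp has_real_derivative 0) (at x)" if "x < 0" for x
        using r[of x] smooth_step_props(2)[of x] that by simp
      with t False have "ramp 0 = ramp t"
        by (intro DERIV_isconst_end) (auto intro!: continuous_at_imp_continuous_on DERIV_isCont[OF r])
      then show ?thesis using r0 by simp
    qed (simp add: r0)
    moreover have "real (Suc n) * s \<le> 0" for n
      using True by (intro mult_nonneg_nonpos) auto
    ultimately show ?thesis using True by simp
  next
    case False
    have lin: "ramp t = t - 1 + ramp 1" if t: "1 < t" for t
    proof -
      have D: "((\<lambda>t. ramp t - t) has_real_derivative smooth_step x - 1) (at x)" for x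
        by (auto intro!: derivative_eq_intros r)
      have "((\<lambda>t. ramp t - t) has_real_derivative 0) (at x)" if "1 < x" for x
        using D[of x] smooth_step_props(3)[of x] that by simp
      then have "ramp t - t = ramp 1 - 1"
        using t by (intro DERIV_isconst_end[of 1 t "\<lambda>t. ramp t - t"])
          (auto intro!: continuous_at_imp_continuous_on DERIV_isCont[OF D])
      then show ?thesis by simp
    qed
    have "(\<lambda>n. (real (Suc n) * s - 1 + ramp 1) / real (Suc n)) \<longlonglongrightarrow> s"
      by real_asymp
    moreover have "\<forall>\<^sub>F n in sequentially. 1 < real (Suc n) * s"
      using False by real_asymp
    then have "\<forall>\<^sub>F n in sequentially. (real (Suc n) * s - 1 + ramp 1) / real (Suc n) = ramp (real (Suc n) * s) / real (Suc n)"
      by eventually_elim (simp only: lin)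
    ultimately have "(\<lambda>n. ramp (real (Suc n) * s) / real (Suc n)) \<longlonglongrightarrow> s"
      by (rule Lim_transform_eventually)
    then show ?thesis using False by simp
  qed
  ultimately show thesis
    using that[OF r S \<kappa>] by blast
qed

lemma step_limit:
  "(\<lambda>n. smooth_step (real (Suc n) * s)) \<longlonglongrightarrow> indicator {0<..} s"
proof (cases "s \<le> 0")
  case True
  then have "real (Suc n) * s \<le> 0" for n
    by (intro mult_nonneg_nonpos) auto
  then show ?thesis using True by (simp add: smooth_step_props(2))
next
  case False
  then have "\<forall>\<^sub>F n in sequentially. 1 \<le> real (Suc n) * s"
    by real_asymp
  then have "\<forall>\<^sub>F n in sequentially. 1 = smooth_step (real (Suc n) * s)"
    by eventually_elim (simp add: smooth_step_props(3))
  then have "(\<lambda>n. smooth_step (real (Suc n) * s)) \<longlonglongrightarrow> 1"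
    by (rule Lim_transform_eventually[OF tendsto_const])
  then show ?thesis using False by simp
qed

text \<open>The masses \<open>n \<kappa> (n (U - r)) U'\<close> are derivatives of \<open>smooth_step (n (U - r))\<close>. So they have total mass at most
\<open>1\<close>, and they concentrate just above the point \<open>c\<close> at which the increasing function \<open>U\<close> takes the value \<open>r\<close>.
That point may be the lower endpoint \<open>a\<close>, because the kernel \<open>\<kappa>\<close> lives on the positive side.\<close>

lemma concentrating_kernel:
  fixes U U' G \<kappa> :: "real \<Rightarrow> real"
  assumes \<kappa>: "\<And>t. (smooth_step has_real_derivative \<kappa> t) (at t)" "\<And>t. isCont \<kappa> t" "\<And>t. 0 \<le> \<kappa> t"
      "\<And>t. t \<le> 0 \<or> 1 \<le> t \<Longrightarrow> \<kappa> t = 0"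
    and ab: "a \<le> b"
    and U: "\<And>y. a \<le> y \<Longrightarrow> y \<le> b \<Longrightarrow> (U has_real_derivative U' y) (at y)"
      "\<And>y. a \<le> y \<Longrightarrow> y \<le> b \<Longrightarrow> 0 < U' y" "\<And>y. a \<le> y \<Longrightarrow> y \<le> b \<Longrightarrow> isCont U' y"
    and G: "\<And>y. a \<le> y \<Longrightarrow> y \<le> b \<Longrightarrow> isCont G y"
  shows "\<And>n B. (\<And>y. a \<le> y \<Longrightarrow> y \<le> b \<Longrightarrow> \<bar>G y\<bar> \<le> B) \<Longrightarrow>
      \<bar>\<integral>y. real (Suc n) * \<kappa> (real (Suc n) * (U y - r)) * U' y * G y * indicator {a..b} y \<partial>lborel\<bar> \<le> B"
    and "r < U a \<Longrightarrow>
      (\<lambda>n. \<integral>y. real (Suc n) * \<kappa> (real (Suc n) * (U y - r)) * U' y * G y * indicator {a..b} y \<partial>lborel) \<longlonglongrightarrow> 0"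
    and "a \<le> c \<Longrightarrow> c < b \<Longrightarrow> U c = r \<Longrightarrow>
      (\<lambda>n. \<integral>y. real (Suc n) * \<kappa> (real (Suc n) * (U y - r)) * U' y * G y * indicator {a..b} y \<partial>lborel) \<longlonglongrightarrow> G c"
proof -
  define k where "k n y = real (Suc n) * \<kappa> (real (Suc n) * (U y - r)) * U' y" for n y
  have contU: "isCont U y" if "a \<le> y" "y \<le> b" for y
    using U(1)[OF that] by (rule DERIV_isCont)
  have k_nonneg: "0 \<le> k n y" if "a \<le> y" "y \<le> b" for n y
    unfolding k_def using \<kappa>(3) U(2)[OF that] by (intro mult_nonneg_nonneg) auto
  have k_cont: "isCont (k n) y" if "a \<le> y" "y \<le> b" for n y
    unfolding k_def[abs_def] using that by (intro continuous_intros isCont_o2[OF _ \<kappa>(2)] contU U(3))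
  have k_deriv: "((\<lambda>y. smooth_step (real (Suc n) * (U y - r))) has_real_derivative k n y) (at y)"
    if "a \<le> y" "y \<le> b" for n y
  proof -
    have "((\<lambda>y. real (Suc n) * (U y - r)) has_real_derivative real (Suc n) * U' y) (at y)"
      using U(1)[OF that] by (auto intro!: derivative_eq_intros)
    from DERIV_chain2[OF \<kappa>(1) this] show ?thesis by (simp add: k_def mult_ac)
  qed
  have k_total: "(\<integral>y. k n y * indicator {a..b} y \<partial>lborel) =
      smooth_step (real (Suc n) * (U b - r)) - smooth_step (real (Suc n) * (U a - r))" for n
    by (rule integral_FTC_Icc_real[OF ab]) (rule k_deriv k_cont; assumption)+
  have int: "integrable lborel (\<lambda>y. H y * indicator {a..b} y)"
    if "\<And>y. a \<le> y \<Longrightarrow> y \<le> b \<Longrightarrow> isCont H y" for H :: "real \<Rightarrow> real"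
  proof -
    have "integrable lborel (\<lambda>y. indicator {a..b} y *\<^sub>R H y)"
      using that by (intro borel_integrable_compact continuous_at_imp_continuous_on) auto
    then show ?thesis by (simp add: mult.commute)
  qed
  have total_le: "(\<integral>y. k n y * indicator {a..b} y \<partial>lborel) \<le> 1" for n
    unfolding k_total using smooth_step_bounds[of "real (Suc n) * (U b - r)"] smooth_step_bounds[of "real (Suc n) * (U a - r)"] by linarith
  have bound: "\<bar>\<integral>y. k n y * H y * indicator {a..b} y \<partial>lborel\<bar> \<le> e"
    if H: "\<And>y. a \<le> y \<Longrightarrow> y \<le> b \<Longrightarrow> isCont H y"
      "\<And>y. a \<le> y \<Longrightarrow> y \<le> b \<Longrightarrow> k n y \<noteq> 0 \<Longrightarrow> \<bar>H y\<bar> \<le> e" and e: "0 \<le> e" for n H e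
  proof -
    have "\<bar>\<integral>y. k n y * H y * indicator {a..b} y \<partial>lborel\<bar> \<le> (\<integral>y. \<bar>k n y * H y * indicator {a..b} y\<bar> \<partial>lborel)"
      by (rule integral_abs_bound)
    also have "\<dots> \<le> (\<integral>y. e * (k n y * indicator {a..b} y) \<partial>lborel)"
    proof (intro integral_mono integrable_abs int integrable_mult_right)
      fix y
      show "\<bar>k n y * H y * indicator {a..b} y\<bar> \<le> e * (k n y * indicator {a..b} y)"
      proof (cases "a \<le> y \<and> y \<le> b \<and> k n y \<noteq> 0")
        case True
        then show ?thesis
          using H(2)[of y] k_nonneg[of y n] by (simp add: abs_mult mult.commute mult_left_mono)
      qed auto
    qed (auto intro!: continuous_intros H k_cont)
    also have "\<dots> = e * (\<integral>y. k n y * indicator {a..b} y \<partial>lborel)" by simp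
    also have "\<dots> \<le> e * 1" using e total_le by (intro mult_left_mono) auto
    finally show ?thesis by simp
  qed
  show "\<bar>\<integral>y. real (Suc n) * \<kappa> (real (Suc n) * (U y - r)) * U' y * G y * indicator {a..b} y \<partial>lborel\<bar> \<le> B"
    if "\<And>y. a \<le> y \<Longrightarrow> y \<le> b \<Longrightarrow> \<bar>G y\<bar> \<le> B" for n B
    using bound[of G n B] G that that[of a] ab by (fold k_def) force
  have mono: "U s \<le> U t" if "a \<le> s" "s \<le> t" "t \<le> b" for s t
    using DERIV_nonneg_imp_nondecreasing[of s t U] U that by (meson less_imp_le order_trans)
  show "(\<lambda>n. \<integral>y. real (Suc n) * \<kappa> (real (Suc n) * (U y - r)) * U' y * G y * indicator {a..b} y \<partial>lborel) \<longlonglongrightarrow> 0"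
    if "r < U a"
  proof -
    have "\<forall>\<^sub>F n in sequentially. 1 \<le> real (Suc n) * (U a - r)"
      using that by real_asymp
    then have "\<forall>\<^sub>F n in sequentially. 0 = (\<integral>y. k n y * G y * indicator {a..b} y \<partial>lborel)"
    proof eventually_elim
      case (elim n)
      have "k n y * G y * indicator {a..b} y = 0" for y
      proof (cases "a \<le> y \<and> y \<le> b")
        case True
        then have "real (Suc n) * (U a - r) \<le> real (Suc n) * (U y - r)"
          using mono[of a y] by (intro mult_left_mono) auto
        with elim have "1 \<le> real (Suc n) * (U y - r)" by linarith
        then show ?thesis using \<kappa>(4) by (simp add: k_def)
      qed auto
      then have "(\<lambda>y. k n y * G y * indicator {a..b} y) = (\<lambda>_. 0)" by (rule ext)
      then show ?case by (simp only: integral_zero)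
    qed
    then show ?thesis
      unfolding k_def by (rule Lim_transform_eventually[OF tendsto_const])
  qed
  show "(\<lambda>n. \<integral>y. real (Suc n) * \<kappa> (real (Suc n) * (U y - r)) * U' y * G y * indicator {a..b} y \<partial>lborel) \<longlonglongrightarrow> G c"
    if c: "a \<le> c" "c < b" "U c = r"
  proof -
    have "(\<lambda>n. \<integral>y. k n y * G y * indicator {a..b} y \<partial>lborel) \<longlonglongrightarrow> G c"
    proof (rule LIMSEQ_I)
      fix e :: real assume e: "0 < e"
      have "isCont G c" using G c by simp
      then obtain d where d: "0 < d" "\<And>y. \<bar>y - c\<bar> < d \<Longrightarrow> \<bar>G y - G c\<bar> < e / 2"
        using half_gt_zero[OF e] unfolding continuous_at_eps_delta dist_real_def by blast
      \<comment> \<open>Beyond \<open>v\<close> the function \<open>U\<close> exceeds \<open>r\<close> by a fixed amount, so that the mass lies in \<open>[c, v]\<close> for large \<open>n\<close>.\<close>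
      define v where "v = min b (c + d / 2)"
      have v: "c < v" "v \<le> b" "v < c + d" using d c by (auto simp: v_def)
      have "U c < U v"
        proof (rule DERIV_pos_imp_increasing[OF v(1)])
        fix y assume "c \<le> y" "y \<le> v"
        then have "a \<le> y" "y \<le> b" using c v by auto
        then show "\<exists>d. (U has_real_derivative d) (at y) \<and> 0 < d" using U by blast
      qed
      then have "0 < U v - r" using c by simp
      then have "\<forall>\<^sub>F n in sequentially. 1 \<le> real (Suc n) * (U v - r)"
        by real_asymp
      then obtain N where N: "\<And>n. N \<le> n \<Longrightarrow> 1 \<le> real (Suc n) * (U v - r)"
        unfolding eventually_sequentially by blast
      show "\<exists>no. \<forall>n\<ge>no. norm ((\<integral>y. k n y * G y * indicator {a..b} y \<partial>lborel) - G c) < e"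
      proof (intro exI allI impI)
        fix n assume n: "N \<le> n"
        have "U v \<le> U b" using v c by (intro mono) auto
        then have "real (Suc n) * (U v - r) \<le> real (Suc n) * (U b - r)" by (intro mult_left_mono) auto
        then have "smooth_step (real (Suc n) * (U b - r)) = 1" using N[OF n] by (intro smooth_step_props) linarith
        moreover have "smooth_step (real (Suc n) * (U a - r)) = 0"
          using mono[of a c] c by (intro smooth_step_props mult_nonneg_nonpos) auto
        ultimately have one: "(\<integral>y. k n y * indicator {a..b} y \<partial>lborel) = 1"
          unfolding k_total by simp
        have "(\<integral>y. k n y * (G y - G c) * indicator {a..b} y \<partial>lborel) =
            (\<integral>y. k n y * G y * indicator {a..b} y - G c * (k n y * indicator {a..b} y) \<partial>lborel)"
          by (intro Bochner_Integration.integral_cong) (auto simp: algebra_simps)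
        also have "\<dots> = (\<integral>y. k n y * G y * indicator {a..b} y \<partial>lborel) - G c"
          using int[of "\<lambda>y. k n y * G y"] int[of "k n"] k_cont G by (simp add: one)
        finally have eq: "(\<integral>y. k n y * G y * indicator {a..b} y \<partial>lborel) - G c =
          (\<integral>y. k n y * (G y - G c) * indicator {a..b} y \<partial>lborel)" by simp
        have "\<bar>\<integral>y. k n y * (G y - G c) * indicator {a..b} y \<partial>lborel\<bar> \<le> e / 2"
        proof (rule bound)
          fix y assume y: "a \<le> y" "y \<le> b" "k n y \<noteq> 0"
          have ne: "\<not> (real (Suc n) * (U y - r) \<le> 0 \<or> 1 \<le> real (Suc n) * (U y - r))"
            using y \<kappa>(4) by (auto simp: k_def)
          have "c < y"
          proof (rule ccontr)
            assume "\<not> c < y"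
            then have "real (Suc n) * (U y - r) \<le> 0"
              using mono[of y c] c y by (intro mult_nonneg_nonpos) auto
            with ne show False by simp
          qed
          moreover have "y < v"
          proof (rule ccontr)
            assume "\<not> y < v"
            then have "real (Suc n) * (U v - r) \<le> real (Suc n) * (U y - r)"
              using mono[of v y] c v y by (intro mult_left_mono) auto
            with ne N[OF n] show False by linarith
          qed
          ultimately show "\<bar>G y - G c\<bar> \<le> e / 2" using d(2)[of y] v by auto
        qed (use e G in \<open>auto intro!: continuous_intros\<close>)
        then show "norm ((\<integral>y. k n y * G y * indicator {a..b} y \<partial>lborel) - G c) < e"
          unfolding eq using e by simp
      qed
    qed
    then show ?thesis by (simp add: k_def)
  qed
qed

lemma isCont_upper_line:
  fixes g :: "complex \<Rightarrow> real"
  assumes "continuous_on upper g" "Complex x y \<in> upper"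
  shows "isCont (\<lambda>y. g (Complex x y)) y"
proof -
  have "isCont g (Complex x y)"
    using assms open_upper by (simp add: continuous_on_eq_continuous_at)
  moreover have "isCont (\<lambda>y. Complex x y) y"
    unfolding Complex_eq by (intro continuous_intros)
  ultimately show ?thesis by (auto intro: isCont_o2)
qed

lemma complex_inner_integral_measurable:
  fixes g :: "complex \<Rightarrow> real"
  assumes [measurable]: "g \<in> borel_measurable borel"
  shows "(\<lambda>x. \<integral>y. g (Complex x y) \<partial>lborel) \<in> borel_measurable borel"
proof -
  have "(\<lambda>(x, y). g (Complex x y)) \<in> borel_measurable (borel \<Otimes>\<^sub>M lborel)"
    by measurable
  from sigma_finite_measure.borel_measurable_lebesgue_integral[OF _ this]
  show ?thesis by (simp add: lborel.sigma_finite_measure_axioms)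
qed

lemma compact_support_bounded_integrable:
  fixes g :: "complex \<Rightarrow> real"
  assumes "continuous_on UNIV g" "\<And>z. R \<le> cmod z \<Longrightarrow> g z = 0" "R < 1"
  shows "integrable lborel g" "\<exists>B\<ge>0. \<forall>z. \<bar>g z\<bar> \<le> B"
proof -
  have "compact (g ` cball 0 1)"
    using assms(1) by (intro compact_continuous_image compact_cball) (auto intro: continuous_on_subset)
  then obtain B where B: "\<And>z. cmod z \<le> 1 \<Longrightarrow> \<bar>g z\<bar> \<le> B"
    by (force dest!: compact_imp_bounded simp: bounded_iff)
  have B': "\<bar>g z\<bar> \<le> \<bar>B\<bar>" for z
    using B[of z] assms(2)[of z] assms(3) by (cases "cmod z \<le> 1") auto
  then show "\<exists>B\<ge>0. \<forall>z. \<bar>g z\<bar> \<le> B" by (intro exI[of _ "\<bar>B\<bar>"]) auto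
  show "integrable lborel g"
    by (rule integrable_bounded_support[OF _ B'])
      (use assms in \<open>auto intro: borel_measurable_continuous_onI\<close>)
qed

lemma abs_le_cmod_Complex: "\<bar>x\<bar> \<le> cmod (Complex x y)" "\<bar>y\<bar> \<le> cmod (Complex x y)"
  using abs_Re_le_cmod[of "Complex x y"] abs_Im_le_cmod[of "Complex x y"] by simp_all

context segment_potential
begin

section \<open>The level sets as graphs\<close>

lemma pot_le_const: "cmod z < 1 \<Longrightarrow> \<bar>pot z\<bar> \<le> pot_const"
proof -
  assume z: "cmod z < 1"
  have "pot_const * (1 - (cmod z)\<^sup>2) powr q \<le> pot_const * 1"
    using z gamma_q pot_const_nonneg by (intro mult_left_mono powr_le1) (auto simp: power_le_one)
  then show ?thesis using pot_bound[OF z] by linarith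
qed

lemma sublevel_radius:
  assumes r: "r < 0"
  obtains R where "0 < R" "R < 1" "\<And>z. cmod z < 1 \<Longrightarrow> pot z \<le> r \<Longrightarrow> cmod z < R"
proof -
  define a where "a = \<bar>r\<bar> / (pot_const + 1)"
  define e where "e = a powr (1 / q)"
  \<comment> \<open>By the bound for the potential, \<open>1 - \<bar>z\<bar>\<^sup>2 \<ge> e\<close> on the sublevel set.\<close>
  define R1 where "R1 = sqrt (max 0 (1 - e))"
  have a: "0 < a" using r pot_const_nonneg unfolding a_def by (intro divide_pos_pos) auto
  have "0 < e" using a by (simp add: e_def)
  then have R1: "0 \<le> R1" "R1 < 1" by (auto simp: R1_def)
  have "cmod z \<le> R1" if z: "cmod z < 1" "pot z \<le> r" for z
  proof -
    have "\<bar>r\<bar> \<le> pot_const * (1 - (cmod z)\<^sup>2) powr q"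
      using pot_bound[OF z(1)] z(2) r by linarith
    also have "\<dots> \<le> (pot_const + 1) * (1 - (cmod z)\<^sup>2) powr q"
      by (intro mult_right_mono) auto
    finally have "a \<le> (1 - (cmod z)\<^sup>2) powr q"
      using pot_const_nonneg by (simp add: a_def divide_le_eq mult.commute)
    then have "e \<le> ((1 - (cmod z)\<^sup>2) powr q) powr (1 / q)"
      unfolding e_def using a gamma_q by (intro powr_mono2) auto
    also have "\<dots> = 1 - (cmod z)\<^sup>2"
      using gamma_q z by (simp add: powr_powr power_le_one)
    finally have "(cmod z)\<^sup>2 \<le> max 0 (1 - e)" by simp
    then show ?thesis unfolding R1_def by (rule real_le_rsqrt)
  qed
  then show thesis
    using R1 by (intro that[of "(1 + R1) / 2"]) force+
qed

text \<open>The height of the level set above the point \<open>x\<close> of the axis. The value \<open>0\<close> marks the points where \<open>x\<close> lies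
outside the sublevel set.\<close>

definition height :: "real \<Rightarrow> real \<Rightarrow> real" where
  "height r x = (if \<bar>x\<bar> < 1 \<and> pot (Complex x 0) < r
     then (SOME h. 0 < h \<and> cmod (Complex x h) < 1 \<and> pot (Complex x h) = r) else 0)"

text \<open>By the intermediate value theorem: near the axis the potential is below \<open>r\<close>, and on the circle of radius \<open>R\<close>
it is above.\<close>

lemma height_props:
  assumes r: "r < 0" and x: "\<bar>x\<bar> < 1" "pot (Complex x 0) < r"
  shows "0 < height r x" "cmod (Complex x (height r x)) < 1" "pot (Complex x (height r x)) = r"
proof -
  obtain R where R: "0 < R" "R < 1" "\<And>z. cmod z < 1 \<Longrightarrow> pot z \<le> r \<Longrightarrow> cmod z < R"
    using sublevel_radius[OF r] by blast
  have "cmod (Complex x 0) = \<bar>x\<bar>" by (simp add: cmod_def)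
  then have xR: "\<bar>x\<bar> < R" using R(3)[of "Complex x 0"] x by simp
  \<comment> \<open>At the height \<open>b\<close> the vertical line leaves the disc of radius \<open>R\<close>; there the potential exceeds \<open>r\<close>.\<close>
  define b where "b = sqrt (R\<^sup>2 - x\<^sup>2)"
  have "x\<^sup>2 < R\<^sup>2" using xR R abs_le_square_iff[of R x] by auto
  then have b: "0 < b" "b\<^sup>2 = R\<^sup>2 - x\<^sup>2" by (auto simp: b_def)
  then have cb: "cmod (Complex x b) = R" using R by (simp add: cmod_def)
  then have pb: "r < pot (Complex x b)" using R(2) R(3)[of "Complex x b"] by force
  have disc: "cmod (Complex x y) < 1" if "0 \<le> y" "y \<le> b" for y
    using disc_vertical[of x b y] that cb R by auto
  define Y where "Y n = b / real (Suc n)" for n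
  have Y: "0 < Y n" "Y n \<le> b" for n using b by (auto simp: Y_def field_simps)
  have Y0: "Y \<longlonglongrightarrow> 0" unfolding Y_def by real_asymp
  have "(\<lambda>n. pot (Complex x (Y n))) \<longlonglongrightarrow> pot (Complex x 0)"
    by (rule pot_vertical_limit[OF x(1) Y0]) (use disc Y less_imp_le in blast)
  then have "\<forall>\<^sub>F n in sequentially. pot (Complex x (Y n)) < r"
    using x(2) by (rule order_tendstoD)
  then obtain n where n: "pot (Complex x (Y n)) < r"
    using eventually_happens[of _ sequentially] by auto
  have up: "Complex x y \<in> upper" if "Y n \<le> y" "y \<le> b" for y
    using disc[of y] Y(1)[of n] that by (auto simp: upper_def)
  have "continuous_on {Y n..b} (\<lambda>y. pot (Complex x y))"
    using up by (intro continuous_at_imp_continuous_on ballI isCont_upper_line continuous_on_pot) auto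
  then obtain h where h: "Y n \<le> h" "h \<le> b" "pot (Complex x h) = r"
    using IVT'[of "\<lambda>y. pot (Complex x y)" "Y n" r b] n pb Y by auto
  then have "0 < h \<and> cmod (Complex x h) < 1 \<and> pot (Complex x h) = r"
    using up[of h] by (auto simp: upper_def)
  from someI[of "\<lambda>h. 0 < h \<and> cmod (Complex x h) < 1 \<and> pot (Complex x h) = r", OF this] x
  show "0 < height r x" "cmod (Complex x (height r x)) < 1" "pot (Complex x (height r x)) = r"
    by (auto simp: height_def)
qed

lemma height_nonneg: "r < 0 \<Longrightarrow> 0 \<le> height r x"
  using height_props(1)[of r x] by (cases "\<bar>x\<bar> < 1 \<and> pot (Complex x 0) < r") (auto simp: height_def)

lemma height_posD:
  assumes "r < 0" "0 < height r x"
  shows "\<bar>x\<bar> < 1" "pot (Complex x 0) < r" "Complex x (height r x) \<in> upper" "pot (Complex x (height r x)) = r"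
proof -
  show a: "\<bar>x\<bar> < 1" "pot (Complex x 0) < r"
    using assms(2) by (auto simp: height_def split: if_splits)
  show "Complex x (height r x) \<in> upper" "pot (Complex x (height r x)) = r"
    using height_props[OF assms(1) a] by (auto simp: upper_def)
qed

lemma height_ge_iff:
  assumes r: "r < 0" and \<delta>: "0 < \<delta>"
  shows "\<delta> \<le> height r x \<longleftrightarrow> cmod (Complex x \<delta>) < 1 \<and> pot (Complex x \<delta>) \<le> r"
proof
  assume h: "\<delta> \<le> height r x"
  then have "0 < height r x" using \<delta> by simp
  note H = height_posD[OF r this]
  have d: "cmod (Complex x \<delta>) < 1"
    using disc_vertical[of x "height r x" \<delta>] H h \<delta> by (auto simp: upper_def)
  moreover have "pot (Complex x \<delta>) \<le> r"
    using pot_vertical_strict_mono[of x "height r x" \<delta>] H h \<delta>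
    by (cases "\<delta> = height r x") (auto simp: upper_def)
  ultimately show "cmod (Complex x \<delta>) < 1 \<and> pot (Complex x \<delta>) \<le> r" by simp
next
  assume d: "cmod (Complex x \<delta>) < 1 \<and> pot (Complex x \<delta>) \<le> r"
  then have "\<bar>x\<bar> < 1" using abs_le_cmod_Complex[of x \<delta>] by auto
  moreover have "pot (Complex x 0) < r"
    using pot_vertical_strict_mono[of x \<delta> 0] d \<delta> by auto
  ultimately have H: "0 < height r x" "cmod (Complex x (height r x)) < 1" "pot (Complex x (height r x)) = r"
    using height_props[OF r] by auto
  show "\<delta> \<le> height r x"
  proof (rule ccontr)
    assume "\<not> \<delta> \<le> height r x"
    then show False
      using pot_vertical_strict_mono[of x \<delta> "height r x"] d H by auto
  qed
qed

lemma height_measurable [measurable]: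
  assumes r: "r < 0"
  shows "height r \<in> borel_measurable borel"
proof (subst borel_measurable_iff_ge, intro allI)
  fix a :: real
  show "{x \<in> space borel. a \<le> height r x} \<in> sets borel"
  proof (cases "a \<le> 0")
    case True
    then have "{x \<in> space borel. a \<le> height r x} = UNIV"
      using height_nonneg[OF r] order_trans by auto
    then show ?thesis by simp
  next
    case False
    then have "{x \<in> space borel. a \<le> height r x} =
        {x \<in> space borel. cmod (Complex x a) < 1 \<and> pot (Complex x a) \<le> r}"
      using height_ge_iff[OF r] by auto
    also have "\<dots> \<in> sets borel" by measurable
    finally show ?thesis .
  qed
qed

lemma dpot_borel [measurable]: "dpot \<in> borel_measurable borel"
proof -
  have "(\<lambda>(z, s). (1 / (z - of_real s) + of_real s / (1 - of_real s * z)) * complex_of_real (dens s))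
      \<in> borel_measurable (borel \<Otimes>\<^sub>M lborel)"
    by measurable
  from sigma_finite_measure.borel_measurable_lebesgue_integral[OF _ this]
  show ?thesis
    unfolding dpot_def[abs_def] by (simp add: lborel.sigma_finite_measure_axioms)
qed

text \<open>The arc length density \<open>\<bar>\<nabla>u\<bar>\<close> of the flux through a level curve, in terms of the abscissa: a level curve has
the line element \<open>(\<bar>\<nabla>u\<bar> / \<partial>\<^sub>yu) dx\<close>.\<close>

definition flux_density :: "complex \<Rightarrow> real" where
  "flux_density z = (cmod (dpot z))\<^sup>2 / - Im (dpot z)"

definition level_weight :: "real \<Rightarrow> real \<Rightarrow> real" where
  "level_weight r x = (if 0 < height r x then flux_density (Complex x (height r x)) else 0)"

lemma flux_density_measurable [measurable]: "flux_density \<in> borel_measurable borel"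
  unfolding flux_density_def[abs_def] by measurable

lemma level_weight_measurable [measurable]:
  assumes [measurable]: "r < 0"
  shows "level_weight r \<in> borel_measurable borel"
  unfolding level_weight_def[abs_def] using height_measurable[OF assms] by measurable

lemma level_weight_nonneg: "r < 0 \<Longrightarrow> 0 \<le> level_weight r x"
  using vertical_derivative_pos[of "Complex x (height r x)"] height_posD(3)[of r x]
  by (auto simp: level_weight_def flux_density_def intro!: divide_nonneg_neg)

lemma continuous_on_dpot: "continuous_on upper dpot" "continuous_on upper (deriv dpot)"
  using dpot_holomorphic holomorphic_deriv[OF dpot_holomorphic open_upper]
  by (auto intro: holomorphic_on_imp_continuous_on)

lemma continuous_on_flux_density: "continuous_on upper flux_density"
proof -
  have "- Im (dpot z) \<noteq> 0" if "z \<in> upper" for z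
    using vertical_derivative_pos[OF that] by simp
  then show ?thesis
    unfolding flux_density_def[abs_def] using continuous_on_dpot
    by (auto intro!: continuous_intros)
qed

section \<open>Green's formula for the truncated potential\<close>

text \<open>For a smooth convex function \<open>\<chi>\<close>, the composition with the potential has the Laplacian
\<open>(\<chi>'' \<circ> u) \<bar>\<nabla>u\<bar>\<^sup>2\<close> above the axis. When \<open>\<chi>\<close> approaches \<open>max \<cdot> r\<close>, the factor \<open>\<chi>'' (u) \<partial>\<^sub>yu\<close> concentrates on each
vertical line at the level set, provided that this lies above the height \<open>\<delta>\<close>; what remains is
\<open>\<bar>\<nabla>u\<bar>\<^sup>2 / \<partial>\<^sub>yu\<close> times the test function.\<close>

lemma level_formula:
  assumes r: "r < 0" and \<delta>: "0 < \<delta>"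
    and p: "C2_compact R p px py pxx pyy" "0 < R" "R < 1"
    and big: "\<And>z. cmod z < 1 \<Longrightarrow> pot z \<le> r \<Longrightarrow> cmod z < R"
  shows "(\<integral>z. indicator {z. \<delta> \<le> Im z} z * (max (pot z) r * (pxx z + pyy z)) \<partial>lborel) =
    (\<integral>x. indicator {\<delta>..} (height r x) * level_weight r x * p (Complex x (height r x)) \<partial>lborel) +
    (\<integral>x. indicator {r<..} (pot (Complex x \<delta>)) * (- Im (dpot (Complex x \<delta>)) * p (Complex x \<delta>)) -
       max (pot (Complex x \<delta>)) r * py (Complex x \<delta>) \<partial>lborel)"
proof -
  obtain ramp \<kappa> :: "real \<Rightarrow> real" where
    ramp: "\<And>t. (ramp has_real_derivative smooth_step t) (at t)"
    and step: "\<And>t. (smooth_step has_real_derivative \<kappa> t) (at t)"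
    and \<kappa>: "\<And>t. isCont \<kappa> t" "\<And>t. 0 \<le> \<kappa> t" "\<And>t. t \<le> 0 \<or> 1 \<le> t \<Longrightarrow> \<kappa> t = 0"
    and ramp_le: "\<And>t. \<bar>ramp t\<bar> \<le> \<bar>t\<bar>"
    and ramp_lim: "\<And>s. (\<lambda>n. ramp (real (Suc n) * s) / real (Suc n)) \<longlonglongrightarrow> max s 0"
    using smooth_ramp_exists by blast
  note P = C2_compactD[OF p(1)]
  \<comment> \<open>The functions \<open>trunc n\<close> are smooth and convex, and they converge to \<open>max \<cdot> r\<close>.\<close>
  define N where "N n = real (Suc n)" for n
  have N: "0 < N n" for n by (simp add: N_def)
  define trunc where "trunc n t = r + ramp (N n * (t - r)) / N n" for n t
  define trunc' where "trunc' n t = smooth_step (N n * (t - r))" for n t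
  define trunc'' where "trunc'' n t = N n * \<kappa> (N n * (t - r))" for n t
  have Dtrunc: "(trunc n has_real_derivative trunc' n t) (at t)" for n t
  proof -
    have "((\<lambda>t. N n * (t - r)) has_real_derivative N n) (at t)"
      by (auto intro!: derivative_eq_intros)
    from DERIV_add[OF DERIV_const[of r] DERIV_cdivide[OF DERIV_chain2[OF ramp this], of "N n"]]
    show ?thesis using N[of n] by (simp add: trunc_def[abs_def] trunc'_def)
  qed
  have Dtrunc': "(trunc' n has_real_derivative trunc'' n t) (at t)" for n t
  proof -
    have "((\<lambda>t. N n * (t - r)) has_real_derivative N n) (at t)"
      by (auto intro!: derivative_eq_intros)
    from DERIV_chain2[OF step this]
    show ?thesis by (simp add: trunc'_def[abs_def] trunc''_def mult.commute)
  qed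
  have conttrunc: "isCont (trunc n) t" "isCont (trunc' n) t" for n t
    using Dtrunc Dtrunc' DERIV_isCont by blast+
  have conttrunc'': "isCont (trunc'' n) t" for n t
    unfolding trunc''_def[abs_def] by (intro continuous_intros isCont_o2[OF _ \<kappa>(1)])
  have trunc_lim: "(\<lambda>n. trunc n t) \<longlonglongrightarrow> max t r" for t
  proof -
    have "(\<lambda>n. trunc n t) \<longlonglongrightarrow> r + max (t - r) 0"
      unfolding trunc_def N_def by (intro tendsto_intros ramp_lim)
    then show ?thesis by (simp add: max_def split: if_splits)
  qed
  define K where "K = 2 * \<bar>r\<bar> + pot_const"
  have K: "0 \<le> K" using pot_const_nonneg by (simp add: K_def)
  have trunc_bound: "\<bar>trunc n (pot z)\<bar> \<le> K" if "cmod z < 1" for n z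
  proof -
    have "\<bar>ramp (N n * (pot z - r)) / N n\<bar> \<le> \<bar>N n * (pot z - r)\<bar> / N n"
      using ramp_le N[of n] by (simp add: divide_right_mono)
    also have "\<dots> = \<bar>pot z - r\<bar>" using N[of n] by (simp add: abs_mult)
    finally show ?thesis
      unfolding trunc_def K_def using pot_le_const[OF that] by linarith
  qed
  have comp: "continuous_on upper (\<lambda>z. g (pot z))" if "\<And>t. isCont g t" for g :: "real \<Rightarrow> real"
    by (rule continuous_on_compose2[OF _ continuous_on_pot, of UNIV])
      (use that in \<open>auto intro: continuous_at_imp_continuous_on\<close>)
  have [measurable]: "trunc n \<in> borel_measurable borel" "trunc' n \<in> borel_measurable borel" for n
    using conttrunc by (auto intro!: borel_measurable_continuous_onI continuous_at_imp_continuous_on)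
  have [measurable]: "p \<in> borel_measurable borel" "py \<in> borel_measurable borel"
    "pxx \<in> borel_measurable borel" "pyy \<in> borel_measurable borel"
    using P by (auto intro!: borel_measurable_continuous_onI)

  define M where "M n z = trunc'' n (pot z) * (cmod (dpot z))\<^sup>2 * p z" for n z
  define gp where "gp z = flux_density z * p z" for z
  have cont_gp: "continuous_on {z. 0 < Im z} gp"
    unfolding gp_def[abs_def] using P p
    by (intro continuous_on_half_plane_product[where R = R] continuous_on_flux_density) auto
  obtain B where B: "0 \<le> B" "\<And>z. \<delta> \<le> Im z \<Longrightarrow> \<bar>gp z\<bar> \<le> B"
    using bounded_on_half_plane[OF cont_gp _ p(3) \<delta>] P(6) by (auto simp: gp_def)
  have cont_M: "continuous_on {z. 0 < Im z} (M n)" for n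
    unfolding M_def[abs_def] using P p continuous_on_dpot
    by (intro continuous_on_half_plane_product[where R = R] continuous_on_mult comp[OF conttrunc''] continuous_intros) auto
  have M_0: "M n z = 0" if "R \<le> cmod z" for n z using P(6)[OF that] by (simp add: M_def)

  have green: "(\<integral>z. indicator {z. \<delta> \<le> Im z} z * (trunc n (pot z) * (pxx z + pyy z)) \<partial>lborel) =
     (\<integral>z. indicator {z. \<delta> \<le> Im z} z * M n z \<partial>lborel) +
     (\<integral>x. trunc' n (pot (Complex x \<delta>)) * - Im (dpot (Complex x \<delta>)) * p (Complex x \<delta>) -
        trunc n (pot (Complex x \<delta>)) * py (Complex x \<delta>) \<partial>lborel)" for n
  proof -
    let ?wxx = "\<lambda>z. trunc'' n (pot z) * (Re (dpot z))\<^sup>2 + trunc' n (pot z) * Re (deriv dpot z)"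
    let ?wyy = "\<lambda>z. trunc'' n (pot z) * (Im (dpot z))\<^sup>2 - trunc' n (pot z) * Re (deriv dpot z)"
    have "(\<integral>z. indicator {z. \<delta> \<le> Im z} z * (trunc n (pot z) * (pxx z + pyy z)) \<partial>lborel) =
       (\<integral>z. indicator {z. \<delta> \<le> Im z} z * ((?wxx z + ?wyy z) * p z) \<partial>lborel) +
       (\<integral>x. trunc' n (pot (Complex x \<delta>)) * - Im (dpot (Complex x \<delta>)) * p (Complex x \<delta>) -
          trunc n (pot (Complex x \<delta>)) * py (Complex x \<delta>) \<partial>lborel)"
    proof (rule green_identity[OF p(1,3) _ _ _ _ _ _ _ \<delta>, where wx = "\<lambda>z. trunc' n (pot z) * Re (dpot z)"])
      show "continuous_on upper (\<lambda>z. trunc n (pot z))" by (rule comp[OF conttrunc(1)])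
      show "continuous_on upper ?wxx" "continuous_on upper ?wyy"
        using continuous_on_dpot
        by (intro continuous_intros comp[OF conttrunc(2)] comp[OF conttrunc'']; simp)+
      fix x y assume u: "Complex x y \<in> upper"
      note D = pot_derivatives[OF u]
      show "((\<lambda>x. trunc n (pot (Complex x y))) has_real_derivative
          trunc' n (pot (Complex x y)) * Re (dpot (Complex x y))) (at x)"
        by (rule DERIV_chain2[OF Dtrunc D(1)])
      show "((\<lambda>y. trunc n (pot (Complex x y))) has_real_derivative
          trunc' n (pot (Complex x y)) * - Im (dpot (Complex x y))) (at y)"
        by (rule DERIV_chain2[OF Dtrunc D(2)])
      show "((\<lambda>x. trunc' n (pot (Complex x y)) * Re (dpot (Complex x y))) has_real_derivative ?wxx (Complex x y)) (at x)"
        by (rule DERIV_cong[OF DERIV_mult[OF DERIV_chain2[OF Dtrunc' D(1)] D(3)]])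
          (simp add: power2_eq_square algebra_simps)
      show "((\<lambda>y. trunc' n (pot (Complex x y)) * - Im (dpot (Complex x y))) has_real_derivative ?wyy (Complex x y)) (at y)"
        by (rule DERIV_cong[OF DERIV_mult[OF DERIV_chain2[OF Dtrunc' D(2)] D(4)]])
          (simp add: power2_eq_square algebra_simps)
    qed
    moreover have "(?wxx z + ?wyy z) * p z = M n z" for z
      by (simp add: M_def cmod_power2 algebra_simps)
    ultimately show ?thesis by simp
  qed

  have lhs: "(\<lambda>n. \<integral>z. indicator {z. \<delta> \<le> Im z} z * (trunc n (pot z) * (pxx z + pyy z)) \<partial>lborel) \<longlonglongrightarrow>
      (\<integral>z. indicator {z. \<delta> \<le> Im z} z * (max (pot z) r * (pxx z + pyy z)) \<partial>lborel)"
  proof (rule integral_dominated_convergence)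
    have "integrable lborel (\<lambda>z. pxx z + pyy z)"
      by (rule compact_support_bounded_integrable(1)[OF _ _ p(3)]) (use P in \<open>auto intro: continuous_intros\<close>)
    then show "integrable lborel (\<lambda>z. K * \<bar>pxx z + pyy z\<bar>)" by simp
    show "AE z in lborel. (\<lambda>n. indicator {z. \<delta> \<le> Im z} z * (trunc n (pot z) * (pxx z + pyy z))) \<longlonglongrightarrow>
        indicator {z. \<delta> \<le> Im z} z * (max (pot z) r * (pxx z + pyy z))"
      by (intro AE_I2 tendsto_intros trunc_lim)
    show "AE z in lborel. norm (indicator {z. \<delta> \<le> Im z} z * (trunc n (pot z) * (pxx z + pyy z))) \<le> K * \<bar>pxx z + pyy z\<bar>" for n
    proof (rule AE_I2)
      fix z
      show "norm (indicator {z. \<delta> \<le> Im z} z * (trunc n (pot z) * (pxx z + pyy z))) \<le> K * \<bar>pxx z + pyy z\<bar>"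
      proof (cases "cmod z < 1")
        case True
        then show ?thesis
          using trunc_bound[OF True, of n] K by (auto simp: indicator_def abs_mult intro!: mult_right_mono)
      qed (use P p in auto)
    qed
  qed measurable

  have bd: "(\<lambda>n. \<integral>x. trunc' n (pot (Complex x \<delta>)) * - Im (dpot (Complex x \<delta>)) * p (Complex x \<delta>) -
        trunc n (pot (Complex x \<delta>)) * py (Complex x \<delta>) \<partial>lborel) \<longlonglongrightarrow>
      (\<integral>x. indicator {r<..} (pot (Complex x \<delta>)) * (- Im (dpot (Complex x \<delta>)) * p (Complex x \<delta>)) -
       max (pot (Complex x \<delta>)) r * py (Complex x \<delta>) \<partial>lborel)"
  proof -
    have "continuous_on {z. 0 < Im z} (\<lambda>z. - Im (dpot z) * p z)"
      using P p continuous_on_dpot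
      by (intro continuous_on_half_plane_product[where R = R] continuous_intros) auto
    then obtain B1 where B1: "0 \<le> B1" "\<And>z. \<delta> \<le> Im z \<Longrightarrow> \<bar>- Im (dpot z) * p z\<bar> \<le> B1"
      by (rule bounded_on_half_plane[OF _ _ p(3) \<delta>]) (use P in auto)
    obtain B2 where B2: "0 \<le> B2" "\<And>z. \<bar>py z\<bar> \<le> B2"
      using compact_support_bounded_integrable(2)[OF P(3) P(8) p(3)] by blast
    show ?thesis
    proof (rule integral_dominated_convergence)
      show "integrable lborel (\<lambda>x. (B1 + K * B2) * indicator {-1..1::real} x)"
        by (intro integrable_mult_right) simp
      show "AE x in lborel. (\<lambda>n. trunc' n (pot (Complex x \<delta>)) * - Im (dpot (Complex x \<delta>)) * p (Complex x \<delta>) -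
        trunc n (pot (Complex x \<delta>)) * py (Complex x \<delta>)) \<longlonglongrightarrow>
        indicator {r<..} (pot (Complex x \<delta>)) * (- Im (dpot (Complex x \<delta>)) * p (Complex x \<delta>)) -
       max (pot (Complex x \<delta>)) r * py (Complex x \<delta>)"
      proof (rule AE_I2)
        fix x
        have "(\<lambda>n. trunc' n t) \<longlonglongrightarrow> indicator {r<..} t" for t
          using step_limit[of "t - r"] by (simp add: trunc'_def N_def indicator_def)
        then show "(\<lambda>n. trunc' n (pot (Complex x \<delta>)) * - Im (dpot (Complex x \<delta>)) * p (Complex x \<delta>) -
          trunc n (pot (Complex x \<delta>)) * py (Complex x \<delta>)) \<longlonglongrightarrow>
          indicator {r<..} (pot (Complex x \<delta>)) * (- Im (dpot (Complex x \<delta>)) * p (Complex x \<delta>)) -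
         max (pot (Complex x \<delta>)) r * py (Complex x \<delta>)"
          unfolding mult.assoc by (intro tendsto_intros trunc_lim)
      qed
      show "AE x in lborel. norm (trunc' n (pot (Complex x \<delta>)) * - Im (dpot (Complex x \<delta>)) * p (Complex x \<delta>) -
        trunc n (pot (Complex x \<delta>)) * py (Complex x \<delta>)) \<le> (B1 + K * B2) * indicator {-1..1} x" for n
      proof (rule AE_I2)
        fix x
        let ?z = "Complex x \<delta>"
        show "norm (trunc' n (pot ?z) * - Im (dpot ?z) * p ?z - trunc n (pot ?z) * py ?z) \<le> (B1 + K * B2) * indicator {-1..1} x"
        proof (cases "cmod ?z < 1")
          case True
          have "\<bar>trunc' n (pot ?z)\<bar> * \<bar>- Im (dpot ?z) * p ?z\<bar> \<le> 1 * B1"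
            using smooth_step_bounds B1(2)[of ?z] B1(1) by (intro mult_mono) (auto simp: trunc'_def)
          moreover have "\<bar>trunc n (pot ?z)\<bar> * \<bar>py ?z\<bar> \<le> K * B2"
            using trunc_bound[OF True] B2 K by (intro mult_mono) auto
          moreover have "x \<in> {-1..1}" using abs_le_cmod_Complex(1)[of x \<delta>] True by auto
          moreover have "norm (trunc' n (pot ?z) * - Im (dpot ?z) * p ?z - trunc n (pot ?z) * py ?z) \<le>
             \<bar>trunc' n (pot ?z)\<bar> * \<bar>- Im (dpot ?z) * p ?z\<bar> + \<bar>trunc n (pot ?z)\<bar> * \<bar>py ?z\<bar>"
            unfolding abs_mult[symmetric] mult.assoc real_norm_def by (rule abs_triangle_ineq4)
          ultimately show ?thesis by simp
        next
          case False
          then have "R \<le> cmod ?z" using p by simp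
          then show ?thesis using P(6,8)[of ?z] B1 B2 K by simp
        qed
      qed
    qed measurable
  qed

  \<comment> \<open>The limit of the term with the second derivative is taken on each vertical line separately.\<close>
  define f where "f n x = (\<integral>y. indicator {z. \<delta> \<le> Im z} (Complex x y) * M n (Complex x y) \<partial>lborel)" for n x
  define l where "l x = indicator {\<delta>..} (height r x) * level_weight r x * p (Complex x (height r x))" for x
  have f_props: "(\<lambda>n. f n x) \<longlonglongrightarrow> l x \<and> (\<forall>n. \<bar>f n x\<bar> \<le> B * indicator {-1..1} x)" for x
  proof (cases "cmod (Complex x \<delta>) < R")
    case False
    have "indicator {z. \<delta> \<le> Im z} (Complex x y) * M n (Complex x y) = 0" for n y
    proof (cases "\<delta> \<le> y")
      case True
      have "(cmod (Complex x \<delta>))\<^sup>2 \<le> (cmod (Complex x y))\<^sup>2"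
        unfolding cmod_power2 using True \<delta> by (simp add: power_mono)
      then have "cmod (Complex x \<delta>) \<le> cmod (Complex x y)" by (rule power2_le_imp_le) simp
      then show ?thesis using False M_0 by simp
    qed simp
    then have "(\<lambda>y. indicator {z. \<delta> \<le> Im z} (Complex x y) * M n (Complex x y)) = (\<lambda>_. 0)" for n
      by (intro ext)
    then have "f n x = 0" for n unfolding f_def by (simp only: integral_zero)
    moreover have "\<not> \<delta> \<le> height r x"
      using height_ge_iff[OF r \<delta>, of x] big False by auto
    ultimately show ?thesis using B by (simp add: l_def)
  next
    case True
    \<comment> \<open>At the height \<open>b\<close> the vertical line leaves the disc of radius \<open>R\<close>; there \<open>p\<close> vanishes and the
         potential exceeds \<open>r\<close>.\<close>
    define b where "b = sqrt (R\<^sup>2 - x\<^sup>2)"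
    have "(cmod (Complex x \<delta>))\<^sup>2 < R\<^sup>2" using True p by (intro power_strict_mono) auto
    then have x2: "\<delta>\<^sup>2 < R\<^sup>2 - x\<^sup>2" by (simp add: cmod_power2)
    then have "0 < R\<^sup>2 - x\<^sup>2" using \<delta> by (smt (verit) zero_le_power2)
    then have b: "0 < b" "b\<^sup>2 = R\<^sup>2 - x\<^sup>2" by (auto simp: b_def)
    have \<delta>b: "\<delta> < b" unfolding b_def using x2 by (rule real_less_rsqrt)
    have cb: "cmod (Complex x b) = R" using b p by (simp add: cmod_def)
    have up: "Complex x y \<in> upper" if "\<delta> \<le> y" "y \<le> b" for y
      using disc_vertical[of x b y] that \<delta> cb p by (auto simp: upper_def)
    have pb: "r < pot (Complex x b)" using big[of "Complex x b"] cb p by force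
    have x1: "x \<in> {-1..1}" using abs_le_cmod_Complex(1)[of x \<delta>] True p by auto
    let ?U = "\<lambda>y. pot (Complex x y)" and ?U' = "\<lambda>y. - Im (dpot (Complex x y))" and ?G = "\<lambda>y. gp (Complex x y)"
    have f_eq: "f n x = (\<integral>y. real (Suc n) * \<kappa> (real (Suc n) * (?U y - r)) * ?U' y * ?G y * indicator {\<delta>..b} y \<partial>lborel)" for n
      unfolding f_def
    proof (rule Bochner_Integration.integral_cong[OF refl])
      fix y
      show "indicator {z. \<delta> \<le> Im z} (Complex x y) * M n (Complex x y) =
        real (Suc n) * \<kappa> (real (Suc n) * (?U y - r)) * ?U' y * ?G y * indicator {\<delta>..b} y"
      proof (cases "\<delta> \<le> y \<and> y \<le> b")
        case True
        then have "?U' y \<noteq> 0" using vertical_derivative_pos[OF up[of y]] by auto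
        then show ?thesis using True by (simp add: M_def gp_def flux_density_def trunc''_def N_def)
      next
        case F: False
        have "M n (Complex x y) = 0" if "\<delta> \<le> y"
        proof -
          have "b \<le> y" using F that by simp
          then have "b\<^sup>2 \<le> y\<^sup>2" using b by (intro power_mono) auto
          then have "R\<^sup>2 \<le> (cmod (Complex x y))\<^sup>2" using b by (simp add: cmod_power2)
          then have "R \<le> cmod (Complex x y)" by (rule power2_le_imp_le) simp
          then show ?thesis by (rule M_0)
        qed
        then show ?thesis using F by (auto simp: indicator_def)
      qed
    qed
    have CU: "(?U has_real_derivative ?U' y) (at y)" "0 < ?U' y" "isCont ?U' y" if "\<delta> \<le> y" "y \<le> b" for y
      using pot_derivatives(2)[OF up[OF that]] vertical_derivative_pos[OF up[OF that]]
        DERIV_isCont[OF pot_derivatives(4)[OF up[OF that]]] by auto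
    have CG: "isCont ?G y" if "\<delta> \<le> y" "y \<le> b" for y
      using isCont_along_lines(2)[OF cont_gp] that \<delta> by auto
    have BG: "\<bar>?G y\<bar> \<le> B" if "\<delta> \<le> y" "y \<le> b" for y
      using B(2)[of "Complex x y"] that by simp
    note kernel = concentrating_kernel[where U = ?U and U' = ?U' and G = ?G and \<kappa> = \<kappa> and a = \<delta> and b = b]
    have "\<bar>f n x\<bar> \<le> B" for n
      unfolding f_eq by (rule kernel(1)) (fact step \<kappa> CU CG less_imp_le[OF \<delta>b] BG | assumption)+
    moreover have "(\<lambda>n. f n x) \<longlonglongrightarrow> l x"
    proof (cases "r < pot (Complex x \<delta>)")
      case gt: True
      then have "\<not> \<delta> \<le> height r x" using height_ge_iff[OF r \<delta>, of x] by auto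
      then have l0: "l x = 0" by (simp add: l_def)
      show ?thesis unfolding f_eq l0
        by (rule kernel(2)) (fact step \<kappa> CU CG less_imp_le[OF \<delta>b] gt | assumption)+
    next
      case False
      then have h: "\<delta> \<le> height r x" using height_ge_iff[OF r \<delta>, of x] True p by auto
      then have h0: "0 < height r x" using \<delta> by simp
      note H = height_posD[OF r h0]
      have "cmod (Complex x (height r x)) < R" using big H by (auto simp: upper_def)
      then have "(cmod (Complex x (height r x)))\<^sup>2 < R\<^sup>2" by (intro power_strict_mono) auto
      then have "(height r x)\<^sup>2 < R\<^sup>2 - x\<^sup>2" by (simp add: cmod_power2)
      then have "height r x < b" unfolding b_def by (rule real_less_rsqrt)
      note hb = this
      have lG: "l x = ?G (height r x)" using h h0 by (simp add: l_def level_weight_def gp_def)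
      show ?thesis unfolding f_eq lG
        by (rule kernel(3)) (fact step \<kappa> CU CG less_imp_le[OF \<delta>b] h hb H(4) | assumption)+
    qed
    ultimately show ?thesis using x1 by simp
  qed
  have mid: "(\<lambda>n. \<integral>z. indicator {z. \<delta> \<le> Im z} z * M n z \<partial>lborel) \<longlonglongrightarrow> (\<integral>x. l x \<partial>lborel)"
  proof -
    have "(\<lambda>n. \<integral>x. f n x \<partial>lborel) \<longlonglongrightarrow> (\<integral>x. l x \<partial>lborel)"
    proof (rule integral_dominated_convergence)
      show "integrable lborel (\<lambda>x. B * indicator {-1..1::real} x)"
        by (intro integrable_mult_right) simp
      show "f n \<in> borel_measurable lborel" for n
        unfolding f_def[abs_def]
        using complex_inner_integral_measurable[OF half_plane_measurable[OF cont_M \<delta>]] by simp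
      show "l \<in> borel_measurable lborel"
        unfolding l_def[abs_def] using height_measurable[OF r] level_weight_measurable[OF r] by measurable
    qed (use f_props in auto)
    moreover have "(\<integral>z. indicator {z. \<delta> \<le> Im z} z * M n z \<partial>lborel) = (\<integral>x. f n x \<partial>lborel)" for n
      unfolding f_def by (rule complex_Fubini(1)[OF integrable_half_plane[OF cont_M M_0 p(3) \<delta>]])
    ultimately show ?thesis by simp
  qed
  have "(\<integral>z. indicator {z. \<delta> \<le> Im z} z * (max (pot z) r * (pxx z + pyy z)) \<partial>lborel) =
    (\<integral>x. l x \<partial>lborel) +
    (\<integral>x. indicator {r<..} (pot (Complex x \<delta>)) * (- Im (dpot (Complex x \<delta>)) * p (Complex x \<delta>)) -
       max (pot (Complex x \<delta>)) r * py (Complex x \<delta>) \<partial>lborel)"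
    by (rule LIMSEQ_unique[OF lhs]) (unfold green, rule tendsto_add[OF mid bd])
  then show ?thesis by (simp only: l_def)
qed

end

lemma cnj_measurable [measurable]: "cnj \<in> borel_measurable borel"
  by (intro borel_measurable_continuous_onI continuous_intros)

text \<open>The potential is symmetric in the real axis, so that a test function may be replaced by its even part. Then the
vertical derivative vanishes on the axis, which removes one boundary term.\<close>

lemma C2_compact_even:
  assumes "C2_compact R p px py pxx pyy"
  shows "C2_compact R (\<lambda>z. p z + p (cnj z)) (\<lambda>z. px z + px (cnj z)) (\<lambda>z. py z - py (cnj z))
     (\<lambda>z. pxx z + pxx (cnj z)) (\<lambda>z. pyy z + pyy (cnj z))"
proof -
  note P = C2_compactD[OF assms]
  have cont: "continuous_on UNIV (\<lambda>z. g (cnj z))" if "continuous_on UNIV g" for g :: "complex \<Rightarrow> real"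
    by (rule continuous_on_compose2[OF that]) (auto intro: continuous_intros)
  have cnj: "cnj (Complex x y) = Complex x (- y)" for x y by (simp add: complex_eq_iff)
  have neg: "((\<lambda>y. g (Complex x (- y))) has_real_derivative - d (Complex x (- y))) (at y)"
    if "\<And>y. ((\<lambda>y. g (Complex x y)) has_real_derivative d (Complex x y)) (at y)" for g d :: "complex \<Rightarrow> real" and x y
    using DERIV_chain2[OF that[of "- y"] DERIV_minus[OF DERIV_ident]] by simp
  show ?thesis
    unfolding C2_compact_def
  proof (intro conjI allI ballI)
    fix g assume "g \<in> {\<lambda>z. p z + p (cnj z), \<lambda>z. px z + px (cnj z), \<lambda>z. py z - py (cnj z),
       \<lambda>z. pxx z + pxx (cnj z), \<lambda>z. pyy z + pyy (cnj z)}"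
    then show "continuous_on UNIV g" "\<And>z. R \<le> cmod z \<longrightarrow> g z = 0"
      using P(1-10) cont by (auto intro!: continuous_intros)
  next
    fix x y
    show "((\<lambda>x. p (Complex x y) + p (cnj (Complex x y))) has_real_derivative
        px (Complex x y) + px (cnj (Complex x y))) (at x)"
      unfolding cnj by (intro DERIV_add P)
    show "((\<lambda>y. p (Complex x y) + p (cnj (Complex x y))) has_real_derivative
        py (Complex x y) - py (cnj (Complex x y))) (at y)"
      unfolding cnj using DERIV_add[OF P(12) neg[OF P(12)]] by simp
    show "((\<lambda>x. px (Complex x y) + px (cnj (Complex x y))) has_real_derivative
        pxx (Complex x y) + pxx (cnj (Complex x y))) (at x)"
      unfolding cnj by (intro DERIV_add P)
    show "((\<lambda>y. py (Complex x y) - py (cnj (Complex x y))) has_real_derivative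
        pyy (Complex x y) + pyy (cnj (Complex x y))) (at y)"
      unfolding cnj using DERIV_diff[OF P(14) neg[OF P(14)]] by simp
  qed
qed

lemma integral_fold_line:
  fixes g :: "real \<Rightarrow> real"
  assumes g: "integrable lborel g"
  shows "(\<integral>y. g y \<partial>lborel) = (\<integral>y. indicator {0<..} y * (g y + g (- y)) \<partial>lborel)"
proof -
  have [measurable]: "g \<in> borel_measurable borel" using g by auto
  have g': "integrable lborel (\<lambda>y. g (- y))"
    using lborel_integrable_real_affine[OF g, of "-1" 0] by simp
  have i1: "integrable lborel (\<lambda>y. indicator {0<..} y * g y)"
    and i2: "integrable lborel (\<lambda>y. indicator {0<..} y * g (- y))"
    using integrable_mult_indicator[OF _ g, of "{0<..}"] integrable_mult_indicator[OF _ g', of "{0<..}"] by auto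
  have i3: "integrable lborel (\<lambda>y. indicator {..<0} y * g y)"
    using integrable_mult_indicator[OF _ g, of "{..<0}"] by auto
  have "(\<integral>y. indicator {..<0} y * g y \<partial>lborel) = (\<integral>y. indicator {..<0} (0 + (-1) * y) * g (0 + (-1) * y) \<partial>lborel)"
    using lborel_integral_real_affine[of "-1" "\<lambda>y. indicator {..<0} y * g y" 0] by simp
  also have "\<dots> = (\<integral>y. indicator {0<..} y * g (- y) \<partial>lborel)"
    by (intro Bochner_Integration.integral_cong) (auto simp: indicator_def)
  finally have neg: "(\<integral>y. indicator {..<0} y * g y \<partial>lborel) = (\<integral>y. indicator {0<..} y * g (- y) \<partial>lborel)" .
  have "(\<integral>y. g y \<partial>lborel) = (\<integral>y. indicator {0<..} y * g y + indicator {..<0} y * g y \<partial>lborel)"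
    by (rule integral_cong_AE)
      (use AE_lborel_singleton[of "0::real"] in \<open>auto elim!: eventually_mono simp: indicator_def\<close>)
  also have "\<dots> = (\<integral>y. indicator {0<..} y * g y \<partial>lborel) + (\<integral>y. indicator {0<..} y * g (- y) \<partial>lborel)"
    using i1 i3 neg by simp
  also have "\<dots> = (\<integral>y. indicator {0<..} y * (g y + g (- y)) \<partial>lborel)"
    using i1 i2 by (simp add: distrib_left)
  finally show ?thesis .
qed

lemma integral_fold_half_plane:
  fixes f :: "complex \<Rightarrow> real"
  assumes [measurable]: "f \<in> borel_measurable borel"
    and B: "\<And>z. \<bar>f z\<bar> \<le> B" "\<And>z. 1 < cmod z \<Longrightarrow> f z = 0"
  shows "(\<integral>z. f z \<partial>lborel) = (\<integral>z. indicator {z. 0 < Im z} z * (f z + f (cnj z)) \<partial>lborel)"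
proof -
  have line: "integrable lborel (\<lambda>y. f (Complex x y))" for x
  proof (rule integrable_bounded_support)
    show "(\<lambda>y. f (Complex x y)) \<in> borel_measurable borel" by measurable
    show "f (Complex x y) = 0" if "1 < norm y" for y
      using B(2)[of "Complex x y"] abs_le_cmod_Complex(2)[of y x] that by simp
  qed (rule B(1))
  have int: "integrable lborel (\<lambda>z. indicator {z. 0 < Im z} z * (f z + f (cnj z)))"
  proof (rule integrable_bounded_support)
    show "(\<lambda>z. indicator {z. 0 < Im z} z * (f z + f (cnj z))) \<in> borel_measurable borel" by measurable
    show "\<bar>indicator {z. 0 < Im z} z * (f z + f (cnj z))\<bar> \<le> 2 * B" for z
      using B(1)[of z] B(1)[of "cnj z"] by (auto simp: indicator_def)
    show "indicator {z. 0 < Im z} z * (f z + f (cnj z)) = 0" if "1 < norm z" for z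
      using B(2)[of z] B(2)[of "cnj z"] that by simp
  qed
  have cnj: "cnj (Complex x y) = Complex x (- y)" for x y by (simp add: complex_eq_iff)
  have f: "integrable lborel f"
    by (rule integrable_bounded_support[of _ B]) (use B in auto)
  have "(\<integral>z. f z \<partial>lborel) = (\<integral>x. \<integral>y. f (Complex x y) \<partial>lborel \<partial>lborel)"
    by (rule complex_Fubini(1)[OF f])
  also have "\<dots> = (\<integral>x. \<integral>y. indicator {z. 0 < Im z} (Complex x y) * (f (Complex x y) + f (cnj (Complex x y))) \<partial>lborel \<partial>lborel)"
    unfolding integral_fold_line[OF line] cnj
    by (intro Bochner_Integration.integral_cong) (auto simp: indicator_def)
  also have "\<dots> = (\<integral>z. indicator {z. 0 < Im z} z * (f z + f (cnj z)) \<partial>lborel)"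
    by (rule complex_Fubini(1)[OF int, symmetric])
  finally show ?thesis .
qed

context segment_potential
begin

section \<open>The distributional Laplacian of the truncated potential\<close>

text \<open>The part of the axis on which the truncation at the level \<open>r\<close> does not change the potential.\<close>

definition axis :: "real \<Rightarrow> real set" where
  "axis r = {x. \<bar>x\<bar> < 1 \<and> r \<le> pot (Complex x 0)}"

lemma axis_measurable [measurable]: "axis r \<in> sets borel"
  unfolding axis_def by measurable

text \<open>Only the boundary term of Green's formula needs attention as \<open>\<delta>\<close> tends to \<open>0\<close>. At a point \<open>x\<close> of the axis with
\<open>u x \<ge> r\<close>, all points above \<open>x\<close> lie above the level \<open>r\<close>, and the vertical derivative tends to \<open>\<pi>\<close> times the
density. If \<open>u x < r\<close>, then the points just above \<open>x\<close> lie below the level and contribute nothing.\<close>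

lemma level_limit:
  assumes r: "r < 0"
    and p: "C2_compact R p px py pxx pyy" "0 < R" "R < 1"
    and big: "\<And>z. cmod z < 1 \<Longrightarrow> pot z \<le> r \<Longrightarrow> cmod z < R"
    and even: "\<And>x. py (Complex x 0) = 0"
  shows "(\<lambda>m. \<integral>x. indicator {inverse (real (Suc m))..} (height r x) * level_weight r x * p (Complex x (height r x)) \<partial>lborel)
    \<longlonglongrightarrow> (\<integral>z. indicator {z. 0 < Im z} z * (max (pot z) r * (pxx z + pyy z)) \<partial>lborel) -
        (\<integral>x. indicator (axis r) x * (pi * dens x * p (Complex x 0)) \<partial>lborel)"
proof -
  define d where "d m = inverse (real (Suc m))" for m
  have d: "0 < d m" for m by (simp add: d_def)
  have d0: "d \<longlonglongrightarrow> 0" unfolding d_def by (rule LIMSEQ_inverse_real_of_nat)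
  note P = C2_compactD[OF p(1)]
  have [measurable]: "p \<in> borel_measurable borel" "py \<in> borel_measurable borel"
    "pxx \<in> borel_measurable borel" "pyy \<in> borel_measurable borel"
    using P by (auto intro!: borel_measurable_continuous_onI)
  define K where "K = \<bar>r\<bar> + pot_const"
  have K: "0 \<le> K" using pot_const_nonneg by (simp add: K_def)
  have V: "\<bar>max (pot z) r\<bar> \<le> K" if "cmod z < 1" for z
    using pot_le_const[OF that] pot_const_nonneg by (auto simp: K_def max_def)
  have intL: "integrable lborel (\<lambda>z. pxx z + pyy z)"
    by (rule compact_support_bounded_integrable(1)[OF _ _ p(3)]) (use P in \<open>auto intro: continuous_intros\<close>)
  have T1: "(\<lambda>m. \<integral>z. indicator {z. d m \<le> Im z} z * (max (pot z) r * (pxx z + pyy z)) \<partial>lborel) \<longlonglongrightarrow>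
      (\<integral>z. indicator {z. 0 < Im z} z * (max (pot z) r * (pxx z + pyy z)) \<partial>lborel)"
  proof (rule integral_dominated_convergence)
    show "integrable lborel (\<lambda>z. K * \<bar>pxx z + pyy z\<bar>)" using intL by simp
    show "AE z in lborel. norm (indicator {z. d m \<le> Im z} z * (max (pot z) r * (pxx z + pyy z))) \<le> K * \<bar>pxx z + pyy z\<bar>" for m
    proof (rule AE_I2)
      fix z
      show "norm (indicator {z. d m \<le> Im z} z * (max (pot z) r * (pxx z + pyy z))) \<le> K * \<bar>pxx z + pyy z\<bar>"
      proof (cases "cmod z < 1")
        case True
        then show ?thesis
          using V[OF True] K by (auto simp: indicator_def abs_mult intro!: mult_right_mono)
      qed (use P p in auto)
    qed
    show "AE z in lborel. (\<lambda>m. indicator {z. d m \<le> Im z} z * (max (pot z) r * (pxx z + pyy z))) \<longlonglongrightarrow>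
        indicator {z. 0 < Im z} z * (max (pot z) r * (pxx z + pyy z))"
    proof (rule AE_I2)
      fix z
      have "(\<lambda>m. indicator {z. d m \<le> Im z} z :: real) \<longlonglongrightarrow> indicator {z. 0 < Im z} z"
      proof (cases "0 < Im z")
        case True
        then have "\<forall>\<^sub>F m in sequentially. d m < Im z" using d0 by (auto dest: order_tendstoD)
        then have "\<forall>\<^sub>F m in sequentially. 1 = (indicator {z. d m \<le> Im z} z :: real)"
          by eventually_elim simp
        then show ?thesis using True by (simp add: Lim_transform_eventually[OF tendsto_const])
      next
        case False
        then have "indicator {z. d m \<le> Im z} z = (0 :: real)" for m using d[of m] by simp
        then show ?thesis using False by simp
      qed
      then show "(\<lambda>m. indicator {z. d m \<le> Im z} z * (max (pot z) r * (pxx z + pyy z))) \<longlonglongrightarrow>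
        indicator {z. 0 < Im z} z * (max (pot z) r * (pxx z + pyy z))"
        by (intro tendsto_intros)
    qed
  qed measurable
  obtain B1 where B1: "0 \<le> B1" "\<And>z. z \<in> upper \<Longrightarrow> \<bar>Re z\<bar> \<le> R \<Longrightarrow> - Im (dpot z) \<le> B1"
    using vertical_derivative_bounded[OF p(3)] by blast
  obtain B2 where B2: "0 \<le> B2" "\<And>z. \<bar>p z\<bar> \<le> B2"
    using compact_support_bounded_integrable(2)[OF P(1) P(6) p(3)] by blast
  obtain B3 where B3: "0 \<le> B3" "\<And>z. \<bar>py z\<bar> \<le> B3"
    using compact_support_bounded_integrable(2)[OF P(3) P(8) p(3)] by blast
  have "continuous_on UNIV (\<lambda>y. Complex x y)" for x
    unfolding Complex_eq by (intro continuous_intros)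
  then have toline: "(\<lambda>m. g (Complex x (d m))) \<longlonglongrightarrow> g (Complex x 0)" if "continuous_on UNIV g" for g :: "complex \<Rightarrow> real" and x
  proof -
    assume c: "\<And>x. continuous_on UNIV (\<lambda>y. Complex x y)"
    have "continuous_on UNIV (\<lambda>y. g (Complex x y))"
      by (rule continuous_on_compose2[OF that c]) auto
    then have "isCont (\<lambda>y. g (Complex x y)) 0" by (simp add: continuous_on_eq_continuous_at)
    then show ?thesis by (rule isCont_tendsto_compose[OF _ d0])
  qed
  have T2: "(\<lambda>m. \<integral>x. indicator {r<..} (pot (Complex x (d m))) * (- Im (dpot (Complex x (d m))) * p (Complex x (d m))) -
       max (pot (Complex x (d m))) r * py (Complex x (d m)) \<partial>lborel) \<longlonglongrightarrow>
      (\<integral>x. indicator (axis r) x * (pi * dens x * p (Complex x 0)) - 0 \<partial>lborel)"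
  proof (rule integral_dominated_convergence)
    show "integrable lborel (\<lambda>x. (B1 * B2 + K * B3) * indicator {-1..1::real} x)"
      by (intro integrable_mult_right) simp
    show "AE x in lborel. norm (indicator {r<..} (pot (Complex x (d m))) * (- Im (dpot (Complex x (d m))) * p (Complex x (d m))) -
       max (pot (Complex x (d m))) r * py (Complex x (d m))) \<le> (B1 * B2 + K * B3) * indicator {-1..1::real} x" for m
    proof (rule AE_I2)
      fix x
      let ?z = "Complex x (d m)"
      show "norm (indicator {r<..} (pot ?z) * (- Im (dpot ?z) * p ?z) - max (pot ?z) r * py ?z) \<le>
         (B1 * B2 + K * B3) * indicator {-1..1::real} x"
      proof (cases "cmod ?z < R")
        case True
        then have u: "?z \<in> upper" using p d by (auto simp: upper_def)
        have xR: "\<bar>x\<bar> \<le> R" using abs_le_cmod_Complex(1)[of x "d m"] True by simp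
        have "\<bar>indicator {r<..} (pot ?z) * (- Im (dpot ?z) * p ?z)\<bar> \<le> \<bar>- Im (dpot ?z)\<bar> * \<bar>p ?z\<bar>"
          by (auto simp: indicator_def abs_mult)
        also have "\<dots> \<le> B1 * B2"
          using B1(2)[OF u] B1(1) B2 vertical_derivative_pos[OF u] xR by (intro mult_mono) auto
        finally have 1: "\<bar>indicator {r<..} (pot ?z) * (- Im (dpot ?z) * p ?z)\<bar> \<le> B1 * B2" .
        have "\<bar>max (pot ?z) r\<bar> * \<bar>py ?z\<bar> \<le> K * B3"
          using V[of ?z] B3 K True p by (intro mult_mono) auto
        then have 2: "\<bar>max (pot ?z) r * py ?z\<bar> \<le> K * B3" by (simp only: abs_mult)
        have "x \<in> {-1..1}" using xR p by auto
        then show ?thesis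
          using order_trans[OF abs_triangle_ineq4 add_mono[OF 1 2]] by simp
      next
        case False
        then show ?thesis using P(6,8)[of ?z] B1 B2 B3 K by simp
      qed
    qed
    show "AE x in lborel. (\<lambda>m. indicator {r<..} (pot (Complex x (d m))) * (- Im (dpot (Complex x (d m))) * p (Complex x (d m))) -
       max (pot (Complex x (d m))) r * py (Complex x (d m))) \<longlonglongrightarrow>
       indicator (axis r) x * (pi * dens x * p (Complex x 0)) - 0"
      using AE_lborel_singleton[of "0::real"]
    proof eventually_elim
      case (elim x)
      show ?case
      proof (cases "\<bar>x\<bar> < R")
        case False
        then have "R \<le> cmod (Complex x y)" for y using abs_le_cmod_Complex(1)[of x y] by simp
        then have "p (Complex x y) = 0" "py (Complex x y) = 0" for y using P(6,8) by auto
        then show ?thesis by simp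
      next
        case True
        \<comment> \<open>The point at height \<open>d m\<close> over \<open>x\<close> lies in the disc for large \<open>m\<close> only.\<close>
        have "continuous_on UNIV cmod" by (intro continuous_intros)
        then have "(\<lambda>m. cmod (Complex x (d m))) \<longlonglongrightarrow> cmod (Complex x 0)" by (rule toline)
        moreover have "cmod (Complex x 0) < 1" using True p by (simp add: cmod_def)
        ultimately have "\<forall>\<^sub>F m in sequentially. cmod (Complex x (d m)) < 1"
          by (rule order_tendstoD)
        then obtain M where M: "\<And>m. M \<le> m \<Longrightarrow> cmod (Complex x (d m)) < 1"
          by (auto simp: eventually_sequentially)
        have dM: "(\<lambda>m. d (m + M)) \<longlonglongrightarrow> 0" by (rule LIMSEQ_ignore_initial_segment[OF d0])
        have x1: "\<bar>x\<bar> < 1" using True p by simp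
        have u: "Complex x (d (m + M)) \<in> upper" for m using M[of "m + M"] d by (simp add: upper_def)
        have "(\<lambda>m. - Im (dpot (Complex x (d (m + M))))) \<longlonglongrightarrow> pi * dens x"
          by (rule vertical_derivative_boundary_limit[OF x1 elim dM u])
        then have a: "(\<lambda>m. - Im (dpot (Complex x (d m)))) \<longlonglongrightarrow> pi * dens x"
          by (rule LIMSEQ_offset)
        have "(\<lambda>m. pot (Complex x (d (m + M)))) \<longlonglongrightarrow> pot (Complex x 0)"
          by (rule pot_vertical_limit[OF x1 dM]) (rule M, simp)
        then have b: "(\<lambda>m. pot (Complex x (d m))) \<longlonglongrightarrow> pot (Complex x 0)"
          by (rule LIMSEQ_offset)
        have "(\<lambda>m. indicator {r<..} (pot (Complex x (d m))) :: real) \<longlonglongrightarrow> indicator (axis r) x"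
        proof (cases "r \<le> pot (Complex x 0)")
          case ge: True
          have "1 = (indicator {r<..} (pot (Complex x (d m))) :: real)" if "M \<le> m" for m
            using pot_vertical_strict_mono[OF M[OF that], of 0] d[of m] ge by simp
          then have "\<forall>\<^sub>F m in sequentially. 1 = (indicator {r<..} (pot (Complex x (d m))) :: real)"
            by (auto simp: eventually_sequentially)
          then show ?thesis using ge x1 by (simp add: axis_def Lim_transform_eventually[OF tendsto_const])
        next
          case lt: False
          then have "\<forall>\<^sub>F m in sequentially. pot (Complex x (d m)) < r"
            using b by (intro order_tendstoD) auto
          then have "\<forall>\<^sub>F m in sequentially. 0 = (indicator {r<..} (pot (Complex x (d m))) :: real)"
            by eventually_elim simp
          then show ?thesis using lt by (simp add: axis_def Lim_transform_eventually[OF tendsto_const])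
        qed
        moreover have "(\<lambda>m. max (pot (Complex x (d m))) r * py (Complex x (d m))) \<longlonglongrightarrow> max (pot (Complex x 0)) r * py (Complex x 0)"
          by (intro tendsto_intros b toline P)
        ultimately show ?thesis
          using even[of x] by (intro tendsto_intros a toline P) auto
      qed
    qed
  qed measurable
  have eq: "(\<integral>x. indicator {d m..} (height r x) * level_weight r x * p (Complex x (height r x)) \<partial>lborel) =
     (\<integral>z. indicator {z. d m \<le> Im z} z * (max (pot z) r * (pxx z + pyy z)) \<partial>lborel) -
     (\<integral>x. indicator {r<..} (pot (Complex x (d m))) * (- Im (dpot (Complex x (d m))) * p (Complex x (d m))) -
       max (pot (Complex x (d m))) r * py (Complex x (d m)) \<partial>lborel)" for m
    using level_formula[OF r d p big, of m] by simp
  show ?thesis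
    using tendsto_diff[OF T1 T2] by (simp only: eq[symmetric] diff_zero) (simp only: d_def)
qed

definition bump :: "real \<Rightarrow> complex \<Rightarrow> real" where
  "bump R z = flat 0 (R\<^sup>2 - (Re z * Re z + Im z * Im z))"

lemma bump_test_function:
  assumes "0 < R" "R < 1"
  shows "bump R \<in> test_functions"
proof (rule smooth_test_function[of _ "cball 0 R"])
  have "smooth (\<lambda>z. flat 0 (R\<^sup>2 - (Re z * Re z + Im z * Im z)))"
    by (intro smooth_flat smooth_diff smooth_const smooth_add smooth_mult smooth_Re smooth_Im)
  then show "smooth (bump R)" by (simp add: bump_def[abs_def])
  show "bump R z = 0" if "z \<notin> cball 0 R" for z
  proof -
    have "R\<^sup>2 \<le> (cmod z)\<^sup>2" using that assms by (intro power_mono) auto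
    then show ?thesis unfolding cmod_power2 by (simp add: bump_def flat_def power2_eq_square)
  qed
qed (use assms in auto)

text \<open>Test with a function that is positive near the sublevel set: the integrals over the parts of the level set
above height \<open>\<delta>\<close> increase to a finite limit.\<close>

lemma integrable_level_weight:
  assumes r: "r < 0"
  shows "integrable lborel (level_weight r)"
proof -
  obtain R0 where R0: "0 < R0" "R0 < 1" "\<And>z. cmod z < 1 \<Longrightarrow> pot z \<le> r \<Longrightarrow> cmod z < R0"
    using sublevel_radius[OF r] by blast
  define R1 where "R1 = (1 + R0) / 2"
  have R1: "0 < R1" "R1 < 1" "R0 < R1" using R0 by (auto simp: R1_def)
  obtain R \<phi>x \<phi>y \<phi>xx \<phi>yy where R: "0 < R" "R < 1" "C2_compact R (bump R1) \<phi>x \<phi>y \<phi>xx \<phi>yy"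
    using test_function_C2[OF bump_test_function[OF R1(1,2)]] by metis
  define R' where "R' = max R R0"
  define p where "p z = bump R1 z + bump R1 (cnj z)" for z
  have R': "0 < R'" "R' < 1" using R R0 by (auto simp: R'_def)
  have p: "C2_compact R' p (\<lambda>z. \<phi>x z + \<phi>x (cnj z)) (\<lambda>z. \<phi>y z - \<phi>y (cnj z)) (\<lambda>z. \<phi>xx z + \<phi>xx (cnj z)) (\<lambda>z. \<phi>yy z + \<phi>yy (cnj z))"
    unfolding p_def[abs_def]
    by (rule C2_compact_mono[OF C2_compact_even[OF R(3)]]) (simp add: R'_def)
  have cnj0: "cnj (Complex x 0) = Complex x 0" for x by (simp add: complex_eq_iff)
  note lim = level_limit[OF r p R']
  define f where "f m x = indicator {inverse (real (Suc m))..} (height r x) * level_weight r x * p (Complex x (height r x))" for m x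
  define F where "F x = level_weight r x * p (Complex x (height r x))" for x
  have p0: "0 \<le> p z" for z by (simp add: p_def bump_def flat_nonneg)
  \<comment> \<open>A lower bound for the test function on the disc of radius \<open>R0\<close>, which contains the level set.\<close>
  define c where "c = 2 * flat 0 (R1\<^sup>2 - R0\<^sup>2)"
  have "R0\<^sup>2 < R1\<^sup>2" using R0 R1 by (intro power_strict_mono) auto
  then have c: "0 < c" by (simp add: c_def flat_def)
  have pc: "c \<le> p z" if "cmod z < R0" for z
  proof -
    have "(cmod z)\<^sup>2 < R0\<^sup>2" using that by (intro power_strict_mono) auto
    then have z: "Re z * Re z + Im z * Im z < R0\<^sup>2"
      unfolding cmod_power2 by (simp add: power2_eq_square)
    have "1 / (R1\<^sup>2 - (Re z * Re z + Im z * Im z)) \<le> 1 / (R1\<^sup>2 - R0\<^sup>2)"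
      using z \<open>R0\<^sup>2 < R1\<^sup>2\<close> by (intro divide_left_mono mult_pos_pos) auto
    then show ?thesis using z \<open>R0\<^sup>2 < R1\<^sup>2\<close> by (simp add: p_def bump_def c_def flat_def)
  qed
  have pm [measurable]: "p \<in> borel_measurable borel"
    using C2_compactD(1)[OF p] by (rule borel_measurable_continuous_onI)
  have "integrable lborel F"
  proof (rule integrable_monotone_convergence)
    show "integrable lborel (f m)" for m
    proof -
      have cont: "continuous_on {z. 0 < Im z} (\<lambda>z. flux_density z * p z)"
        by (rule continuous_on_half_plane_product[OF continuous_on_flux_density C2_compactD(1)[OF p] C2_compactD(6)[OF p] R'(2)])
      have zero: "flux_density z * p z = 0" if "R' \<le> cmod z" for z
        using C2_compactD(6)[OF p that] by simp
      have pos: "0 < inverse (real (Suc m))" by simp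
      obtain B where B: "0 \<le> B" "\<And>z. inverse (real (Suc m)) \<le> Im z \<Longrightarrow> \<bar>flux_density z * p z\<bar> \<le> B"
        using bounded_on_half_plane[OF cont zero R'(2) pos] by blast
      show ?thesis
      proof (rule integrable_bounded_support)
        show "f m \<in> borel_measurable borel"
          unfolding f_def[abs_def] using height_measurable[OF r] level_weight_measurable[OF r] by measurable
        show "\<bar>f m x\<bar> \<le> B" for x
        proof (cases "inverse (real (Suc m)) \<le> height r x")
          case True
          then have "0 < height r x" by (rule less_le_trans[rotated]) simp
          then show ?thesis using B(2)[of "Complex x (height r x)"] True by (simp add: f_def level_weight_def)
        qed (use B in \<open>simp add: f_def\<close>)
        show "f m x = 0" if "1 < norm x" for x
          using height_posD(1)[OF r, of x] that by (auto simp: f_def level_weight_def)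
      qed
    qed
    show "AE x in lborel. mono (\<lambda>m. f m x)"
    proof (intro AE_I2 monoI)
      fix x and m n :: nat assume "m \<le> n"
      then have inv: "inverse (real (Suc n)) \<le> inverse (real (Suc m))" by (intro le_imp_inverse_le) auto
      have "(indicator {inverse (real (Suc m))..} (height r x) :: real) \<le> indicator {inverse (real (Suc n))..} (height r x)"
        using order_trans[OF inv, of "height r x"] by (simp add: indicator_def del: of_nat_Suc)
      then show "f m x \<le> f n x"
        unfolding f_def using level_weight_nonneg[OF r] p0 by (intro mult_right_mono) auto
    qed
    show "AE x in lborel. (\<lambda>m. f m x) \<longlonglongrightarrow> F x"
    proof (rule AE_I2)
      fix x
      show "(\<lambda>m. f m x) \<longlonglongrightarrow> F x"
      proof (cases "0 < height r x")
        case True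
        have "\<forall>\<^sub>F m in sequentially. inverse (real (Suc m)) < height r x"
          using LIMSEQ_inverse_real_of_nat True by (rule order_tendstoD)
        then have "\<forall>\<^sub>F m in sequentially. F x = f m x"
          by eventually_elim (simp add: f_def F_def)
        then show ?thesis by (rule Lim_transform_eventually[OF tendsto_const])
      qed (simp add: f_def F_def level_weight_def)
    qed
    show "(\<lambda>m. integral\<^sup>L lborel (f m)) \<longlonglongrightarrow>
        (\<integral>z. indicator {z. 0 < Im z} z * (max (pot z) r * (\<phi>xx z + \<phi>xx (cnj z) + (\<phi>yy z + \<phi>yy (cnj z)))) \<partial>lborel) -
        (\<integral>x. indicator (axis r) x * (pi * dens x * p (Complex x 0)) \<partial>lborel)"
      unfolding f_def[abs_def]
    proof (rule lim)
      show "cmod z < R'" if "cmod z < 1" "pot z \<le> r" for z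
        using R0(3)[OF that] by (simp add: R'_def)
    qed (simp add: cnj0)
    show "F \<in> borel_measurable lborel"
      unfolding F_def[abs_def] using height_measurable[OF r] level_weight_measurable[OF r] by measurable
  qed
  then have "integrable lborel (\<lambda>x. F x / c)" by simp
  then show ?thesis
  proof (rule Bochner_Integration.integrable_bound)
    show "AE x in lborel. norm (level_weight r x) \<le> norm (F x / c)"
    proof (rule AE_I2)
      fix x
      show "norm (level_weight r x) \<le> norm (F x / c)"
      proof (cases "0 < height r x")
        case True
        then have "cmod (Complex x (height r x)) < R0"
          using R0(3) height_posD[OF r True] by (auto simp: upper_def)
        from mult_left_mono[OF pc[OF this] level_weight_nonneg[OF r, of x]]
        show ?thesis using level_weight_nonneg[OF r, of x] p0 c by (simp add: F_def divide_simps abs_mult)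
      qed (simp add: level_weight_def)
    qed
  qed (use level_weight_measurable[OF r] in simp)
qed

text \<open>The integral over the disc is folded into the upper half plane, which replaces the test function by its even
part. The level set above an abscissa \<open>x\<close> consists of the points at heights \<open>h\<close> and \<open>- h\<close>; on the axis the even
part doubles the value.\<close>

lemma laplacian_formula:
  assumes r: "r < 0" and \<phi>: "\<phi> \<in> test_functions"
  shows "(\<integral>z\<in>unit_disc. max (pot z) r * laplace \<phi> z \<partial>lborel) =
    (\<integral>x. level_weight r x * (\<phi> (Complex x (height r x)) + \<phi> (Complex x (- height r x))) \<partial>lborel) +
    2 * pi * (\<integral>x. indicator (axis r) x * (dens x * \<phi> (Complex x 0)) \<partial>lborel)"
proof -
  obtain R0 where R0: "0 < R0" "R0 < 1" "\<And>z. cmod z < 1 \<Longrightarrow> pot z \<le> r \<Longrightarrow> cmod z < R0"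
    using sublevel_radius[OF r] by blast
  obtain R1 \<phi>x \<phi>y \<phi>xx \<phi>yy where R1: "0 < R1" "R1 < 1" "C2_compact R1 \<phi> \<phi>x \<phi>y \<phi>xx \<phi>yy"
    and lap: "\<And>z. laplace \<phi> z = \<phi>xx z + \<phi>yy z"
    using test_function_C2[OF \<phi>] by blast
  define R where "R = max R0 R1"
  have R: "0 < R" "R < 1" using R1 R0 by (auto simp: R_def)
  have C2: "C2_compact R \<phi> \<phi>x \<phi>y \<phi>xx \<phi>yy"
    by (rule C2_compact_mono[OF R1(3)]) (simp add: R_def)
  note Q = C2_compactD[OF C2]
  define p where "p z = \<phi> z + \<phi> (cnj z)" for z
  have p: "C2_compact R p (\<lambda>z. \<phi>x z + \<phi>x (cnj z)) (\<lambda>z. \<phi>y z - \<phi>y (cnj z)) (\<lambda>z. \<phi>xx z + \<phi>xx (cnj z)) (\<lambda>z. \<phi>yy z + \<phi>yy (cnj z))"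
    unfolding p_def[abs_def] by (rule C2_compact_even[OF C2])
  have cnj: "cnj (Complex x y) = Complex x (- y)" for x y by (simp add: complex_eq_iff)
  have [measurable]: "\<phi> \<in> borel_measurable borel" "\<phi>xx \<in> borel_measurable borel" "\<phi>yy \<in> borel_measurable borel"
    using Q by (auto intro!: borel_measurable_continuous_onI)
  have pm [measurable]: "p \<in> borel_measurable borel" unfolding p_def[abs_def] by measurable
  obtain B where B: "0 \<le> B" "\<And>z. \<bar>p z\<bar> \<le> B"
    using compact_support_bounded_integrable(2)[OF C2_compactD(1)[OF p] C2_compactD(6)[OF p] R(2)] by blast
  have lim: "(\<lambda>m. \<integral>x. indicator {inverse (real (Suc m))..} (height r x) * level_weight r x * p (Complex x (height r x)) \<partial>lborel)
    \<longlonglongrightarrow> (\<integral>z. indicator {z. 0 < Im z} z * (max (pot z) r * (\<phi>xx z + \<phi>xx (cnj z) + (\<phi>yy z + \<phi>yy (cnj z)))) \<partial>lborel) -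
        (\<integral>x. indicator (axis r) x * (pi * dens x * p (Complex x 0)) \<partial>lborel)"
  proof (rule level_limit[OF r p R])
    show "cmod z < R" if "cmod z < 1" "pot z \<le> r" for z
      using R0(3)[OF that] by (simp add: R_def)
  qed (simp add: cnj)
  have "(\<lambda>m. \<integral>x. indicator {inverse (real (Suc m))..} (height r x) * level_weight r x * p (Complex x (height r x)) \<partial>lborel)
    \<longlonglongrightarrow> (\<integral>x. level_weight r x * p (Complex x (height r x)) \<partial>lborel)"
  proof (rule integral_dominated_convergence)
    show "integrable lborel (\<lambda>x. B * level_weight r x)" by (intro integrable_mult_right integrable_level_weight r)
    show "AE x in lborel. norm (indicator {inverse (real (Suc m))..} (height r x) * level_weight r x * p (Complex x (height r x))) \<le> B * level_weight r x" for m
    proof (rule AE_I2)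
      fix x
      have "\<bar>level_weight r x * p (Complex x (height r x))\<bar> \<le> level_weight r x * B"
        using level_weight_nonneg[OF r, of x] B by (simp add: abs_mult mult_left_mono)
      then show "norm (indicator {inverse (real (Suc m))..} (height r x) * level_weight r x * p (Complex x (height r x))) \<le> B * level_weight r x"
        using level_weight_nonneg[OF r, of x] B(1) by (auto simp: indicator_def mult.commute)
    qed
    show "AE x in lborel. (\<lambda>m. indicator {inverse (real (Suc m))..} (height r x) * level_weight r x * p (Complex x (height r x)))
       \<longlonglongrightarrow> level_weight r x * p (Complex x (height r x))"
    proof (rule AE_I2)
      fix x
      show "(\<lambda>m. indicator {inverse (real (Suc m))..} (height r x) * level_weight r x * p (Complex x (height r x)))
       \<longlonglongrightarrow> level_weight r x * p (Complex x (height r x))"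
      proof (cases "0 < height r x")
        case True
        have "\<forall>\<^sub>F m in sequentially. inverse (real (Suc m)) < height r x"
          using LIMSEQ_inverse_real_of_nat True by (rule order_tendstoD)
        then have "\<forall>\<^sub>F m in sequentially. level_weight r x * p (Complex x (height r x)) =
            indicator {inverse (real (Suc m))..} (height r x) * level_weight r x * p (Complex x (height r x))"
          by eventually_elim simp
        then show ?thesis by (rule Lim_transform_eventually[OF tendsto_const])
      qed (simp add: level_weight_def)
    qed
  qed (use height_measurable[OF r] level_weight_measurable[OF r] in measurable)
  from LIMSEQ_unique[OF lim this]
  have main: "(\<integral>z. indicator {z. 0 < Im z} z * (max (pot z) r * (\<phi>xx z + \<phi>xx (cnj z) + (\<phi>yy z + \<phi>yy (cnj z)))) \<partial>lborel) =
     (\<integral>x. level_weight r x * p (Complex x (height r x)) \<partial>lborel) +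
     (\<integral>x. indicator (axis r) x * (pi * dens x * p (Complex x 0)) \<partial>lborel)" by simp
  define f where "f z = max (pot z) r * (\<phi>xx z + \<phi>yy z)" for z
  have L0: "\<phi>xx z = 0" "\<phi>yy z = 0" if "1 \<le> cmod z" for z using Q(9,10) that R by auto
  obtain B' where B': "0 \<le> B'" "\<And>z. \<bar>\<phi>xx z + \<phi>yy z\<bar> \<le> B'"
  proof -
    have "continuous_on UNIV (\<lambda>z. \<phi>xx z + \<phi>yy z)" by (intro continuous_intros Q)
    moreover have "\<phi>xx z + \<phi>yy z = 0" if "R \<le> cmod z" for z using Q(9,10)[OF that] by simp
    ultimately show ?thesis
      using compact_support_bounded_integrable(2)[OF _ _ R(2), of "\<lambda>z. \<phi>xx z + \<phi>yy z"] that by blast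
  qed
  have fB: "\<bar>f z\<bar> \<le> (\<bar>r\<bar> + pot_const) * B'" for z
  proof (cases "cmod z < 1")
    case True
    have "\<bar>max (pot z) r\<bar> \<le> \<bar>r\<bar> + pot_const"
      using pot_le_const[OF True] pot_const_nonneg by (auto simp: max_def)
    then show ?thesis unfolding f_def abs_mult using B' pot_const_nonneg by (intro mult_mono) auto
  qed (use L0 B' pot_const_nonneg in \<open>simp add: f_def\<close>)
  have "(\<integral>z\<in>unit_disc. max (pot z) r * laplace \<phi> z \<partial>lborel) = (\<integral>z. f z \<partial>lborel)"
    unfolding set_lebesgue_integral_def f_def lap
    by (intro Bochner_Integration.integral_cong) (auto simp: indicator_def L0)
  also have "\<dots> = (\<integral>z. indicator {z. 0 < Im z} z * (f z + f (cnj z)) \<partial>lborel)"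
    by (rule integral_fold_half_plane[OF _ fB]) (use L0 in \<open>auto simp: f_def[abs_def]\<close>)
  also have "\<dots> = (\<integral>z. indicator {z. 0 < Im z} z * (max (pot z) r * (\<phi>xx z + \<phi>xx (cnj z) + (\<phi>yy z + \<phi>yy (cnj z)))) \<partial>lborel)"
    by (intro Bochner_Integration.integral_cong) (auto simp: f_def pot_cnj algebra_simps)
  also note main
  also have "(\<integral>x. indicator (axis r) x * (pi * dens x * p (Complex x 0)) \<partial>lborel) =
      (\<integral>x. (2 * pi) * (indicator (axis r) x * (dens x * \<phi> (Complex x 0))) \<partial>lborel)"
    by (intro Bochner_Integration.integral_cong) (auto simp: p_def cnj)
  finally show ?thesis
    by (simp add: p_def cnj)
qed

end

section \<open>Demailly measures\<close>

definition sum_measure :: "'a measure \<Rightarrow> 'a measure \<Rightarrow> 'a measure" where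
  "sum_measure M N = measure_of (space M) (sets M) (\<lambda>A. emeasure M A + emeasure N A)"

lemma space_sum_measure [simp]: "space (sum_measure M N) = space M"
  and sets_sum_measure [simp, measurable_cong]: "sets (sum_measure M N) = sets M"
  by (auto simp: sum_measure_def)

lemma emeasure_sum_measure:
  assumes sets: "sets N = sets M" and A: "A \<in> sets M"
  shows "emeasure (sum_measure M N) A = emeasure M A + emeasure N A"
  unfolding sum_measure_def
proof (rule emeasure_measure_of_sigma)
  show "sigma_algebra (space M) (sets M)" ..
  show "positive (sets M) (\<lambda>A. emeasure M A + emeasure N A)"
    by (simp add: positive_def)
  show "countably_additive (sets M) (\<lambda>A. emeasure M A + emeasure N A)"
  proof (rule countably_additiveI)
    fix A :: "nat \<Rightarrow> _" assume "range A \<subseteq> sets M" "disjoint_family A"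
    then show "(\<Sum>i. emeasure M (A i) + emeasure N (A i)) = emeasure M (\<Union>i. A i) + emeasure N (\<Union>i. A i)"
      by (simp add: suminf_add[symmetric] suminf_emeasure sets)
  qed
qed fact

lemma nn_integral_sum_measure:
  assumes sets [measurable_cong]: "sets N = sets M" and f: "f \<in> borel_measurable M"
  shows "(\<integral>\<^sup>+x. f x \<partial>sum_measure M N) = (\<integral>\<^sup>+x. f x \<partial>M) + (\<integral>\<^sup>+x. f x \<partial>N)"
  using f
proof (induction rule: borel_measurable_induct)
  case (cong f g)
  have sp: "space N = space M" using sets by (rule sets_eq_imp_space_eq)
  have "(\<integral>\<^sup>+x. f x \<partial>L) = (\<integral>\<^sup>+x. g x \<partial>L)" if "space L = space M" for L
    by (rule nn_integral_cong) (use cong that in auto)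
  from this[of M] this[of N] this[of "sum_measure M N"] show ?case
    using cong sp by simp
next
  case (set A)
  then show ?case by (simp add: emeasure_sum_measure sets)
next
  case (mult u c)
  have "u \<in> borel_measurable N" "u \<in> borel_measurable (sum_measure M N)"
    using mult by measurable
  with mult show ?case by (simp add: nn_integral_cmult distrib_left)
next
  case (add u v)
  have "u \<in> borel_measurable N" "u \<in> borel_measurable (sum_measure M N)"
    "v \<in> borel_measurable N" "v \<in> borel_measurable (sum_measure M N)"
    using add by measurable
  with add show ?case by (simp add: nn_integral_add add_ac)
next
  case (seq U)
  have [measurable]: "U i \<in> borel_measurable M" for i by (rule seq)
  have m: "U i \<in> borel_measurable N" "U i \<in> borel_measurable (sum_measure M N)" for i
    by measurable
  have inc: "incseq (\<lambda>i. \<integral>\<^sup>+x. U i x \<partial>L)" for L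
    using seq(3) by (auto simp: incseq_def le_fun_def intro!: nn_integral_mono)
  have "(\<integral>\<^sup>+x. (SUP i. U i x) \<partial>L) = (SUP i. \<integral>\<^sup>+x. U i x \<partial>L)" if "\<And>i. U i \<in> borel_measurable L" for L
    by (rule nn_integral_monotone_convergence_SUP[OF seq(3) that])
  from this[OF seq(1)] this[OF m(1)] this[OF m(2)] show ?case
    using seq ennreal_SUP_add[OF inc[of M] inc[of N]] by (simp add: SUP_apply[abs_def] image_comp)
qed

lemma integral_sum_measure:
  fixes f :: "'a \<Rightarrow> real"
  assumes sets [measurable_cong]: "sets N = sets M" and f: "integrable M f" "integrable N f"
  shows "integrable (sum_measure M N) f"
    and "(\<integral>x. f x \<partial>sum_measure M N) = (\<integral>x. f x \<partial>M) + (\<integral>x. f x \<partial>N)"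
proof -
  have [measurable]: "f \<in> borel_measurable M" using f by auto
  have nn: "(\<integral>\<^sup>+x. ennreal (g x) \<partial>sum_measure M N) = (\<integral>\<^sup>+x. ennreal (g x) \<partial>M) + (\<integral>\<^sup>+x. ennreal (g x) \<partial>N)"
    if [measurable]: "g \<in> borel_measurable M" for g :: "'a \<Rightarrow> real"
    by (rule nn_integral_sum_measure[OF sets]) measurable
  have fin: "(\<integral>\<^sup>+x. ennreal (f x) \<partial>L) < top" "(\<integral>\<^sup>+x. ennreal (- f x) \<partial>L) < top"
    if "integrable L f" for L
    using integrableD(2)[OF that] integrableD(3)[OF that] by (auto simp: less_top)
  show int: "integrable (sum_measure M N) f"
    unfolding real_integrable_def using f fin by (auto simp: nn less_top[symmetric] real_integrable_def)
  show "(\<integral>x. f x \<partial>sum_measure M N) = (\<integral>x. f x \<partial>M) + (\<integral>x. f x \<partial>N)"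
    using fin[OF f(1)] fin[OF f(2)]
    by (simp add: real_lebesgue_integral_def[OF int] real_lebesgue_integral_def[OF f(1)]
        real_lebesgue_integral_def[OF f(2)] nn enn2real_plus)
qed

definition disc_borel :: "complex measure" where
  "disc_borel = restrict_space borel unit_disc"

lemma space_disc_borel [simp]: "space disc_borel = unit_disc"
  by (simp add: disc_borel_def space_restrict_space)

lemma borel_to_disc_borel: "f \<in> borel_measurable borel \<Longrightarrow> f \<in> borel_measurable disc_borel"
  unfolding disc_borel_def by (rule measurable_restrict_space1)

context segment_potential
begin

text \<open>The point of the upper (\<open>\<sigma> = 1\<close>) or lower (\<open>\<sigma> = - 1\<close>) graph over \<open>x\<close>, or the point \<open>x\<close> itself (\<open>\<sigma> = 0\<close>). The
default value \<open>0\<close> outside \<open>(-1, 1)\<close> makes it a map into the disc.\<close>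

definition graph_point :: "real \<Rightarrow> real \<Rightarrow> real \<Rightarrow> complex" where
  "graph_point r \<sigma> x = (if \<bar>x\<bar> < 1 then Complex x (\<sigma> * height r x) else 0)"

lemma graph_point_in_disc:
  assumes "r < 0" "\<bar>\<sigma>\<bar> \<le> 1"
  shows "graph_point r \<sigma> x \<in> unit_disc"
proof (cases "\<bar>x\<bar> < 1")
  case True
  have h: "cmod (Complex x (height r x)) < 1"
  proof (cases "0 < height r x")
    case True
    then show ?thesis using height_posD(3)[OF assms(1)] by (simp add: upper_def)
  next
    case False
    then have "height r x = 0" using height_nonneg[OF assms(1), of x] by simp
    then show ?thesis using True by (simp add: cmod_def)
  qed
  have "\<bar>\<sigma> * height r x\<bar> \<le> \<bar>height r x\<bar>"
    using assms by (simp add: abs_mult mult_left_le_one_le)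
  then have "(\<sigma> * height r x)\<^sup>2 \<le> (height r x)\<^sup>2" by (simp only: abs_le_square_iff)
  then have "(cmod (Complex x (\<sigma> * height r x)))\<^sup>2 \<le> (cmod (Complex x (height r x)))\<^sup>2"
    unfolding cmod_power2 by simp
  then have "cmod (Complex x (\<sigma> * height r x)) \<le> cmod (Complex x (height r x))"
    by (rule power2_le_imp_le) simp
  then show ?thesis using h True by (simp add: graph_point_def)
qed (simp add: graph_point_def)

lemma graph_point_measurable:
  assumes "r < 0" "\<bar>\<sigma>\<bar> \<le> 1"
  shows "graph_point r \<sigma> \<in> measurable borel disc_borel"
  unfolding disc_borel_def
proof (rule measurable_restrict_space2)
  show "graph_point r \<sigma> \<in> space borel \<rightarrow> unit_disc" using graph_point_in_disc[OF assms] by auto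
  show "graph_point r \<sigma> \<in> borel_measurable borel"
    unfolding graph_point_def[abs_def] using height_measurable[OF assms(1)] by measurable
qed

definition graph_measure :: "(real \<Rightarrow> real) \<Rightarrow> real \<Rightarrow> real \<Rightarrow> complex measure" where
  "graph_measure w r \<sigma> = distr (density lborel (\<lambda>x. ennreal (w x))) disc_borel (graph_point r \<sigma>)"

lemma sets_graph_measure [simp, measurable_cong]: "sets (graph_measure w r \<sigma>) = sets disc_borel"
  and space_graph_measure [simp]: "space (graph_measure w r \<sigma>) = unit_disc"
  by (simp_all add: graph_measure_def)

lemma nn_integral_graph_measure:
  assumes r: "r < 0" "\<bar>\<sigma>\<bar> \<le> 1" and w [measurable]: "w \<in> borel_measurable borel"
    and f: "f \<in> borel_measurable disc_borel"
  shows "(\<integral>\<^sup>+z. f z \<partial>graph_measure w r \<sigma>) = (\<integral>\<^sup>+x. ennreal (w x) * f (graph_point r \<sigma> x) \<partial>lborel)"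
proof -
  have m: "graph_point r \<sigma> \<in> measurable (density lborel (\<lambda>x. ennreal (w x))) disc_borel"
    using graph_point_measurable[OF r] by simp
  have fm [measurable]: "(\<lambda>x. f (graph_point r \<sigma> x)) \<in> borel_measurable borel"
    using measurable_compose[OF graph_point_measurable[OF r] f] .
  have "f \<in> borel_measurable (distr (density lborel (\<lambda>x. ennreal (w x))) disc_borel (graph_point r \<sigma>))"
    using f by simp
  from nn_integral_distr[OF m this] show ?thesis
    unfolding graph_measure_def by (simp add: nn_integral_density)
qed

lemma emeasure_graph_measure:
  assumes "r < 0" "\<bar>\<sigma>\<bar> \<le> 1" "w \<in> borel_measurable borel" "A \<in> sets disc_borel"
  shows "emeasure (graph_measure w r \<sigma>) A = (\<integral>\<^sup>+x. ennreal (w x) * indicator A (graph_point r \<sigma> x) \<partial>lborel)"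
  using nn_integral_graph_measure[OF assms(1-3), of "indicator A"] assms(4) by simp

lemma finite_graph_measure:
  assumes "r < 0" "\<bar>\<sigma>\<bar> \<le> 1" "integrable lborel w"
  shows "emeasure (graph_measure w r \<sigma>) A < \<infinity>"
proof -
  have [measurable]: "w \<in> borel_measurable borel" using assms by auto
  have "emeasure (graph_measure w r \<sigma>) A \<le> emeasure (graph_measure w r \<sigma>) (space (graph_measure w r \<sigma>))"
    by (rule emeasure_space)
  also have "\<dots> = (\<integral>\<^sup>+x. ennreal (w x) * indicator unit_disc (graph_point r \<sigma> x) \<partial>lborel)"
    using sets.top[of disc_borel] by (simp add: emeasure_graph_measure assms)
  also have "\<dots> \<le> (\<integral>\<^sup>+x. ennreal (w x) \<partial>lborel)"
    by (intro nn_integral_mono) (auto simp: indicator_def)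
  also have "\<dots> < \<infinity>"
    using integrableD(2)[OF assms(3)] by (simp add: less_top)
  finally show ?thesis .
qed

lemma integral_graph_measure:
  fixes \<phi> :: "complex \<Rightarrow> real"
  assumes r: "r < 0" "\<bar>\<sigma>\<bar> \<le> 1" and w: "integrable lborel w" "\<And>x. 0 \<le> w x"
    and \<phi> [measurable]: "\<phi> \<in> borel_measurable borel" and B: "\<And>z. \<bar>\<phi> z\<bar> \<le> B"
  shows "(\<integral>z. \<phi> z \<partial>graph_measure w r \<sigma>) = (\<integral>x. w x * \<phi> (graph_point r \<sigma> x) \<partial>lborel)"
    and "integrable (graph_measure w r \<sigma>) \<phi>"
    and "integrable lborel (\<lambda>x. w x * \<phi> (graph_point r \<sigma> x))"
proof -
  have [measurable]: "w \<in> borel_measurable borel" using w by auto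
  have m: "graph_point r \<sigma> \<in> measurable (density lborel (\<lambda>x. ennreal (w x))) disc_borel"
    using graph_point_measurable[OF r] by simp
  have \<phi>m: "\<phi> \<in> borel_measurable disc_borel" by (rule borel_to_disc_borel[OF \<phi>])
  have [measurable]: "(\<lambda>x. \<phi> (graph_point r \<sigma> x)) \<in> borel_measurable borel"
    using measurable_compose[OF graph_point_measurable[OF r] \<phi>m] .
  show "(\<integral>z. \<phi> z \<partial>graph_measure w r \<sigma>) = (\<integral>x. w x * \<phi> (graph_point r \<sigma> x) \<partial>lborel)"
    unfolding graph_measure_def by (simp add: integral_distr[OF m \<phi>m] integral_density w)
  have bound: "integrable lborel (\<lambda>x. w x * B)" using w by simp
  show i: "integrable lborel (\<lambda>x. w x * \<phi> (graph_point r \<sigma> x))"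
  proof (rule Bochner_Integration.integrable_bound[OF bound])
    show "AE x in lborel. norm (w x * \<phi> (graph_point r \<sigma> x)) \<le> norm (w x * B)"
    proof (rule AE_I2)
      fix x
      have "\<bar>\<phi> (graph_point r \<sigma> x)\<bar> \<le> \<bar>B\<bar>" using B[of "graph_point r \<sigma> x"] by linarith
      then show "norm (w x * \<phi> (graph_point r \<sigma> x)) \<le> norm (w x * B)"
        by (simp add: abs_mult mult_left_mono)
    qed
  qed measurable
  show "integrable (graph_measure w r \<sigma>) \<phi>"
    unfolding graph_measure_def using i by (simp add: integrable_distr_eq[OF m \<phi>m] integrable_density w)
qed

text \<open>The Demailly measure, as \<open>demailly_measure_eq\<close> shows. The factor \<open>1 / (2 \<pi>)\<close> is the normalization of the
Laplacian.\<close>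

definition level_measure :: "real \<Rightarrow> complex measure" where
  "level_measure r = sum_measure (graph_measure (\<lambda>x. level_weight r x / (2 * pi)) r 1) (graph_measure (\<lambda>x. level_weight r x / (2 * pi)) r (- 1))"

text \<open>The restriction of the Laplacian of the potential to the complement of the sublevel set.\<close>

definition segment_measure :: "real \<Rightarrow> complex measure" where
  "segment_measure r = graph_measure (\<lambda>x. indicator (axis r) x * dens x) r 0"

lemma sets_level_segment [simp, measurable_cong]:
  "sets (level_measure r) = sets disc_borel" "sets (segment_measure r) = sets disc_borel"
  by (simp_all add: level_measure_def segment_measure_def)

lemma weight_props:
  assumes r: "r < 0"
  shows "integrable lborel (\<lambda>x. level_weight r x / (2 * pi))" "0 \<le> level_weight r x / (2 * pi)"
    "integrable lborel (\<lambda>x. indicator (axis r) x * dens x)" "0 \<le> indicator (axis r) x * dens x"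
proof -
  show "integrable lborel (\<lambda>x. level_weight r x / (2 * pi))" "0 \<le> level_weight r x / (2 * pi)"
    using integrable_level_weight[OF r] level_weight_nonneg[OF r] by auto
  show "integrable lborel (\<lambda>x. indicator (axis r) x * dens x)" "0 \<le> indicator (axis r) x * dens x"
    using integrable_mult_indicator[OF _ integrable_dens, of "axis r"] dens_nonneg by auto
qed

lemma integral_level_measure:
  fixes \<phi> :: "complex \<Rightarrow> real"
  assumes r: "r < 0" and \<phi>: "\<phi> \<in> borel_measurable borel" "\<And>z. \<bar>\<phi> z\<bar> \<le> B"
  shows "integrable (level_measure r) \<phi>"
    "(\<integral>z. \<phi> z \<partial>level_measure r) =
      1 / (2 * pi) * (\<integral>x. level_weight r x * (\<phi> (Complex x (height r x)) + \<phi> (Complex x (- height r x))) \<partial>lborel)"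
    "integrable (segment_measure r) \<phi>"
    "(\<integral>z. \<phi> z \<partial>segment_measure r) = (\<integral>x. indicator (axis r) x * (dens x * \<phi> (Complex x 0)) \<partial>lborel)"
proof -
  note W = weight_props[OF r]
  have s: "r < 0" "\<bar>1::real\<bar> \<le> 1" "\<bar>- 1::real\<bar> \<le> 1" "\<bar>0::real\<bar> \<le> 1" using r by auto
  note up = integral_graph_measure[OF s(1,2) W(1,2) \<phi>]
  note down = integral_graph_measure[OF s(1,3) W(1,2) \<phi>]
  note seg = integral_graph_measure[OF s(1,4) W(3,4) \<phi>]
  show "integrable (level_measure r) \<phi>"
    unfolding level_measure_def by (rule integral_sum_measure(1)[OF _ up(2) down(2)]) simp
  have wpt: "level_weight r x * \<phi> (graph_point r \<sigma> x) = level_weight r x * \<phi> (Complex x (\<sigma> * height r x))" for \<sigma> x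
    using height_posD(1)[OF r, of x] by (auto simp: graph_point_def level_weight_def)
  have "(\<integral>z. \<phi> z \<partial>level_measure r) = (\<integral>x. level_weight r x / (2 * pi) * \<phi> (graph_point r 1 x) \<partial>lborel) + (\<integral>x. level_weight r x / (2 * pi) * \<phi> (graph_point r (- 1) x) \<partial>lborel)"
    unfolding level_measure_def using integral_sum_measure(2)[OF _ up(2) down(2)] up(1) down(1) by simp
  also have "\<dots> = (\<integral>x. level_weight r x / (2 * pi) * \<phi> (graph_point r 1 x) + level_weight r x / (2 * pi) * \<phi> (graph_point r (- 1) x) \<partial>lborel)"
    using up(3) down(3) by simp
  also have "\<dots> = (\<integral>x. 1 / (2 * pi) * (level_weight r x * (\<phi> (Complex x (height r x)) + \<phi> (Complex x (- height r x)))) \<partial>lborel)"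
  proof (rule Bochner_Integration.integral_cong[OF refl])
    fix x
    have "level_weight r x / (2 * pi) * \<phi> (graph_point r \<sigma> x) = 1 / (2 * pi) * (level_weight r x * \<phi> (Complex x (\<sigma> * height r x)))" for \<sigma>
      by (simp only: times_divide_eq_left mult_1_left wpt)
    from this[of 1] this[of "- 1"]
    show "level_weight r x / (2 * pi) * \<phi> (graph_point r 1 x) + level_weight r x / (2 * pi) * \<phi> (graph_point r (- 1) x) =
       1 / (2 * pi) * (level_weight r x * (\<phi> (Complex x (height r x)) + \<phi> (Complex x (- height r x))))"
      by (simp only: distrib_left mult_1_left mult_minus1)
  qed
  finally show "(\<integral>z. \<phi> z \<partial>level_measure r) =
      1 / (2 * pi) * (\<integral>x. level_weight r x * (\<phi> (Complex x (height r x)) + \<phi> (Complex x (- height r x))) \<partial>lborel)"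
    by simp
  show "integrable (segment_measure r) \<phi>"
    unfolding segment_measure_def by (rule seg(2))
  show "(\<integral>z. \<phi> z \<partial>segment_measure r) = (\<integral>x. indicator (axis r) x * (dens x * \<phi> (Complex x 0)) \<partial>lborel)"
    unfolding segment_measure_def seg(1)
    by (intro Bochner_Integration.integral_cong) (auto simp: graph_point_def axis_def indicator_def)
qed

lemma finite_level_segment:
  assumes r: "r < 0"
  shows "emeasure (level_measure r) A < \<infinity>" "emeasure (segment_measure r) A < \<infinity>"
proof -
  note W = weight_props[OF r]
  show "emeasure (segment_measure r) A < \<infinity>"
    unfolding segment_measure_def by (rule finite_graph_measure[OF r _ W(3)]) simp
  show "emeasure (level_measure r) A < \<infinity>"
  proof (cases "A \<in> sets disc_borel")
    case True
    then show ?thesis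
      unfolding level_measure_def using finite_graph_measure[OF r _ W(1), of 1 A] finite_graph_measure[OF r _ W(1), of "-1" A]
      by (subst emeasure_sum_measure) (auto simp: ennreal_add_less_top)
  qed (simp add: emeasure_notin_sets)
qed

lemma truncated_laplacian_measure:
  assumes r: "r < 0" and u: "\<And>z. z \<in> unit_disc \<Longrightarrow> v z = ereal (max (pot z) r)"
  shows "is_laplacian_measure v (sum_measure (level_measure r) (segment_measure r))"
  unfolding is_laplacian_measure_def
proof (intro conjI allI impI ballI)
  let ?M = "sum_measure (level_measure r) (segment_measure r)"
  show "sets ?M = sets (restrict_space borel unit_disc)"
    by (simp add: disc_borel_def)
  fix K :: "complex set"
  show "emeasure ?M K < \<infinity>"
  proof (cases "K \<in> sets disc_borel")
    case True
    then show ?thesis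
      using finite_level_segment[OF r, of K] by (subst emeasure_sum_measure) (auto simp: ennreal_add_less_top)
  qed (simp add: emeasure_notin_sets)
  assume K: "compact K \<and> K \<subseteq> unit_disc"
  then have [measurable]: "K \<in> sets borel" by (simp add: borel_compact)
  have "real_of_ereal (v z) = max (pot z) r" if "z \<in> unit_disc" for z
    unfolding u[OF that] by (rule real_of_ereal.simps)
  then have eq: "(\<lambda>z. indicator K z *\<^sub>R real_of_ereal (v z)) = (\<lambda>z. indicator K z * max (pot z) r)"
    using K by (auto simp: indicator_def fun_eq_iff)
  show "set_integrable lborel K (\<lambda>z. real_of_ereal (v z))"
    unfolding set_integrable_def eq
  proof (rule integrable_bounded_support)
    show "\<bar>indicator K z * max (pot z) r\<bar> \<le> \<bar>r\<bar> + pot_const" for z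
    proof (cases "z \<in> K")
      case True
      then have "cmod z < 1" using K by auto
      then show ?thesis using pot_le_const[of z] pot_const_nonneg True by (auto simp: max_def)
    qed (use pot_const_nonneg in auto)
    show "indicator K z * max (pot z) r = 0" if "1 < norm z" for z
      using K that by (auto simp: indicator_def)
  qed measurable
next
  fix \<phi> assume \<phi>: "\<phi> \<in> test_functions"
  obtain R px py pxx pyy where R: "R < 1" "C2_compact R \<phi> px py pxx pyy"
    using test_function_C2[OF \<phi>] by metis
  obtain B where B: "\<And>z. \<bar>\<phi> z\<bar> \<le> B"
    using compact_support_bounded_integrable(2)[OF C2_compactD(1)[OF R(2)] C2_compactD(6)[OF R(2)] R(1)] by blast
  have m: "\<phi> \<in> borel_measurable borel"
    using continuous_test_function[OF \<phi>] by (rule borel_measurable_continuous_onI)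
  note I = integral_level_measure[OF r m B]
  have "(\<integral>z. \<phi> z \<partial>sum_measure (level_measure r) (segment_measure r)) =
     1 / (2 * pi) * (\<integral>z\<in>unit_disc. max (pot z) r * laplace \<phi> z \<partial>lborel)"
    unfolding laplacian_formula[OF r \<phi>]
    using integral_sum_measure(2)[OF _ I(1,3)] I(2,4) by (simp add: distrib_left)
  also have "(\<integral>z\<in>unit_disc. max (pot z) r * laplace \<phi> z \<partial>lborel) =
      (\<integral>z\<in>unit_disc. real_of_ereal (v z) * laplace \<phi> z \<partial>lborel)"
  proof (rule set_lebesgue_integral_cong, simp, intro allI impI)
    fix z assume "z \<in> unit_disc"
    then show "max (pot z) r * laplace \<phi> z = real_of_ereal (v z) * laplace \<phi> z"
      unfolding u[OF \<open>z \<in> unit_disc\<close>] by (simp only: real_of_ereal.simps)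
  qed
  finally show "(\<integral>z. \<phi> z \<partial>sum_measure (level_measure r) (segment_measure r)) =
     1 / (2 * pi) * (\<integral>z\<in>unit_disc. real_of_ereal (v z) * laplace \<phi> z \<partial>lborel)" .
qed

text \<open>A level below all values of the potential: truncation there changes nothing, and statements on
truncated potentials specialize to the potential itself.\<close>

definition deep_level :: real where "deep_level = - (pot_const + 1)"

lemma deep_level_props:
  shows "deep_level < 0" "cmod z < 1 \<Longrightarrow> deep_level < pot z" "height deep_level x = 0" "level_weight deep_level x = 0" "axis deep_level = {-1<..<1}"
proof -
  show l0: "deep_level < 0" using pot_const_nonneg by (simp add: deep_level_def)
  have l: "deep_level < pot z" if "cmod z < 1" for z using pot_le_const[OF that] by (simp add: deep_level_def)
  then show "cmod z < 1 \<Longrightarrow> deep_level < pot z" .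
  have "cmod (Complex x 0) = \<bar>x\<bar>" for x by (simp add: cmod_def)
  then have lx: "deep_level < pot (Complex x 0)" if "\<bar>x\<bar> < 1" for x using l[of "Complex x 0"] that by simp
  show h: "height deep_level x = 0" for x using lx[of x] by (auto simp: height_def)
  show "level_weight deep_level x = 0" using h by (simp add: level_weight_def)
  have "deep_level \<le> pot (Complex x 0)" if "-1 < x" "x < 1" for x
    using lx[of x] that by (simp add: abs_less_iff)
  then show "axis deep_level = {-1<..<1}" unfolding axis_def by (auto simp: abs_less_iff)
qed

lemma potential_laplacian_measure:
  assumes u: "\<And>z. z \<in> unit_disc \<Longrightarrow> u z = ereal (pot z)"
  shows "laplacian_measure u = segment_measure deep_level"
proof -
  have "laplacian_measure u = sum_measure (level_measure deep_level) (segment_measure deep_level)"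
    by (intro laplacian_measure_eqI truncated_laplacian_measure deep_level_props(1)) (use u deep_level_props(2) in \<open>force simp: max_def\<close>)
  also have "\<dots> = segment_measure deep_level"
  proof (rule measure_eqI)
    fix A assume "A \<in> sets (sum_measure (level_measure deep_level) (segment_measure deep_level))"
    then have A: "A \<in> sets disc_borel" by simp
    have "emeasure (level_measure deep_level) A = 0"
      unfolding level_measure_def using A deep_level_props by (simp add: emeasure_sum_measure emeasure_graph_measure)
    then show "emeasure (sum_measure (level_measure deep_level) (segment_measure deep_level)) A = emeasure (segment_measure deep_level) A"
      using A by (simp add: emeasure_sum_measure)
  qed simp
  finally show ?thesis .
qed

text \<open>The Laplacian of the truncated potential is the sum of a measure on the graphs and the measure that is
subtracted in the definition of Demailly. All measures are finite, so the subtraction is exact.\<close>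

theorem demailly_measure_eq:
  assumes r: "r < 0" and u: "\<And>z. z \<in> unit_disc \<Longrightarrow> u z = ereal (pot z)"
  shows "demailly_measure u r = level_measure r"
proof -
  let ?M = "sum_measure (level_measure r) (segment_measure r)"
  have "sublevel u r = unit_disc \<inter> {z. pot z < r}"
    using u by (auto simp: sublevel_def)
  moreover have "{z. pot z < r} \<in> sets borel" by measurable
  ultimately have sub: "unit_disc - sublevel u r \<in> sets disc_borel"
    by (auto simp: disc_borel_def sets_restrict_space intro!: image_eqI[of _ _ "- {z. pot z < r}"])
  have lap: "laplacian_measure u = segment_measure deep_level"
    by (rule potential_laplacian_measure) (rule u)
  let ?N = "density (laplacian_measure u) (indicator (unit_disc - sublevel u r))"
  have N: "emeasure ?N A = emeasure (segment_measure r) A" if A: "A \<in> sets disc_borel" for A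
  proof -
    have [measurable]: "indicator A \<in> borel_measurable disc_borel"
      "indicator (unit_disc - sublevel u r) \<in> borel_measurable disc_borel"
      using A sub by auto
    have "emeasure ?N A = (\<integral>\<^sup>+z. indicator (unit_disc - sublevel u r) z * indicator A z \<partial>segment_measure deep_level)"
      unfolding lap using A sub by (subst emeasure_density) auto
    also have "\<dots> = (\<integral>\<^sup>+x. ennreal (indicator (axis deep_level) x * dens x) *
         (indicator (unit_disc - sublevel u r) (graph_point deep_level 0 x) * indicator A (graph_point deep_level 0 x)) \<partial>lborel)"
      unfolding segment_measure_def
      by (rule nn_integral_graph_measure) (use deep_level_props(1) A sub in auto)
    also have "\<dots> = (\<integral>\<^sup>+x. ennreal (indicator (axis r) x * dens x) * indicator A (graph_point r 0 x) \<partial>lborel)"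
    proof (rule nn_integral_cong)
      fix x
      show "ennreal (indicator (axis deep_level) x * dens x) *
         (indicator (unit_disc - sublevel u r) (graph_point deep_level 0 x) * indicator A (graph_point deep_level 0 x)) =
         ennreal (indicator (axis r) x * dens x) * indicator A (graph_point r 0 x)"
      proof (cases "0 < x \<and> x < 1")
        case True
        then have "Complex x 0 \<in> unit_disc" by (simp add: cmod_def)
        then show ?thesis
          using True u[of "Complex x 0"] unfolding deep_level_props(5)
          by (auto simp: graph_point_def axis_def sublevel_def indicator_def)
      qed (auto simp: dens_0)
    qed
    also have "\<dots> = emeasure (segment_measure r) A"
      unfolding segment_measure_def by (rule emeasure_graph_measure[symmetric]) (use r A in auto)
    finally show ?thesis .
  qed
  have setsN: "sets ?N = sets disc_borel"
    unfolding lap by simp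
  have M: "laplacian_measure (\<lambda>z. max (u z) (ereal r)) = ?M"
    by (intro laplacian_measure_eqI truncated_laplacian_measure r) (use u in \<open>auto simp: max_def\<close>)
  have eM: "emeasure ?M A = emeasure (level_measure r) A + emeasure (segment_measure r) A" if "A \<in> sets disc_borel" for A
    using that by (simp add: emeasure_sum_measure)
  have top: "unit_disc \<in> sets disc_borel" using sets.top[of disc_borel] by simp
  have sp: "space ?M = unit_disc" "space ?N = unit_disc"
    using sets_eq_imp_space_eq[OF setsN] sets_eq_imp_space_eq[of ?M disc_borel] by simp_all
  have finM: "finite_measure ?M"
    by (rule finite_measureI, unfold sp(1) eM[OF top])
      (use finite_level_segment[OF r, of unit_disc] in \<open>auto simp: less_top\<close>)
  have finN: "finite_measure ?N"
    by (rule finite_measureI, unfold sp(2) N[OF top])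
      (use finite_level_segment[OF r, of unit_disc] in \<open>auto simp: less_top\<close>)
  show ?thesis
    unfolding demailly_measure_def M
  proof (rule measure_eqI)
    fix A assume "A \<in> sets (diff_measure ?M ?N)"
    then have A: "A \<in> sets disc_borel" by simp
    have "emeasure (diff_measure ?M ?N) A = emeasure ?M A - emeasure ?N A"
      by (rule emeasure_diff_measure[OF finM finN]) (use A setsN eM N in auto)
    also have "\<dots> = emeasure (level_measure r) A"
      using finite_level_segment(2)[OF r, of A] by (simp add: eM[OF A] N[OF A])
    finally show "emeasure (diff_measure ?M ?N) A = emeasure (level_measure r) A" .
  qed simp
qed

end

section \<open>The Lelong-Jensen formula for harmonic functions\<close>

lemma radial_cutoff:
  assumes "0 \<le> R1" "R1 < R2"
  obtains c where "smooth c" "\<And>z. cmod z \<le> R1 \<Longrightarrow> c z = 1" "\<And>z. R2 \<le> cmod z \<Longrightarrow> c z = 0"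
proof -
  define k where "k = 1 / (R2\<^sup>2 - R1\<^sup>2)"
  have pos: "0 < R2\<^sup>2 - R1\<^sup>2" using assms by (simp add: power_strict_mono)
  then have k: "0 < k" "k * (R2\<^sup>2 - R1\<^sup>2) = 1" by (auto simp: k_def)
  define c where "c z = smooth_step (k * (R2\<^sup>2 - (Re z * Re z + Im z * Im z)))" for z
  have c_eq: "c z = smooth_step (k * (R2\<^sup>2 - (cmod z)\<^sup>2))" for z
    unfolding c_def cmod_power2 by (simp add: power2_eq_square)
  show thesis
  proof (rule that)
    have "smooth (\<lambda>z. smooth_step (k * (R2\<^sup>2 - (Re z * Re z + Im z * Im z))))"
      by (intro smooth_smooth_step smooth_diff smooth_const smooth_add smooth_mult smooth_Re smooth_Im)
    then show "smooth c" by (simp add: c_def[abs_def])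
    show "c z = 1" if "cmod z \<le> R1" for z
    proof -
      have "(cmod z)\<^sup>2 \<le> R1\<^sup>2" using that by (intro power_mono) auto
      then have "k * (R2\<^sup>2 - R1\<^sup>2) \<le> k * (R2\<^sup>2 - (cmod z)\<^sup>2)" using k by (intro mult_left_mono) auto
      then show ?thesis unfolding c_eq using k by (intro smooth_step_props) simp
    qed
    show "c z = 0" if "R2 \<le> cmod z" for z
    proof -
      have "R2\<^sup>2 \<le> (cmod z)\<^sup>2" using that assms by (intro power_mono) auto
      then show ?thesis unfolding c_eq using k by (intro smooth_step_props mult_nonneg_nonpos) auto
    qed
  qed
qed

text \<open>The second derivatives in the directions \<open>1\<close> and \<open>\<i>\<close> are the real parts of \<open>Q''\<close> and \<open>\<i>\<^sup>2 Q''\<close>.\<close>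

lemma laplace_Re_holomorphic:
  assumes Q: "Q holomorphic_on U" "open U" and eq: "\<And>w. w \<in> U \<Longrightarrow> \<phi> w = Re (Q w)" and z: "z \<in> U"
  shows "laplace \<phi> z = 0"
proof -
  have D: "((\<lambda>w. Re (F w * a)) has_derivative (\<lambda>h. Re (deriv F w * h * a))) (at w)"
    if "F holomorphic_on U" "w \<in> U" for F w a
  proof -
    have "(F has_field_derivative deriv F w) (at w)"
      by (rule holomorphic_derivI[OF that(1) Q(2) that(2)])
    then have "(F has_derivative (\<lambda>h. deriv F w * h)) (at w)"
      by (simp add: has_field_derivative_def)
    then have "((\<lambda>w. F w * a) has_derivative (\<lambda>h. deriv F w * h * a)) (at w)"
      by (rule has_derivative_mult_left)
    then show ?thesis
      by (rule bounded_linear.has_derivative[OF bounded_linear_Re])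
  qed
  have first: "frechet_derivative \<phi> (at w) b = Re (deriv Q w * b)" if "w \<in> U" for w b
  proof -
    have "(\<phi> has_derivative (\<lambda>h. Re (deriv Q w * h))) (at w)"
      using D[OF Q(1) that, of 1] unfolding mult_1_right
      by (rule has_derivative_transform_within_open[OF _ Q(2) that]) (simp add: eq)
    from frechet_derivative_at[OF this, symmetric] show ?thesis by simp
  qed
  have Q': "deriv Q holomorphic_on U" by (rule holomorphic_deriv[OF Q])
  have second: "frechet_derivative (\<lambda>w. frechet_derivative \<phi> (at w) b) (at z) b = Re (deriv (deriv Q) z * b * b)" for b
  proof -
    have "((\<lambda>w. frechet_derivative \<phi> (at w) b) has_derivative (\<lambda>h. Re (deriv (deriv Q) z * h * b))) (at z)"
      by (rule has_derivative_transform_within_open[OF D[OF Q' z] Q(2) z]) (simp add: first)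
    from frechet_derivative_at[OF this, symmetric] show ?thesis by simp
  qed
  show ?thesis
    by (simp add: laplace_def Basis_complex_def second mult.assoc)
qed

lemma ennreal_integral_le:
  assumes "integrable M g"
  shows "ennreal (\<integral>x. g x \<partial>M) \<le> (\<integral>\<^sup>+x. ennreal (g x) \<partial>M)"
proof -
  have "(\<integral>x. g x \<partial>M) \<le> enn2real (\<integral>\<^sup>+x. ennreal (g x) \<partial>M)"
    by (simp add: real_lebesgue_integral_def[OF assms])
  then have "ennreal (\<integral>x. g x \<partial>M) \<le> ennreal (enn2real (\<integral>\<^sup>+x. ennreal (g x) \<partial>M))"
    by (rule ennreal_leI)
  also have "\<dots> = (\<integral>\<^sup>+x. ennreal (g x) \<partial>M)"
    using integrableD(2)[OF assms] by (simp add: less_top)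
  finally show ?thesis .
qed

lemma one_minus_not_nonpos: "cmod z < 1 \<Longrightarrow> 1 - z \<notin> \<real>\<^sub>\<le>\<^sub>0"
  using abs_Re_le_cmod[of z] by (auto simp: complex_nonpos_Reals_iff)

lemma one_minus_powr_holomorphic: "(\<lambda>z. (1 - z) powr a) holomorphic_on unit_disc"
  by (intro holomorphic_intros) (use one_minus_not_nonpos in auto)

context segment_potential
begin

lemma AE_level_measure:
  assumes r: "r < 0"
  shows "AE z in level_measure r. cmod z < 1 \<and> pot z = r"
proof (rule AE_I)
  let ?A = "{z \<in> unit_disc. pot z \<noteq> r}"
  have A: "?A \<in> sets disc_borel"
  proof -
    have "{z. pot z \<noteq> r} \<in> sets borel" by measurable
    then show ?thesis by (auto simp: disc_borel_def sets_restrict_space)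
  qed
  then show "?A \<in> sets (level_measure r)" by simp
  have sp: "space (level_measure r) = unit_disc"
    using sets_eq_imp_space_eq[of "level_measure r" disc_borel] by simp
  show "{z \<in> space (level_measure r). \<not> (cmod z < 1 \<and> pot z = r)} \<subseteq> ?A"
    by (auto simp: sp)
  have cnj: "Complex x (- y) = cnj (Complex x y)" for x y by (simp add: complex_eq_iff)
  have "ennreal (level_weight r x / (2 * pi)) * indicator ?A (graph_point r \<sigma> x) = 0" if "\<sigma> = 1 \<or> \<sigma> = - 1" for \<sigma> x
  proof (cases "0 < height r x")
    case True
    then have "pot (graph_point r \<sigma> x) = r"
      using height_posD(1,4)[OF r True] that by (auto simp: graph_point_def cnj pot_cnj)
    then show ?thesis by simp
  qed (simp add: level_weight_def)
  then have zero: "(\<lambda>x. ennreal (level_weight r x / (2 * pi)) * indicator ?A (graph_point r \<sigma> x)) = (\<lambda>_. 0)"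
    if "\<sigma> = 1 \<or> \<sigma> = - 1" for \<sigma>
    using that by (intro ext) blast
  have g: "emeasure (graph_measure (\<lambda>x. level_weight r x / (2 * pi)) r \<sigma>) ?A = 0" if "\<sigma> = 1 \<or> \<sigma> = - 1" for \<sigma>
  proof -
    have "\<bar>\<sigma>\<bar> \<le> 1" "(\<lambda>x. level_weight r x / (2 * pi)) \<in> borel_measurable borel"
      using that level_weight_measurable[OF r] by auto
    from emeasure_graph_measure[OF r this A] show ?thesis
      unfolding zero[OF that] by simp
  qed
  show "emeasure (level_measure r) ?A = 0"
    unfolding level_measure_def using A g by (simp add: emeasure_sum_measure)
qed

text \<open>The Lelong-Jensen formula for the harmonic function \<open>Re ((1 - z) powr a)\<close>, cut off outside a disc that
contains the sublevel set. The potential and its truncation differ only on the sublevel set, where the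
Laplacian of the test function vanishes; so both give the same integral against it, and the two
distributional identities can be subtracted.\<close>

lemma level_integral_lower_bound:
  assumes r: "r < 0"
  shows "(\<integral>\<^sup>+x. ennreal (indicator {x. \<bar>x\<bar> < 1 \<and> pot (Complex x 0) < r} x * (dens x * (1 - x) powr a)) \<partial>lborel)
     \<le> (\<integral>\<^sup>+z. ennreal (cmod (1 - z) powr a) * indicator {z. pot z = r} z \<partial>level_measure r)"
proof -
  obtain R0 where R0: "0 < R0" "R0 < 1" "\<And>z. cmod z < 1 \<Longrightarrow> pot z \<le> r \<Longrightarrow> cmod z < R0"
    using sublevel_radius[OF r] by blast
  define R1 where "R1 = (1 + R0) / 2"
  define R2 where "R2 = (1 + R1) / 2"
  have R: "0 < R1" "R0 < R1" "R1 < R2" "R2 < 1" using R0 by (auto simp: R1_def R2_def)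
  obtain c where c: "smooth c" "\<And>z. cmod z \<le> R1 \<Longrightarrow> c z = 1" "\<And>z. R2 \<le> cmod z \<Longrightarrow> c z = 0"
    using radial_cutoff[of R1 R2] R by auto
  define Q where "Q z = (1 - z) powr complex_of_real a" for z
  have Q: "Q holomorphic_on unit_disc" unfolding Q_def[abs_def] by (rule one_minus_powr_holomorphic)
  define \<phi> where "\<phi> z = c z * Re (Q z)" for z
  have \<phi>: "\<phi> \<in> test_functions"
  proof (rule smooth_test_function[of _ "cball 0 R2"])
    show "smooth \<phi>"
      unfolding \<phi>_def[abs_def] by (rule smooth_cutoff[OF c(1) R(4) _ Q]) (simp add: c(3))
    show "\<phi> z = 0" if "z \<notin> cball 0 R2" for z using that c(3)[of z] by (simp add: \<phi>_def)
  qed (use R in auto)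
  have \<phi>_eq: "\<phi> z = Re (Q z)" if "cmod z \<le> R1" for z using c(2)[OF that] by (simp add: \<phi>_def)
  have lap0: "laplace \<phi> z = 0" if "cmod z < R1" for z
    by (rule laplace_Re_holomorphic[of Q "ball 0 R1"])
      (use that \<phi>_eq R in \<open>auto intro: holomorphic_on_subset[OF Q]\<close>)
  obtain R' px py pxx pyy where R': "R' < 1" "C2_compact R' \<phi> px py pxx pyy"
    using test_function_C2[OF \<phi>] by metis
  obtain B where B: "\<And>z. \<bar>\<phi> z\<bar> \<le> B"
    using compact_support_bounded_integrable(2)[OF C2_compactD(1)[OF R'(2)] C2_compactD(6)[OF R'(2)] R'(1)] by blast
  have m [measurable]: "\<phi> \<in> borel_measurable borel"
    using continuous_test_function[OF \<phi>] by (rule borel_measurable_continuous_onI)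
  let ?S = "{x. \<bar>x\<bar> < 1 \<and> pot (Complex x 0) < r}"
  have Sm [measurable]: "?S \<in> sets borel" by measurable
  note I = integral_level_measure[OF r m B]
  have i0: "integrable lborel (\<lambda>x. dens x * \<phi> (Complex x 0))"
  proof (rule Bochner_Integration.integrable_bound[of _ "\<lambda>x. B * dens x"])
    show "integrable lborel (\<lambda>x. B * dens x)" by (intro integrable_mult_right integrable_dens)
    show "AE x in lborel. norm (dens x * \<phi> (Complex x 0)) \<le> norm (B * dens x)"
    proof (rule AE_I2)
      fix x
      have "\<bar>\<phi> (Complex x 0)\<bar> \<le> \<bar>B\<bar>" using B[of "Complex x 0"] by linarith
      then show "norm (dens x * \<phi> (Complex x 0)) \<le> norm (B * dens x)"
        using mult_left_mono[of "\<bar>\<phi> (Complex x 0)\<bar>" "\<bar>B\<bar>" "\<bar>dens x\<bar>"] by (simp add: abs_mult mult.commute)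
    qed
  qed measurable
  have ind: "integrable lborel (\<lambda>x. indicator A x * (dens x * \<phi> (Complex x 0)))" if "A \<in> sets borel" for A
    using integrable_mult_indicator[OF _ i0, of A] that by simp
  \<comment> \<open>The two truncations differ on the sublevel set only.\<close>
  have same: "(\<integral>z\<in>unit_disc. max (pot z) r * laplace \<phi> z \<partial>lborel) = (\<integral>z\<in>unit_disc. max (pot z) deep_level * laplace \<phi> z \<partial>lborel)"
  proof (rule set_lebesgue_integral_cong, simp, intro allI impI)
    fix z assume z: "z \<in> unit_disc"
    show "max (pot z) r * laplace \<phi> z = max (pot z) deep_level * laplace \<phi> z"
    proof (cases "pot z < r")
      case True
      then have "cmod z < R0" using z R0(3)[of z] by simp
      then show ?thesis using lap0[of z] R by simp
    next
      case False
      then show ?thesis using deep_level_props(2)[of z] z by (simp add: max_def)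
    qed
  qed
  have "(\<integral>z. \<phi> z \<partial>level_measure r) =
      1 / (2 * pi) * ((\<integral>z\<in>unit_disc. max (pot z) r * laplace \<phi> z \<partial>lborel) -
        2 * pi * (\<integral>x. indicator (axis r) x * (dens x * \<phi> (Complex x 0)) \<partial>lborel))"
    unfolding I(2) laplacian_formula[OF r \<phi>] by simp
  also have "(\<integral>z\<in>unit_disc. max (pot z) r * laplace \<phi> z \<partial>lborel) =
      2 * pi * (\<integral>x. indicator {-1<..<1} x * (dens x * \<phi> (Complex x 0)) \<partial>lborel)"
    unfolding same laplacian_formula[OF deep_level_props(1) \<phi>] by (simp add: deep_level_props(4,5))
  also have "1 / (2 * pi) * (2 * pi * (\<integral>x. indicator {-1<..<1} x * (dens x * \<phi> (Complex x 0)) \<partial>lborel) -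
        2 * pi * (\<integral>x. indicator (axis r) x * (dens x * \<phi> (Complex x 0)) \<partial>lborel)) =
      (\<integral>x. indicator {-1<..<1} x * (dens x * \<phi> (Complex x 0)) \<partial>lborel) -
        (\<integral>x. indicator (axis r) x * (dens x * \<phi> (Complex x 0)) \<partial>lborel)"
    by (simp add: field_simps)
  also have "\<dots> = (\<integral>x. indicator {-1<..<1} x * (dens x * \<phi> (Complex x 0)) -
      indicator (axis r) x * (dens x * \<phi> (Complex x 0)) \<partial>lborel)"
    by (rule Bochner_Integration.integral_diff[symmetric]) (intro ind; simp)+
  also have "\<dots> = (\<integral>x. indicator ?S x * (dens x * \<phi> (Complex x 0)) \<partial>lborel)"
    by (intro Bochner_Integration.integral_cong) (auto simp: axis_def indicator_def abs_less_iff)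
  finally have mass: "(\<integral>z. \<phi> z \<partial>level_measure r) = (\<integral>x. indicator ?S x * (dens x * \<phi> (Complex x 0)) \<partial>lborel)" .
  have eq: "indicator ?S x * (dens x * \<phi> (Complex x 0)) = indicator ?S x * (dens x * (1 - x) powr a)" for x
  proof (cases "0 < x \<and> x < 1 \<and> x \<in> ?S")
    case True
    then have "cmod (Complex x 0) < R0" using R0(3)[of "Complex x 0"] by (simp add: cmod_def)
    then have "\<phi> (Complex x 0) = Re (Q (Complex x 0))" using \<phi>_eq R by simp
    moreover have "Q (Complex x 0) = complex_of_real ((1 - x) powr a)"
      using powr_of_real[of "1 - x" a] True by (simp add: Q_def complex_of_real_def[symmetric])
    ultimately show ?thesis by simp
  qed (auto simp: dens_0)
  have "(\<integral>\<^sup>+x. ennreal (indicator ?S x * (dens x * (1 - x) powr a)) \<partial>lborel) =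
      ennreal (\<integral>x. indicator ?S x * (dens x * (1 - x) powr a) \<partial>lborel)"
    by (rule nn_integral_eq_integral) (use ind[OF Sm] dens_nonneg in \<open>auto simp: eq\<close>)
  also have "\<dots> = ennreal (\<integral>z. \<phi> z \<partial>level_measure r)"
    unfolding mass eq ..
  also have "\<dots> \<le> (\<integral>\<^sup>+z. ennreal (\<phi> z) \<partial>level_measure r)"
    by (rule ennreal_integral_le[OF I(1)])
  also have "\<dots> \<le> (\<integral>\<^sup>+z. ennreal (cmod (1 - z) powr a) * indicator {z. pot z = r} z \<partial>level_measure r)"
  proof (rule nn_integral_mono_AE)
    show "AE z in level_measure r. ennreal (\<phi> z) \<le> ennreal (cmod (1 - z) powr a) * indicator {z. pot z = r} z"
      using AE_level_measure[OF r]
    proof eventually_elim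
      case (elim z)
      then have "cmod z < R0" using R0(3)[of z] by simp
      then have "\<phi> z = Re (Q z)" using \<phi>_eq R by simp
      also have "\<dots> \<le> cmod (Q z)" by (rule complex_Re_le_cmod)
      also have "\<dots> = cmod (1 - z) powr a" by (simp add: Q_def norm_powr_real_powr')
      finally show ?case using elim by (simp add: ennreal_leI)
    qed
  qed
  finally show ?thesis .
qed

text \<open>The integrand dominates \<open>1 / (1 - x)\<close>, whose primitive \<open>- ln (1 - x)\<close> is unbounded.\<close>

lemma segment_integral_infinite:
  assumes a: "a \<le> \<beta> - 1"
  shows "(\<integral>\<^sup>+x. ennreal (dens x * (1 - x) powr a) \<partial>lborel) = top"
proof -
  have *: "ennreal k \<le> (\<integral>\<^sup>+x. ennreal (dens x * (1 - x) powr a) \<partial>lborel)" if k: "0 < k" for k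
  proof -
    define c where "c = 1 - exp (- k)"
    have c: "0 \<le> c" "c < 1" using k by (auto simp: c_def)
    have "(\<integral>\<^sup>+x. ennreal (1 / (1 - x)) * indicator {0..c} x \<partial>lborel) = - ln (1 - c) - (- ln (1 - 0))"
    proof (rule nn_integral_FTC_Icc)
      show "((\<lambda>x. - ln (1 - x)) has_real_derivative 1 / (1 - x)) (at x)" if "x \<in> {0..c}" for x
        using that c by (auto intro!: derivative_eq_intros simp: field_simps)
    qed (use c in auto)
    then have "ennreal k = (\<integral>\<^sup>+x. ennreal (1 / (1 - x)) * indicator {0..c} x \<partial>lborel)"
      by (simp add: c_def)
    also have "\<dots> \<le> (\<integral>\<^sup>+x. ennreal (dens x * (1 - x) powr a) \<partial>lborel)"
    proof (rule nn_integral_mono_AE)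
      show "AE x in lborel. ennreal (1 / (1 - x)) * indicator {0..c} x \<le> ennreal (dens x * (1 - x) powr a)"
        using AE_lborel_singleton[of "0::real"]
      proof eventually_elim
        case (elim x)
        show ?case
        proof (cases "x \<in> {0..c}")
          case True
          then have x: "0 < x" "x < 1" using elim c by auto
          have "1 / (1 - x) = (1 - x) powr (- 1)" using x by (simp add: powr_minus field_simps)
          also have "\<dots> \<le> (1 - x) powr (a - \<beta>)" using x a by (intro powr_mono') auto
          also have "\<dots> = dens x * (1 - x) powr a" using x by (simp add: dens_def powr_diff)
          finally show ?thesis using True by (simp add: ennreal_leI)
        qed simp
      qed
    qed
    finally show ?thesis .
  qed
  have "ennreal (real (Suc n)) \<le> (\<integral>\<^sup>+x. ennreal (dens x * (1 - x) powr a) \<partial>lborel)" for n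
    by (rule *) simp
  then have "(SUP n. ennreal (real (Suc n))) \<le> (\<integral>\<^sup>+x. ennreal (dens x * (1 - x) powr a) \<partial>lborel)"
    by (rule SUP_least)
  moreover have "(SUP n. ennreal (real (Suc n))) = top"
  proof -
    have "(SUP n. of_nat n :: ennreal) \<le> (SUP n. ennreal (real (Suc n)))"
      by (rule SUP_mono) (metis UNIV_I ennreal_leI ennreal_of_nat_eq_real_of_nat le_SucI of_nat_le_iff order_refl)
    then show ?thesis by (simp add: ennreal_SUP_of_nat_eq_top top_unique)
  qed
  ultimately show ?thesis by (metis top_unique)
qed

text \<open>Every point of the segment lies in the sublevel set of \<open>r\<close> for \<open>r\<close> close to \<open>0\<close>, so the lower bounds increase
to the divergent integral over the segment.\<close>

theorem poletsky_stessin_norm2_infinite: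
  assumes u: "\<And>z. z \<in> unit_disc \<Longrightarrow> u z = ereal (pot z)"
    and f: "\<And>z. z \<in> unit_disc \<Longrightarrow> (cmod (f z))\<^sup>2 = cmod (1 - z) powr a"
    and a: "a \<le> \<beta> - 1"
  shows "poletsky_stessin_norm2 u f = \<infinity>"
proof -
  define L where "L r = (\<integral>\<^sup>+z\<in>level u r. ennreal ((cmod (f z))\<^sup>2) \<partial>demailly_measure u r)" for r
  define E where "E r = (\<integral>\<^sup>+x. ennreal (indicator {x. \<bar>x\<bar> < 1 \<and> pot (Complex x 0) < r} x * (dens x * (1 - x) powr a)) \<partial>lborel)" for r
  have LE: "E r \<le> L r" if r: "r < 0" for r
  proof -
    have sp: "space (level_measure r) = unit_disc"
      using sets_eq_imp_space_eq[of "level_measure r" disc_borel] by simp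
    have dm: "demailly_measure u r = level_measure r"
      by (rule demailly_measure_eq[OF r]) (rule u)
    have "L r = (\<integral>\<^sup>+z. ennreal (cmod (1 - z) powr a) * indicator {z. pot z = r} z \<partial>level_measure r)"
      unfolding L_def dm
      by (rule nn_integral_cong) (auto simp: sp f u level_def indicator_def)
    then show ?thesis using level_integral_lower_bound[OF r, of a] by (simp add: E_def)
  qed
  have mono: "E r \<le> E s" if "r \<le> s" for r s
    unfolding E_def using that dens_nonneg
    by (intro nn_integral_mono ennreal_leI mult_right_mono mult_nonneg_nonneg) (auto simp: indicator_def)
  define \<rho> where "\<rho> n = - inverse (real (Suc n))" for n
  have "(\<lambda>n. E (\<rho> n)) \<longlonglongrightarrow> (\<integral>\<^sup>+x. ennreal (dens x * (1 - x) powr a) \<partial>lborel)"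
    unfolding E_def
  proof (rule nn_integral_LIMSEQ)
    show "incseq (\<lambda>n x. ennreal (indicator {x. \<bar>x\<bar> < 1 \<and> pot (Complex x 0) < \<rho> n} x * (dens x * (1 - x) powr a)))"
    proof (intro incseq_SucI le_funI ennreal_leI mult_right_mono)
      fix n x
      have "\<rho> n \<le> \<rho> (Suc n)" by (simp add: \<rho>_def le_imp_inverse_le)
      then show "(indicator {x. \<bar>x\<bar> < 1 \<and> pot (Complex x 0) < \<rho> n} x :: real) \<le>
          indicator {x. \<bar>x\<bar> < 1 \<and> pot (Complex x 0) < \<rho> (Suc n)} x"
        by (auto simp: indicator_def)
    qed (simp add: dens_nonneg)
    show "(\<lambda>n. ennreal (indicator {x. \<bar>x\<bar> < 1 \<and> pot (Complex x 0) < \<rho> n} x * (dens x * (1 - x) powr a)))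
        \<longlonglongrightarrow> ennreal (dens x * (1 - x) powr a)" for x
    proof (cases "0 < x \<and> x < 1")
      case True
      then have "pot (Complex x 0) < 0" by (intro pot_neg) (simp add: cmod_def)
      moreover have "\<rho> \<longlonglongrightarrow> 0"
        unfolding \<rho>_def using tendsto_minus[OF LIMSEQ_inverse_real_of_nat] by simp
      ultimately have "\<forall>\<^sub>F n in sequentially. pot (Complex x 0) < \<rho> n" by (intro order_tendstoD)
      then have "\<forall>\<^sub>F n in sequentially. ennreal (dens x * (1 - x) powr a) =
          ennreal (indicator {x. \<bar>x\<bar> < 1 \<and> pot (Complex x 0) < \<rho> n} x * (dens x * (1 - x) powr a))"
        by eventually_elim (use True in simp)
      then show ?thesis by (rule Lim_transform_eventually[OF tendsto_const])
    qed (auto simp: dens_0)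
  qed measurable
  then have lim: "(\<lambda>n. E (\<rho> n)) \<longlonglongrightarrow> top"
    by (simp add: segment_integral_infinite[OF a])
  have "(L \<longlongrightarrow> top) (at_left 0)"
  proof (rule order_tendstoI)
    fix k :: ennreal assume "k < top"
    with lim have "\<forall>\<^sub>F n in sequentially. k < E (\<rho> n)" by (rule order_tendstoD)
    then obtain n where n: "k < E (\<rho> n)" using eventually_happens[of _ sequentially] by auto
    show "\<forall>\<^sub>F r in at_left 0. k < L r"
      unfolding eventually_at_left_field
    proof (intro exI[of _ "\<rho> n"] conjI allI impI)
      show "\<rho> n < 0" by (simp add: \<rho>_def)
      fix r assume "\<rho> n < r" "r < 0"
      then show "k < L r" using n mono[of "\<rho> n" r] LE[of r] by (meson less_imp_le less_le_trans)
    qed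
  qed auto
  then have "Lim (at_left 0) L = top"
    by (intro tendsto_Lim) auto
  then show ?thesis
    by (simp add: poletsky_stessin_norm2_def L_def[abs_def])
qed

end

section \<open>The classical Hardy space\<close>

lemma sin_ge_half:
  fixes t :: real
  assumes "0 \<le> t" "t \<le> pi / 2"
  shows "t / 2 \<le> sin t"
proof (cases "t \<le> pi / 3")
  case True
  have "sin 0 - 0 / 2 \<le> sin t - t / 2"
  proof (rule DERIV_nonneg_imp_nondecreasing[OF assms(1)])
    fix x assume x: "0 \<le> x" "x \<le> t"
    have "cos (pi / 3) \<le> cos x"
      using x True pi_gt_zero by (intro cos_monotone_0_pi_le) auto
    then show "\<exists>y. ((\<lambda>t. sin t - t / 2) has_real_derivative y) (at x) \<and> 0 \<le> y"
      by (intro exI[of _ "cos x - 1 / 2"]) (auto intro!: derivative_eq_intros simp: cos_60)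
  qed
  then show ?thesis by simp
next
  case False
  have "sin (pi / 3) \<le> sin t"
    using assms False pi_gt_zero by (intro sin_monotone_2pi_le) auto
  moreover have "sqrt 3 / 2 = sin (pi / 3)" by (simp add: sin_60)
  moreover have "(8 / 5)\<^sup>2 \<le> (3::real)" by (simp add: power2_eq_square)
  then have "8 / 5 \<le> sqrt 3" by (rule real_le_rsqrt)
  moreover have "pi \<le> 16 / 5" by (rule order_trans[OF pi_approx(2)]) simp
  then have "t \<le> 8 / 5" using assms(2) by linarith
  ultimately show ?thesis by linarith
qed

text \<open>The estimate \<open>\<bar>1 - \<rho> cis \<theta>\<bar>\<^sup>2 = (1 - \<rho>)\<^sup>2 + 4 \<rho> (sin (\<theta> / 2))\<^sup>2 \<ge> (sin (\<theta> / 2))\<^sup>2\<close> is uniform in the radius \<open>\<rho>\<close>.\<close>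

lemma circle_distance_bound:
  assumes \<rho>: "0 \<le> \<rho>" "\<rho> < 1" and \<theta>: "0 < \<theta>" "\<theta> < 2 * pi"
  shows "min (\<theta> / 4) ((2 * pi - \<theta>) / 4) \<le> cmod (1 - of_real \<rho> * cis \<theta>)"
proof -
  have "sin (\<theta> / 2) \<le> cmod (1 - of_real \<rho> * cis \<theta>)"
  proof (rule power2_le_imp_le)
    have c: "cos \<theta> = 1 - 2 * (sin (\<theta> / 2))\<^sup>2"
      using cos_double_sin[of "\<theta> / 2"] by simp
    define S where "S = (sin (\<theta> / 2))\<^sup>2"
    have S: "0 \<le> S" "S \<le> 1" by (auto simp: S_def abs_square_le_1)
    have "(cmod (1 - of_real \<rho> * cis \<theta>))\<^sup>2 = (1 - \<rho> * cos \<theta>)\<^sup>2 + (\<rho> * sin \<theta>)\<^sup>2"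
      unfolding cmod_power2 by simp
    also have "\<dots> = 1 - 2 * \<rho> * cos \<theta> + \<rho>\<^sup>2 * ((cos \<theta>)\<^sup>2 + (sin \<theta>)\<^sup>2)"
      (is "?l = ?r")
    proof -
      have "(1 - \<rho> * a)\<^sup>2 + (\<rho> * b)\<^sup>2 = 1 - 2 * \<rho> * a + \<rho>\<^sup>2 * (a\<^sup>2 + b\<^sup>2)" for a b :: real
        by (simp add: power2_eq_square algebra_simps)
      then show ?thesis .
    qed
    also have "\<dots> = 1 - 2 * \<rho> * cos \<theta> + \<rho>\<^sup>2" by simp
    also have "\<dots> = (1 - \<rho>)\<^sup>2 + 4 * \<rho> * S"
      unfolding S_def c by (simp add: power2_eq_square algebra_simps)
    finally have e: "(cmod (1 - of_real \<rho> * cis \<theta>))\<^sup>2 = (1 - \<rho>)\<^sup>2 + 4 * \<rho> * S" .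
    have "(1 - \<rho>)\<^sup>2 + 4 * \<rho> * S - S = (1 - \<rho>)\<^sup>2 * (1 - S) + \<rho> * (2 + \<rho>) * S"
      by (simp add: power2_eq_square algebra_simps)
    moreover have "0 \<le> (1 - \<rho>)\<^sup>2 * (1 - S) + \<rho> * (2 + \<rho>) * S"
      using S \<rho> by simp
    ultimately have "0 \<le> (1 - \<rho>)\<^sup>2 + 4 * \<rho> * S - S" by simp
    then show "(sin (\<theta> / 2))\<^sup>2 \<le> (cmod (1 - of_real \<rho> * cis \<theta>))\<^sup>2"
      unfolding e by (simp add: S_def)
  qed simp
  moreover have "min (\<theta> / 4) ((2 * pi - \<theta>) / 4) \<le> sin (\<theta> / 2)"
  proof (cases "\<theta> \<le> pi")
    case True
    then show ?thesis using sin_ge_half[of "\<theta> / 2"] \<theta> by simp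
  next
    case False
    have "sin (\<theta> / 2) = sin (pi - \<theta> / 2)" by simp
    then show ?thesis using sin_ge_half[of "pi - \<theta> / 2"] \<theta> False by (simp add: field_simps min_def)
  qed
  ultimately show ?thesis by linarith
qed

text \<open>The means over all circles have the common integrable majorant given by the distance to the two ends of the
interval \<open>(0, 2 \<pi>)\<close>. The values of \<open>f\<close> outside the disc are arbitrary, possibly not measurable, so the integrand is
replaced first, almost everywhere on the circle.\<close>

theorem one_minus_powr_hardy:
  assumes a: "0 < a" "a < 1"
    and hol: "f holomorphic_on unit_disc"
    and f: "\<And>z. z \<in> unit_disc \<Longrightarrow> (cmod (f z))\<^sup>2 = cmod (1 - z) powr (- a)"
  shows "f \<in> hardy"
proof -
  define g where "g \<theta> = cut_power a (\<theta> / 4) + cut_power a ((2 * pi - \<theta>) / 4)" for \<theta>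
  \<comment> \<open>The division by \<open>4\<close> keeps the arguments in \<open>[0, 2]\<close>, where the truncation has no effect.\<close>
  have "integrable lborel (\<lambda>\<theta>. cut_power a (0 + (1 / 4) * \<theta>) + cut_power a (pi / 2 + (- 1 / 4) * \<theta>))"
    using a by (intro Bochner_Integration.integrable_add lborel_integrable_real_affine integrable_cut_power) auto
  also have "(\<lambda>\<theta>. cut_power a (0 + (1 / 4) * \<theta>) + cut_power a (pi / 2 + (- 1 / 4) * \<theta>)) = g"
    by (simp add: g_def fun_eq_iff field_simps)
  finally have g: "integrable lborel g" .
  have g0: "0 \<le> g \<theta>" for \<theta> by (simp add: g_def cut_power_nonneg)
  let ?I = "\<integral>\<^sup>+\<theta>. ennreal (g \<theta>) \<partial>lborel"
  have "(\<integral>\<^sup>+\<zeta>. ennreal ((cmod (f (of_real \<rho> * \<zeta>)))\<^sup>2) \<partial>circle_measure) \<le> ?I / emeasure lborel {0..<2 * pi}"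
    if \<rho>: "\<rho> \<in> {0..<1}" for \<rho>
  proof -
    have cisM: "cis \<in> measurable (uniform_measure lborel {0..<2 * pi}) borel"
      unfolding measurable_cong_sets[OF sets_uniform_measure refl]
      by (simp add: borel_measurable_continuous_onI continuous_on_cis continuous_on_id)
    have "AE \<zeta> in circle_measure. cmod \<zeta> = 1"
      unfolding circle_measure_def by (subst AE_distr_iff[OF cisM]) auto
    then have "AE \<zeta> in circle_measure. ennreal ((cmod (f (of_real \<rho> * \<zeta>)))\<^sup>2) = ennreal (cmod (1 - of_real \<rho> * \<zeta>) powr (- a))"
      by eventually_elim (use \<rho> in \<open>simp add: f norm_mult\<close>)
    then have "(\<integral>\<^sup>+\<zeta>. ennreal ((cmod (f (of_real \<rho> * \<zeta>)))\<^sup>2) \<partial>circle_measure) =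
       (\<integral>\<^sup>+\<zeta>. ennreal (cmod (1 - of_real \<rho> * \<zeta>) powr (- a)) \<partial>circle_measure)"
      by (rule nn_integral_cong_AE)
    also have "\<dots> = (\<integral>\<^sup>+\<theta>. ennreal (cmod (1 - of_real \<rho> * cis \<theta>) powr (- a)) \<partial>uniform_measure lborel {0..<2 * pi})"
      unfolding circle_measure_def by (rule nn_integral_distr[OF cisM]) measurable
    also have "\<dots> = (\<integral>\<^sup>+\<theta>. ennreal (cmod (1 - of_real \<rho> * cis \<theta>) powr (- a)) * indicator {0..<2 * pi} \<theta> \<partial>lborel) /
        emeasure lborel {0..<2 * pi}"
      using cisM by (intro nn_integral_uniform_measure) auto
    also have "\<dots> \<le> ?I / emeasure lborel {0..<2 * pi}"
    proof (intro divide_right_mono_ennreal nn_integral_mono_AE)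
      show "AE \<theta> in lborel. ennreal (cmod (1 - of_real \<rho> * cis \<theta>) powr (- a)) * indicator {0..<2 * pi} \<theta> \<le> ennreal (g \<theta>)"
        using AE_lborel_singleton[of "0::real"]
      proof eventually_elim
        case (elim \<theta>)
        show ?case
        proof (cases "\<theta> \<in> {0..<2 * pi}")
          case True
          then have \<theta>: "0 < \<theta>" "\<theta> < 2 * pi" using elim by auto
          let ?m = "min (\<theta> / 4) ((2 * pi - \<theta>) / 4)"
          have "cmod (1 - of_real \<rho> * cis \<theta>) powr (- a) \<le> ?m powr (- a)"
            using circle_distance_bound[of \<rho> \<theta>] \<rho> \<theta> a by (intro powr_mono2') auto
          also have "\<dots> \<le> (\<theta> / 4) powr (- a) + ((2 * pi - \<theta>) / 4) powr (- a)"
            by (auto simp: min_def)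
          also have "\<dots> = g \<theta>"
            using \<theta> pi_less_4 by (simp add: g_def cut_power_def)
          finally show ?thesis using True by (simp add: ennreal_leI)
        qed simp
      qed
    qed
    finally show ?thesis .
  qed
  then have "hardy_norm2 f \<le> ?I / emeasure lborel {0..<2 * pi}"
    unfolding hardy_norm2_def by (rule SUP_least)
  also have "\<dots> < \<infinity>"
    using integrableD(2)[OF g] by (auto simp: less_top[symmetric] ennreal_divide_eq_top_iff)
  finally show ?thesis using hol by (simp add: hardy_def)
qed

theorem theorem3p2:
  fixes \<alpha> \<beta> :: real and u :: "complex \<Rightarrow> ereal" and f :: "complex \<Rightarrow> complex"
  assumes "0 < \<beta>" and "\<beta> < 1"
    and "\<And>z. z \<in> unit_disc \<Longrightarrow>
      u z = ereal (\<integral>s\<in>{0<..<1::real}.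
        ln (cmod ((z - of_real s) / (1 - of_real s * z))) * (1 / (1 - s) powr \<beta>) \<partial>lborel)"
    and "(1 - \<beta>) / 2 \<le> \<alpha>" and "\<alpha> < 1 / 2"
    and "\<And>z. z \<in> unit_disc \<Longrightarrow> f z = 1 / (1 - z) powr (of_real \<alpha>)"
  shows "f \<in> hardy \<and> f \<notin> poletsky_stessin_hardy u"
proof -
  interpret segment_potential \<beta>
    using assms(1,2) by unfold_locales
  have u: "u z = ereal (pot z)" if "z \<in> unit_disc" for z
    unfolding assms(3)[OF that] pot_def kernel_def dens_def set_lebesgue_integral_def
    by (simp add: mult_ac)
  have mod_f: "(cmod (f z))\<^sup>2 = cmod (1 - z) powr (- (2 * \<alpha>))" if z: "z \<in> unit_disc" for z
  proof -
    have "cmod (f z) = cmod (1 - z) powr (- \<alpha>)"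
      using z by (simp add: assms(6) norm_divide norm_inverse norm_powr_real_powr' powr_minus divide_inverse)
    then show ?thesis
      by (simp add: power2_eq_square powr_add[symmetric])
  qed
  have "(\<lambda>z. 1 / (1 - z) powr (of_real \<alpha>)) holomorphic_on unit_disc"
    by (intro holomorphic_intros one_minus_powr_holomorphic) (use one_minus_not_nonpos in auto)
  then have hol: "f holomorphic_on unit_disc"
    by (rule holomorphic_transform) (simp add: assms(6))
  have "f \<in> hardy"
    by (rule one_minus_powr_hardy[OF _ _ hol mod_f]) (use assms in auto)
  moreover have "poletsky_stessin_norm2 u f = \<infinity>"
    by (rule poletsky_stessin_norm2_infinite[OF u mod_f]) (use assms in auto)
  ultimately show ?thesis
    by (simp add: poletsky_stessin_hardy_def)
qed

end
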